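(* Let $n\ge 2$ and let $f_n$ and $f_{n-1}$ be even continuous nonnegative functions on $\mathbb R^n$ such that $$t\,\frac{f_n(tx)}{f_{n-1}(tx)}$$ is an increasing function of $t$ for any fixed $x\in S^{n-1}$. Let $K$ be an origin-symmetric star-shaped body in $\mathbb R^n$ such that $$\|x\|_K^{-1}\,\frac{f_n\left(\frac{x}{\|x\|_K}\right)}{f_{n-1}\left(\frac{x}{\|x\|_K}\right)}$$ is a positive definite distribution on $\mathbb R^n$. Then for any origin-symmetric star-shaped body $L$ in $\mathbb R^n$ satisfying $$\mu_{n-1}(K\cap\xi^\perp)\le \mu_{n-1}(L\cap\xi^\perp)\qquad\text{for all }\xi\in S^{n-1},$$ we have $$\mu_n(K)\le\mu_n(L).$$
   Context: $\mu_n$ is the measure on $\mathbb R^n$ with density $f_n$. For $\xi\in S^{n-1}$, $\xi^\perp$ is the hyperplane through the origin orthogonal to $\xi$, and $\mu_{n-1}(B)=\int_B f_{n-1}(x)\,dx$ for bounded Borel $B\subset\xi^\perp$, where $dx$ is $(n-1)$-dimensional Lebesgue measure on $\xi^\perp$. A star-shaped body is a compact set with non-empty interior that is star-shaped with respect to the origin. Its Minkowski functional is $\|x\|_K=\min\{a>0: x\in aK\}$. The Fourier transform of a tempered distribution $f$ is defined by $\langle\hat f,\phi\rangle=\langle f,\hat\phi\rangle$ for Schwartz functions $\phi$, with $\hat\phi(\xi)=\int\phi(x)e^{-i(x,\xi)}dx$. A distribution $f$ is positive definite iff $\langle\hat f,\phi\rangle\ge0$ for every nonnegative Schwartz function $\phi$.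 *)

theory Defs
  imports "HOL-Analysis.Analysis"
begin

definition star_shaped_body :: "'a::euclidean_space set \<Rightarrow> bool" where
  "star_shaped_body K \<longleftrightarrow>
     compact K \<and> interior K \<noteq> {} \<and> 0 \<in> K \<and> (\<forall>x\<in>K. closed_segment 0 x \<subseteq> K)"

definition origin_symmetric :: "'a::real_vector set \<Rightarrow> bool" where
  "origin_symmetric K \<longleftrightarrow> uminus ` K = K"

text \<open>A star-shaped body need not contain the origin in its interior, so no multiple of it may
  contain \<open>x\<close>; the value is then \<open>\<infinity>\<close>. For \<open>x \<noteq> 0\<close> and compact \<open>K\<close> a finite infimum is
  attained; for \<open>x = 0 \<in> K\<close> the value is \<open>0\<close>.\<close>

definition minkowski_functional :: "'a::real_vector set \<Rightarrow> 'a \<Rightarrow> ereal" where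
  "minkowski_functional K x = (INF a\<in>{a. 0 < a \<and> x \<in> (\<lambda>y. a *\<^sub>R y) ` K}. ereal a)"

text \<open>The reciprocal of the Minkowski functional, with \<open>1 / \<infinity> = 0\<close>. Its value at \<open>x = 0\<close>,
  where the reciprocal is infinite, is irrelevant because it is only used under an integral.\<close>

definition inv_minkowski :: "'a::real_vector set \<Rightarrow> 'a \<Rightarrow> real" where
  "inv_minkowski K x = real_of_ereal (inverse (minkowski_functional K x))"

definition mu :: "('a::euclidean_space \<Rightarrow> real) \<Rightarrow> 'a measure" where
  "mu f = density lborel (\<lambda>x. ennreal (f x))"

definition hyperplane_perp :: "'a::real_inner \<Rightarrow> 'a set" where
  "hyperplane_perp \<xi> = {x. \<xi> \<bullet> x = 0}"

definition orthonormal_basis_of :: "'a::euclidean_space set \<Rightarrow> 'a set \<Rightarrow> bool" where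
  "orthonormal_basis_of V B \<longleftrightarrow>
     pairwise orthogonal B \<and> (\<forall>b\<in>B. norm b = 1) \<and> span B = V"

text \<open>Lebesgue measure of dimension \<open>dim V\<close> on a linear subspace \<open>V\<close>, as a Borel measure on the
  ambient space that is carried by \<open>V\<close>: the image of the product Lebesgue measure under
  orthonormal coordinates, exactly as \<^const>\<open>lborel\<close> is built from \<^const>\<open>Basis\<close>. By rotation
  invariance it does not depend on the chosen orthonormal basis.\<close>

definition subspace_lborel :: "'a::euclidean_space set \<Rightarrow> 'a measure" where
  "subspace_lborel V =
     (let B = (SOME B. orthonormal_basis_of V B)
      in distr (\<Pi>\<^sub>M b\<in>B. (lborel :: real measure)) borel (\<lambda>c. \<Sum>b\<in>B. c b *\<^sub>R b))"

definition mu_perp :: "('a::euclidean_space \<Rightarrow> real) \<Rightarrow> 'a \<Rightarrow> 'a measure" where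
  "mu_perp f \<xi> = density (subspace_lborel (hyperplane_perp \<xi>)) (\<lambda>x. ennreal (f x))"

primrec iter_partial :: "'a::euclidean_space list \<Rightarrow> ('a \<Rightarrow> complex) \<Rightarrow> 'a \<Rightarrow> complex" where
  "iter_partial [] \<phi> = \<phi>"
| "iter_partial (b # bs) \<phi> = (\<lambda>x. frechet_derivative (iter_partial bs \<phi>) (at x) b)"

definition schwartz :: "('a::euclidean_space \<Rightarrow> complex) set" where
  "schwartz = {\<phi>. \<forall>bs\<in>lists Basis.
     (\<forall>x. iter_partial bs \<phi> differentiable (at x)) \<and>
     (\<forall>k::nat. bounded (range (\<lambda>x. norm x ^ k *\<^sub>R iter_partial bs \<phi> x)))}"

definition schwartz_seminorm :: "nat \<Rightarrow> 'a::euclidean_space list \<Rightarrow> ('a \<Rightarrow> complex) \<Rightarrow> real" where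
  "schwartz_seminorm k bs \<phi> = (SUP x. norm x ^ k * norm (iter_partial bs \<phi> x))"

text \<open>Continuity of a linear functional for the Schwartz topology is stated as a bound by
  finitely many seminorms.\<close>

definition tempered_distribution :: "(('a::euclidean_space \<Rightarrow> complex) \<Rightarrow> complex) \<Rightarrow> bool" where
  "tempered_distribution T \<longleftrightarrow>
     (\<forall>\<phi>\<in>schwartz. \<forall>\<psi>\<in>schwartz. T (\<lambda>x. \<phi> x + \<psi> x) = T \<phi> + T \<psi>) \<and>
     (\<forall>\<phi>\<in>schwartz. \<forall>c. T (\<lambda>x. c * \<phi> x) = c * T \<phi>) \<and>
     (\<exists>C. \<exists>N::nat. \<forall>\<phi>\<in>schwartz.
        norm (T \<phi>) \<le> C * (\<Sum>k\<le>N. \<Sum>bs\<in>{bs\<in>lists Basis. length bs \<le> N}.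
                              schwartz_seminorm k bs \<phi>))"

definition fourier :: "('a::euclidean_space \<Rightarrow> complex) \<Rightarrow> 'a \<Rightarrow> complex" where
  "fourier \<phi> \<xi> = (LINT x|lborel. \<phi> x * exp (- \<i> * complex_of_real (x \<bullet> \<xi>)))"

definition fourier_distribution ::
  "(('a::euclidean_space \<Rightarrow> complex) \<Rightarrow> complex) \<Rightarrow> ('a \<Rightarrow> complex) \<Rightarrow> complex" where
  "fourier_distribution T \<phi> = T (fourier \<phi>)"

definition positive_definite_distribution ::
  "(('a::euclidean_space \<Rightarrow> complex) \<Rightarrow> complex) \<Rightarrow> bool" where
  "positive_definite_distribution T \<longleftrightarrow>
     tempered_distribution T \<and>
     (\<forall>\<phi>\<in>schwartz. (\<forall>x. \<phi> x \<in> \<real>\<^sub>\<ge>\<^sub>0) \<longrightarrow> fourier_distribution T \<phi> \<in> \<real>\<^sub>\<ge>\<^sub>0)"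

definition function_distribution ::
  "('a::euclidean_space \<Rightarrow> real) \<Rightarrow> ('a \<Rightarrow> complex) \<Rightarrow> complex" where
  "function_distribution g \<phi> = (LINT x|lborel. complex_of_real (g x) * \<phi> x)"

end

theory Submission
  imports Defs "HOL-Probability.Probability"
begin

text \<open>
  Let \<open>g\<close> be the positive definite function attached to \<open>K\<close>; it is even and homogeneous of degree
  \<open>-1\<close>. The monotonicity hypothesis says that \<open>f\<^sub>n \<le> g f\<^sub>n\<^sub>1\<close> on \<open>K\<close> and \<open>f\<^sub>n \<ge> g f\<^sub>n\<^sub>1\<close> off \<open>K\<close>, so it
  suffices that the integral of \<open>g f\<^sub>n\<^sub>1\<close> over \<open>K\<close> is at most that over \<open>L\<close>.

  Testing positive definiteness on shifted Gaussians shows that the Fourier transform \<open>S\<close> of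
  \<open>g(z) exp(-|z|\<^sup>2/2T\<^sup>2)\<close> is nonnegative. Integrate \<open>S(\<eta>) exp(-|\<eta>|\<^sup>2/2) / |\<eta>|\<close> against the measure of the
  section by \<open>\<eta>\<^sup>\<bottom>\<close>, a monotone operation. Exchanging \<open>\<eta>\<close> and \<open>x\<close> in the incidence relation
  \<open>\<eta> \<bullet> x = 0\<close> and then using that the integral of a Fourier transform over \<open>x\<^sup>\<bottom>\<close> is an integral over
  the line through \<open>x\<close>, one obtains the integral of \<open>f\<^sub>n\<^sub>1(x)\<close> over the body against line integrals
  of a mollification of \<open>g\<close>. These grow like \<open>g(x) log T\<close>, and comparing the coefficients of \<open>log T\<close>
  gives the claim. Since only measurability of \<open>g\<close> is available, the coefficient is extracted by means
  of the continuity of translations in \<open>L\<^sup>1\<close>.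
\<close>

section \<open>Gaussian integrals\<close>

text \<open>Along the line r x the function \<open>g\<close> behaves like g(x)/|r|, whose integral
  diverges at both ends; this is why two Gaussians occur. The one in z, of width T, cuts off
  infinity and makes \<open>S\<close> an honest function. The one in eta is dual to a mollification
  at scale 1 and removes the divergence at the origin. Between the scales 1 and T the integrand is
  essentially g(x)/|r|, whence the logarithm: in the limit, each doubling of T adds one fixed
  multiple of g(x).

  The weight 1/|eta| is there because Lebesgue measure on eta^perp divided by |eta| is the
  distribution delta(eta . x), which is symmetric in eta and x. Constant factors are harmless, since
  they multiply the terms of both bodies alike.

  The origin may lie on the boundary of \<open>K\<close>, as for a double cone. The radial function
  then vanishes in some directions and may be discontinuous, so that mollifications of
  \<open>g\<close> need not converge at every point. The argument therefore moves the mollifying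
  shift into an integral over x, where convergence in the mean is enough.\<close>

lemma nn_integral_translate:
  fixes f :: "'a::euclidean_space \<Rightarrow> ennreal"
  assumes [measurable]: "f \<in> borel_measurable borel"
  shows "(\<integral>\<^sup>+x. f (x + t) \<partial>lborel) = (\<integral>\<^sup>+x. f x \<partial>lborel)"
proof -
  have "(\<integral>\<^sup>+x. f x \<partial>lborel) = (\<integral>\<^sup>+x. f x \<partial>(distr lborel borel ((+) t)))"
    by (simp add: lborel_distr_plus)
  also have "\<dots> = (\<integral>\<^sup>+x. f (x + t) \<partial>lborel)"
    by (subst nn_integral_distr) (auto simp: add.commute)
  finally show ?thesis by simp
qed

lemma nn_integral_reflect_translate:
  fixes f :: "'a::euclidean_space \<Rightarrow> ennreal"
  assumes [measurable]: "f \<in> borel_measurable borel"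
  shows "(\<integral>\<^sup>+x. f (t - x) \<partial>lborel) = (\<integral>\<^sup>+x. f x \<partial>lborel)"
proof -
  have "(\<integral>\<^sup>+x. f x \<partial>lborel)
      = (\<integral>\<^sup>+x. f x \<partial>(density (distr lborel borel (\<lambda>x. t + (-1) *\<^sub>R x)) (\<lambda>_. 1)))"
    using lborel_affine[of "-1" t] by simp
  also have "\<dots> = (\<integral>\<^sup>+x. f (t - x) \<partial>lborel)"
    by (simp add: nn_integral_density nn_integral_distr)
  finally show ?thesis by simp
qed

lemma nn_integral_scale:
  fixes f :: "'a::euclidean_space \<Rightarrow> ennreal"
  assumes [measurable]: "f \<in> borel_measurable borel" and c: "c \<noteq> 0"
  shows "(\<integral>\<^sup>+x. f x \<partial>lborel) = ennreal (\<bar>c\<bar> ^ DIM('a)) * (\<integral>\<^sup>+x. f (c *\<^sub>R x) \<partial>lborel)"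
proof -
  have "(\<integral>\<^sup>+x. f x \<partial>lborel)
      = (\<integral>\<^sup>+x. f x \<partial>(density (distr lborel borel (\<lambda>x. 0 + c *\<^sub>R x)) (\<lambda>_. \<bar>c\<bar>^DIM('a))))"
    using lborel_affine[OF c, of "0::'a"] by simp
  also have "\<dots> = ennreal (\<bar>c\<bar> ^ DIM('a)) * (\<integral>\<^sup>+x. f (c *\<^sub>R x) \<partial>lborel)"
    by (simp add: nn_integral_density nn_integral_distr nn_integral_cmult ennreal_power)
  finally show ?thesis .
qed

text \<open>The value is read off from the characteristic function of the standard normal
  distribution, after its normalising constant has been moved to the other side.\<close>

lemma gaussian_fourier_std_real:
  "integrable lborel (\<lambda>x::real. complex_of_real (exp (-(x\<^sup>2)/2)) * exp (\<i> * complex_of_real (t * x)))"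
  "(LINT x|lborel. complex_of_real (exp (-(x\<^sup>2)/2)) * exp (\<i> * complex_of_real (t * x)))
     = complex_of_real (sqrt (2*pi) * exp (-(t\<^sup>2)/2))"
proof -
  have i0: "integrable lborel (\<lambda>x::real. exp (-(x\<^sup>2)/2))"
  proof -
    have "integrable lborel (\<lambda>x. sqrt (2*pi) * std_normal_density x)" by simp
    then show ?thesis by (simp add: std_normal_density_def)
  qed
  show "integrable lborel (\<lambda>x::real. complex_of_real (exp (-(x\<^sup>2)/2)) * exp (\<i> * complex_of_real (t * x)))"
    by (rule Bochner_Integration.integrable_bound[OF i0]) (auto simp: norm_mult)
  have "char std_normal_distribution t
      = (LINT x|lborel. std_normal_density x *\<^sub>R exp (\<i> * complex_of_real (t * x)))"
    unfolding char_def by (subst integral_density) auto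
  also have "\<dots> = (LINT x|lborel. complex_of_real (1 / sqrt (2*pi)) *
      (complex_of_real (exp (-(x\<^sup>2)/2)) * exp (\<i> * complex_of_real (t * x))))"
    by (simp add: std_normal_density_def scaleR_conv_of_real)
  also have "\<dots> = complex_of_real (1 / sqrt (2*pi)) *
      (LINT x|lborel. (complex_of_real (exp (-(x\<^sup>2)/2)) * exp (\<i> * complex_of_real (t * x))))"
    by (rule integral_mult_right_zero)
  finally have "complex_of_real (exp (-(t\<^sup>2)/2)) = complex_of_real (1 / sqrt (2*pi)) *
      (LINT x|lborel. (complex_of_real (exp (-(x\<^sup>2)/2)) * exp (\<i> * complex_of_real (t * x))))"
    by (simp add: char_std_normal_distribution)
  moreover have "complex_of_real (sqrt (2*pi)) * complex_of_real (1 / sqrt (2*pi)) = 1"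
    by (simp flip: of_real_mult)
  ultimately show "(LINT x|lborel. complex_of_real (exp (-(x\<^sup>2)/2)) * exp (\<i> * complex_of_real (t * x)))
     = complex_of_real (sqrt (2*pi) * exp (-(t\<^sup>2)/2))"
    by (metis (no_types, lifting) mult.assoc mult_1 of_real_mult)
qed

lemma gaussian_fourier_real:
  assumes s: "s > 0"
  shows "integrable lborel (\<lambda>x::real. complex_of_real (exp (-(s\<^sup>2*x\<^sup>2)/2)) * exp (\<i> * complex_of_real (t * x)))"
  "(LINT x|lborel. complex_of_real (exp (-(s\<^sup>2*x\<^sup>2)/2)) * exp (\<i> * complex_of_real (t * x)))
     = complex_of_real (sqrt (2*pi) / s * exp (-(t\<^sup>2)/(2 * s\<^sup>2)))"
proof -
  let ?f = "\<lambda>x::real. complex_of_real (exp (-(x\<^sup>2)/2)) * exp (\<i> * complex_of_real (t/s * x))"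
  have eq: "(\<lambda>x. ?f (0 + s * x)) = (\<lambda>x::real. complex_of_real (exp (-(s\<^sup>2*x\<^sup>2)/2)) * exp (\<i> * complex_of_real (t * x)))"
    using s by (auto simp: power_mult_distrib)
  show "integrable lborel (\<lambda>x::real. complex_of_real (exp (-(s\<^sup>2*x\<^sup>2)/2)) * exp (\<i> * complex_of_real (t * x)))"
    using lborel_integrable_real_affine[OF gaussian_fourier_std_real(1)[of "t/s"], of s 0] s unfolding eq by simp
  have "complex_of_real (sqrt (2*pi) * exp (-((t/s)\<^sup>2)/2)) = s *\<^sub>R (LINT x|lborel. ?f (0 + s * x))"
    unfolding gaussian_fourier_std_real(2)[of "t/s", symmetric]
    using lborel_integral_real_affine[of s ?f 0] s by simp
  then have "complex_of_real (sqrt (2*pi) * exp (-((t/s)\<^sup>2)/2)) = 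
     complex_of_real s * (LINT x|lborel. complex_of_real (exp (-(s\<^sup>2*x\<^sup>2)/2)) * exp (\<i> * complex_of_real (t * x)))"
    unfolding eq by (simp add: scaleR_conv_of_real)
  then show "(LINT x|lborel. complex_of_real (exp (-(s\<^sup>2*x\<^sup>2)/2)) * exp (\<i> * complex_of_real (t * x)))
     = complex_of_real (sqrt (2*pi) / s * exp (-(t\<^sup>2)/(2 * s\<^sup>2)))"
    using s by (simp add: power_divide field_simps)
qed

section \<open>Gaussian integrals in several variables\<close>

lemma
  fixes f :: "'a::euclidean_space \<Rightarrow> real \<Rightarrow> complex"
  assumes f: "\<And>b. b \<in> Basis \<Longrightarrow> integrable lborel (f b)"
  shows integrable_lborel_prod: "integrable lborel (\<lambda>x. \<Prod>b\<in>Basis. f b (x \<bullet> b))"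
    and integral_lborel_prod: "(LINT x|lborel. (\<Prod>b\<in>Basis. f b (x \<bullet> b))) = (\<Prod>b\<in>Basis. LINT t|lborel. f b t)"
proof -
  interpret product_sigma_finite "\<lambda>_::'a. lborel::real measure"
    by standard
  have [measurable]: "f b \<in> borel_measurable borel" if "b \<in> Basis" for b
    using f[OF that] by (auto dest: borel_measurable_integrable)
  have m[measurable]: "(\<lambda>x. \<Prod>b\<in>Basis. f b (x \<bullet> b)) \<in> borel_measurable borel"
    by measurable
  show "integrable lborel (\<lambda>x. \<Prod>b\<in>Basis. f b (x \<bullet> b))"
    by (subst lborel_eq, subst integrable_distr_eq)
       (auto intro!: product_integrable_prod f cong: prod.cong)
  show "(LINT x|lborel. (\<Prod>b\<in>Basis. f b (x \<bullet> b))) = (\<Prod>b\<in>Basis. LINT t|lborel. f b t)"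
    by (subst lborel_eq, subst integral_distr)
       (auto simp: product_integral_prod f cong: prod.cong)
qed

lemma
  fixes z :: "'a::euclidean_space"
  assumes s: "s > 0"
  shows integrable_gaussian_exp:
      "integrable lborel (\<lambda>x::'a. complex_of_real (exp (-(s\<^sup>2*(norm x)\<^sup>2)/2)) * exp (\<i> * complex_of_real (x \<bullet> z)))"
   and gaussian_fourier: "(LINT x|lborel. complex_of_real (exp (-(s\<^sup>2*(norm x)\<^sup>2)/2)) * exp (\<i> * complex_of_real (x \<bullet> z)))
     = complex_of_real ((sqrt (2*pi) / s)^DIM('a) * exp (-((norm z)\<^sup>2)/(2 * s\<^sup>2)))"
proof -
  define f where "f b = (\<lambda>x::real. complex_of_real (exp (-(s\<^sup>2*x\<^sup>2)/2)) * exp (\<i> * complex_of_real ((z \<bullet> b) * x)))" for b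
  have n2: "(norm x)\<^sup>2 = (\<Sum>b\<in>Basis. (x \<bullet> b)\<^sup>2)" for x :: 'a
    unfolding power2_norm_eq_inner euclidean_inner[of x x] by (simp add: power2_eq_square)
  have eq: "(\<lambda>x::'a. complex_of_real (exp (-(s\<^sup>2*(norm x)\<^sup>2)/2)) * exp (\<i> * complex_of_real (x \<bullet> z)))
     = (\<lambda>x. \<Prod>b\<in>Basis. f b (x \<bullet> b))"
  proof
    fix x :: 'a
    have "(\<Prod>b\<in>Basis. exp (-(s\<^sup>2*(x \<bullet> b)\<^sup>2)/2)) = exp (-(s\<^sup>2*(norm x)\<^sup>2)/2)"
      unfolding n2 by (subst exp_sum[symmetric]) (auto simp: sum_distrib_left sum_divide_distrib sum_negf)
    then have 1: "(\<Prod>b\<in>Basis. complex_of_real (exp (-(s\<^sup>2*(x \<bullet> b)\<^sup>2)/2))) = complex_of_real (exp (-(s\<^sup>2*(norm x)\<^sup>2)/2))"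
      by (simp only: of_real_prod[symmetric])
    have "(\<Prod>b\<in>Basis. exp (\<i> * complex_of_real ((z \<bullet> b) * (x \<bullet> b)))) = exp (\<i> * complex_of_real (x \<bullet> z))"
      unfolding euclidean_inner[of x z]
      by (subst exp_sum[symmetric]) (auto simp: sum_distrib_left mult_ac)
    with 1 show "complex_of_real (exp (-(s\<^sup>2*(norm x)\<^sup>2)/2)) * exp (\<i> * complex_of_real (x \<bullet> z)) = (\<Prod>b\<in>Basis. f b (x \<bullet> b))"
      unfolding f_def prod.distrib by simp
  qed
  have i: "integrable lborel (f b)" for b
    unfolding f_def by (rule gaussian_fourier_real(1)[OF s])
  show "integrable lborel (\<lambda>x::'a. complex_of_real (exp (-(s\<^sup>2*(norm x)\<^sup>2)/2)) * exp (\<i> * complex_of_real (x \<bullet> z)))"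
    unfolding eq by (rule integrable_lborel_prod) (rule i)
  have "(LINT x|lborel. complex_of_real (exp (-(s\<^sup>2*(norm x)\<^sup>2)/2)) * exp (\<i> * complex_of_real (x \<bullet> z)))
     = (\<Prod>b\<in>Basis. LINT t|lborel. f b t)"
    unfolding eq by (rule integral_lborel_prod) (rule i)
  also have "\<dots> = (\<Prod>b\<in>Basis. complex_of_real (sqrt (2*pi) / s * exp (-((z \<bullet> b)\<^sup>2)/(2 * s\<^sup>2))))"
    unfolding f_def by (intro prod.cong refl gaussian_fourier_real(2)[OF s])
  also have "\<dots> = complex_of_real ((sqrt (2*pi) / s)^DIM('a) * (\<Prod>b\<in>Basis. exp (-((z \<bullet> b)\<^sup>2)/(2 * s\<^sup>2))))"
    by (simp only: of_real_prod[symmetric] prod.distrib prod_constant)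
  also have "(\<Prod>b\<in>Basis. exp (-((z \<bullet> b)\<^sup>2)/(2 * s\<^sup>2))) = exp (-((norm z)\<^sup>2)/(2 * s\<^sup>2))"
    unfolding n2 by (subst exp_sum[symmetric]) (auto simp: sum_divide_distrib sum_negf)
  finally show "(LINT x|lborel. complex_of_real (exp (-(s\<^sup>2*(norm x)\<^sup>2)/2)) * exp (\<i> * complex_of_real (x \<bullet> z)))
     = complex_of_real ((sqrt (2*pi) / s)^DIM('a) * exp (-((norm z)\<^sup>2)/(2 * s\<^sup>2)))" .
qed

lemma nn_integral_gaussian:
  assumes s: "s > 0"
  shows "integral\<^sup>N lborel (\<lambda>x::'a::euclidean_space. ennreal (exp (-(s\<^sup>2*(norm x)\<^sup>2)/2))) = ennreal ((sqrt (2*pi) / s)^DIM('a))"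
proof -
  have i: "integrable lborel (\<lambda>x::'a. exp (-(s\<^sup>2*(norm x)\<^sup>2)/2))"
    using integrable_gaussian_exp[OF s, of "0::'a"] by (simp add: complex_of_real_integrable_eq)
  have "complex_of_real (LINT (x::'a)|lborel. exp (-(s\<^sup>2*(norm x)\<^sup>2)/2)) = complex_of_real ((sqrt (2*pi) / s)^DIM('a))"
    using gaussian_fourier[OF s, of "0::'a"] by (simp flip: integral_complex_of_real)
  then have "(LINT (x::'a)|lborel. exp (-(s\<^sup>2*(norm x)\<^sup>2)/2)) = ((sqrt (2*pi) / s)^DIM('a))"
    by (simp only: of_real_eq_iff)
  then show ?thesis
    by (subst nn_integral_eq_integral[OF i]) auto
qed

lemma nn_integral_gaussian_real:
  assumes "s > 0"
  shows "(\<integral>\<^sup>+(x::real). ennreal (exp (-(s\<^sup>2*x\<^sup>2)/2)) \<partial>lborel) = ennreal (sqrt (2*pi) / s)"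
  using nn_integral_gaussian[OF assms, where 'a=real] by simp

lemma nn_integral_inverse_1_plus_square:
  "(\<integral>\<^sup>+(x::real). ennreal (1 / (1 + x\<^sup>2)) \<partial>lborel) < \<infinity>"
proof -
  have "set_integrable lborel {0<..} (\<lambda>x. 1 / (1 + x^2) :: real)"
    using integrable_I0i_1_div_plus_square
    by (simp add: interval_lebesgue_integrable_def zero_ereal_def)
  then have i: "integrable lborel (\<lambda>x::real. indicator {0<..} x * (1 / (1 + x^2)))"
    by (simp add: set_integrable_def)
  have i2: "integrable lborel (\<lambda>x::real. indicator {0<..} (-x) * (1 / (1 + x^2)))"
    using lborel_integrable_real_affine[OF i, of "-1" 0] by simp
  have "integrable lborel (\<lambda>x::real. indicator {0<..} x * (1 / (1 + x^2)) + indicator {0<..} (-x) * (1 / (1 + x^2)) + indicator {0} x)"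
    by (intro Bochner_Integration.integrable_add i i2) auto
  moreover have "(\<lambda>x::real. indicator {0<..} x * (1 / (1 + x^2)) + indicator {0<..} (-x) * (1 / (1 + x^2)) + indicator {0} x) = (\<lambda>x. 1 / (1 + x^2))"
    by (auto simp: fun_eq_iff indicator_def)
  ultimately have "integrable lborel (\<lambda>x::real. 1 / (1 + x^2))" by metis
  then show ?thesis by (auto simp: integrable_iff_bounded)
qed

text \<open>The factor 1/|x| is itself a Gaussian integral: exp(-t^2 |x|^2 / 2) integrates over t to
  sqrt(2 pi)/|x|. Exchanging x and t leaves a constant times the integral of (s^2 + t^2)^(-n/2) over
  t, which converges because n is at least 2. No polar coordinates are involved.\<close>

lemma nn_integral_inverse_norm_gaussian_finite:
  assumes dim: "DIM('a::euclidean_space) \<ge> 2" and s: "s > 0"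
  shows "(\<integral>\<^sup>+(x::'a). ennreal (1 / norm x * exp (-(s\<^sup>2*(norm x)\<^sup>2)/2)) \<partial>lborel) < \<infinity>"
proof -
  have eq: "ennreal (1 / norm x * exp (-(s\<^sup>2*(norm x)\<^sup>2)/2)) =
     ennreal (1 / sqrt (2*pi)) * (\<integral>\<^sup>+(t::real). ennreal (exp (-(((sqrt (s\<^sup>2 + t\<^sup>2))\<^sup>2)*(norm x)\<^sup>2)/2)) \<partial>lborel)" if "x \<noteq> 0" for x :: 'a
  proof -
    have "(\<integral>\<^sup>+(t::real). ennreal (exp (-((sqrt (s\<^sup>2 + t\<^sup>2))\<^sup>2*(norm x)\<^sup>2)/2)) \<partial>lborel)
      = (\<integral>\<^sup>+(t::real). ennreal (exp (-(s\<^sup>2*(norm x)\<^sup>2)/2)) * ennreal (exp (-((norm x)\<^sup>2*t\<^sup>2)/2)) \<partial>lborel)"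
      by (intro nn_integral_cong) (simp flip: ennreal_mult' exp_add add: field_simps)
    also have "\<dots> = ennreal (exp (-(s\<^sup>2*(norm x)\<^sup>2)/2)) * ennreal (sqrt (2*pi) / norm x)"
      using that nn_integral_gaussian_real[of "norm x"] by (subst nn_integral_cmult) auto
    finally show ?thesis
      by (simp flip: ennreal_mult')
  qed
  have "(\<integral>\<^sup>+(x::'a). ennreal (1 / norm x * exp (-(s\<^sup>2*(norm x)\<^sup>2)/2)) \<partial>lborel)
     = (\<integral>\<^sup>+(x::'a). ennreal (1 / sqrt (2*pi)) * (\<integral>\<^sup>+(t::real). ennreal (exp (-(((sqrt (s\<^sup>2 + t\<^sup>2))\<^sup>2)*(norm x)\<^sup>2)/2)) \<partial>lborel) \<partial>lborel)"
    by (rule nn_integral_cong_AE, rule AE_mp[OF AE_lborel_singleton[of "0::'a"]]) (intro AE_I2 impI eq)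
  also have "\<dots> = ennreal (1 / sqrt (2*pi)) * (\<integral>\<^sup>+(x::'a). (\<integral>\<^sup>+(t::real). ennreal (exp (-(((sqrt (s\<^sup>2 + t\<^sup>2))\<^sup>2)*(norm x)\<^sup>2)/2)) \<partial>lborel) \<partial>lborel)"
    by (rule nn_integral_cmult) measurable
  finally have *: "(\<integral>\<^sup>+(x::'a). ennreal (1 / norm x * exp (-(s\<^sup>2*(norm x)\<^sup>2)/2)) \<partial>lborel) = ennreal (1 / sqrt (2*pi)) * (\<integral>\<^sup>+(x::'a). (\<integral>\<^sup>+(t::real). ennreal (exp (-(((sqrt (s\<^sup>2 + t\<^sup>2))\<^sup>2)*(norm x)\<^sup>2)/2)) \<partial>lborel) \<partial>lborel)" .
  have "(\<integral>\<^sup>+(x::'a). (\<integral>\<^sup>+(t::real). ennreal (exp (-(((sqrt (s\<^sup>2 + t\<^sup>2))\<^sup>2)*(norm x)\<^sup>2)/2)) \<partial>lborel) \<partial>lborel)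
     = (\<integral>\<^sup>+(t::real). (\<integral>\<^sup>+(x::'a). ennreal (exp (-(((sqrt (s\<^sup>2 + t\<^sup>2))\<^sup>2)*(norm x)\<^sup>2)/2)) \<partial>lborel) \<partial>lborel)"
    by (rule lborel_pair.Fubini') measurable
  also have "\<dots> = (\<integral>\<^sup>+(t::real). ennreal ((sqrt (2*pi) / sqrt (s\<^sup>2 + t\<^sup>2))^DIM('a)) \<partial>lborel)"
    using s by (intro nn_integral_cong nn_integral_gaussian) (auto simp: add_pos_nonneg)
  \<comment> \<open>Two of the n factors (s^2 + t^2)^(-1/2) supply the decay 1/(1 + t^2); each of
    the other n - 2 is at most 1/s.\<close>
  also have "\<dots> \<le> (\<integral>\<^sup>+(t::real). ennreal ((sqrt (2*pi))^DIM('a) * (1/s)^(DIM('a) - 2) * max 1 (1/s\<^sup>2)) * ennreal (1 / (1 + t\<^sup>2)) \<partial>lborel)"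
  proof (intro nn_integral_mono)
    fix t :: real
    obtain d where d: "DIM('a) = d + 2" using dim by (metis add.commute le_Suc_ex)
    have pos: "s\<^sup>2 + t\<^sup>2 > 0" "1 + t\<^sup>2 > 0" using s by (simp_all add: add_pos_nonneg)
    have "s \<le> sqrt (s\<^sup>2 + t\<^sup>2)" using s by (intro real_le_rsqrt) simp
    then have 1: "1 / sqrt (s\<^sup>2 + t\<^sup>2) \<le> 1 / s" using s by (intro divide_left_mono) (auto simp: add_pos_nonneg)
    have "1 + t\<^sup>2 \<le> max 1 (1/s\<^sup>2) * (s\<^sup>2 + t\<^sup>2)"
    proof -
      have "1 = (1/s\<^sup>2) * s\<^sup>2" using s by simp
      also have "\<dots> \<le> max 1 (1/s\<^sup>2) * s\<^sup>2" by (intro mult_right_mono) auto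
      finally have "1 \<le> max 1 (1/s\<^sup>2) * s\<^sup>2" .
      moreover have "1 * t\<^sup>2 \<le> max 1 (1/s\<^sup>2) * t\<^sup>2" by (intro mult_right_mono) auto
      ultimately show ?thesis by (simp add: distrib_left)
    qed
    then have 2: "1 / (s\<^sup>2 + t\<^sup>2) \<le> max 1 (1/s\<^sup>2) * (1 / (1 + t\<^sup>2))"
      using pos by (simp add: field_simps)
    have "(1 / sqrt (s\<^sup>2 + t\<^sup>2))^DIM('a) = (1 / sqrt (s\<^sup>2 + t\<^sup>2))^d * (1 / (s\<^sup>2 + t\<^sup>2))"
      unfolding d power_add using pos by (simp add: power_divide)
    also have "\<dots> \<le> (1/s)^d * (max 1 (1/s\<^sup>2) * (1 / (1 + t\<^sup>2)))"
      using pos s by (intro mult_mono power_mono 1 2) auto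
    finally have 3: "(1 / sqrt (s\<^sup>2 + t\<^sup>2))^DIM('a) \<le> (1/s)^d * (max 1 (1/s\<^sup>2) * (1 / (1 + t\<^sup>2)))" .
    have "(sqrt (2*pi) / sqrt (s\<^sup>2 + t\<^sup>2))^DIM('a) = sqrt (2*pi)^DIM('a) * (1 / sqrt (s\<^sup>2 + t\<^sup>2))^DIM('a)"
      by (simp add: power_divide)
    also have "\<dots> \<le> sqrt (2*pi)^DIM('a) * ((1/s)^d * (max 1 (1/s\<^sup>2) * (1 / (1 + t\<^sup>2))))"
      by (intro mult_left_mono 3) auto
    finally show "ennreal ((sqrt (2*pi) / sqrt (s\<^sup>2 + t\<^sup>2))^DIM('a)) \<le> ennreal ((sqrt (2*pi))^DIM('a) * (1/s)^(DIM('a) - 2) * max 1 (1/s\<^sup>2)) * ennreal (1 / (1 + t\<^sup>2))"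
      using s by (subst ennreal_mult[symmetric]) (auto simp: d intro!: ennreal_leI simp: mult_ac)
  qed
  also have "\<dots> = ennreal ((sqrt (2*pi))^DIM('a) * (1/s)^(DIM('a) - 2) * max 1 (1/s\<^sup>2)) * (\<integral>\<^sup>+(t::real). ennreal (1 / (1 + t\<^sup>2)) \<partial>lborel)"
    by (rule nn_integral_cmult) measurable
  also have "\<dots> < \<infinity>"
    using nn_integral_inverse_1_plus_square by (simp add: ennreal_mult_less_top)
  finally show ?thesis
    unfolding * by (simp add: ennreal_mult_less_top)
qed

section \<open>Positive definiteness tested on Gaussians\<close>

text \<open>These are the polynomials in x - c times one fixed Gaussian. The class is generated by
  rules because the derivative of the Gaussian is again obtained by \<open>linear\<close> and
  \<open>scale\<close>; membership of all iterated partial derivatives then follows by rule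
  induction, without any explicit polynomial.\<close>

inductive gaussian_poly :: "real \<Rightarrow> 'a::euclidean_space \<Rightarrow> ('a \<Rightarrow> complex) \<Rightarrow> bool"
  for s :: real and c :: 'a where
  gauss: "gaussian_poly s c (\<lambda>x. complex_of_real (exp (-(s\<^sup>2*(norm (x - c))\<^sup>2)/2)))"
| add: "gaussian_poly s c f \<Longrightarrow> gaussian_poly s c g \<Longrightarrow> gaussian_poly s c (\<lambda>x. f x + g x)"
| scale: "gaussian_poly s c f \<Longrightarrow> gaussian_poly s c (\<lambda>x. a * f x)"
| linear: "gaussian_poly s c f \<Longrightarrow> gaussian_poly s c (\<lambda>x. complex_of_real ((x - c) \<bullet> b) * f x)"

lemma gaussian_poly_has_derivative:
  assumes "gaussian_poly s c f"
  shows "\<exists>f'. (\<forall>x. (f has_derivative (\<lambda>h. f' h x)) (at x)) \<and> (\<forall>h. gaussian_poly s c (f' h))"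
  using assms
proof induction
  case gauss
  let ?f' = "\<lambda>h x. complex_of_real (- s\<^sup>2) * (complex_of_real ((x - c) \<bullet> h) * complex_of_real (exp (-(s\<^sup>2*(norm (x - c))\<^sup>2)/2)))"
  have "((\<lambda>x. complex_of_real (exp (-(s\<^sup>2*(norm (x - c))\<^sup>2)/2))) has_derivative (\<lambda>h. ?f' h x)) (at x)" for x
  proof -
    have "((\<lambda>x. exp (-(s\<^sup>2*((x - c) \<bullet> (x - c)))/2)) has_derivative
      (\<lambda>h. (- s\<^sup>2) * (((x - c) \<bullet> h) * exp (-(s\<^sup>2*((x - c) \<bullet> (x - c)))/2)))) (at x)"
      by (rule derivative_eq_intros refl | simp)+ (simp add: fun_eq_iff inner_commute)
    then show ?thesis
      unfolding power2_norm_eq_inner of_real_mult[symmetric] by (rule has_derivative_of_real)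
  qed
  moreover have "gaussian_poly s c (?f' h)" for h
    by (intro gaussian_poly.intros)
  ultimately show ?case by (intro exI[of _ ?f']) blast
next
  case (add f g)
  then obtain f' g' where fg: "\<And>x. (f has_derivative (\<lambda>h. f' h x)) (at x)" "\<And>h. gaussian_poly s c (f' h)"
    "\<And>x. (g has_derivative (\<lambda>h. g' h x)) (at x)" "\<And>h. gaussian_poly s c (g' h)" by blast
  show ?case
    by (rule exI[of _ "\<lambda>h x. f' h x + g' h x"]) (auto intro!: fg has_derivative_add gaussian_poly.add)
next
  case (scale f a)
  then obtain f' where fg: "\<And>x. (f has_derivative (\<lambda>h. f' h x)) (at x)" "\<And>h. gaussian_poly s c (f' h)" by blast
  show ?case
    by (rule exI[of _ "\<lambda>h x. a * f' h x"]) (auto intro!: fg has_derivative_mult_right gaussian_poly.scale)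
next
  case (linear f b)
  then obtain f' where fg: "\<And>x. (f has_derivative (\<lambda>h. f' h x)) (at x)" "\<And>h. gaussian_poly s c (f' h)" by blast
  have "((\<lambda>x. complex_of_real ((x - c) \<bullet> b) * f x) has_derivative
     (\<lambda>h. complex_of_real ((x - c) \<bullet> b) * f' h x + complex_of_real (h \<bullet> b) * f x)) (at x)" for x
    by (rule derivative_eq_intros fg(1) refl | simp)+
  moreover have "gaussian_poly s c (\<lambda>x. complex_of_real ((x - c) \<bullet> b) * f' h x + complex_of_real (h \<bullet> b) * f x)" for h
    by (intro gaussian_poly.intros fg linear.hyps)
  ultimately show ?case
    by (intro exI[of _ "\<lambda>h x. complex_of_real ((x - c) \<bullet> b) * f' h x + complex_of_real (h \<bullet> b) * f x"]) auto
qed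

lemma gaussian_poly_iter_partial:
  "gaussian_poly s c f \<Longrightarrow> gaussian_poly s c (iter_partial bs f)"
proof (induction bs)
  case (Cons b bs)
  then obtain f' where f': "\<And>x. (iter_partial bs f has_derivative (\<lambda>h. f' h x)) (at x)" "\<And>h. gaussian_poly s c (f' h)"
    using gaussian_poly_has_derivative by blast
  have "frechet_derivative (iter_partial bs f) (at x) = (\<lambda>h. f' h x)" for x
    using frechet_derivative_at[OF f'(1)[of x]] by simp
  then have "iter_partial (b # bs) f = f' b" by auto
  with f'(2) show ?case by metis
qed simp

text \<open>With u = s^2 r^2 / 2 the exponential series gives u^k <= k! exp(u). As u is quadratic in
  r, this controls r^(2k), and r^k <= 1 + r^(2k) covers odd powers without square roots.\<close>

lemma power_times_gaussian_bounded:
  assumes s: "s > 0"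
  shows "\<exists>C. \<forall>r\<ge>0. r ^ k * exp (-(s\<^sup>2*r\<^sup>2)/2) \<le> (C::real)"
proof -
  have "r ^ k * exp (-(s\<^sup>2*r\<^sup>2)/2) \<le> 1 + (2/s\<^sup>2)^k * fact k" if r: "r \<ge> 0" for r
  proof -
    define u where "u = s\<^sup>2*r\<^sup>2/2"
    have u: "u \<ge> 0" by (simp add: u_def)
    have "u ^ k / fact k \<le> exp u"
    proof -
      have "u ^ k / fact k \<le> (\<Sum>n. u ^ n /\<^sub>R fact n)"
        using sum_le_suminf[OF summable_exp_generic[of u], of "{k}"] u
        by (auto simp: divide_inverse mult.commute)
      then show ?thesis by (simp add: exp_def)
    qed
    then have 1: "u ^ k * exp (- u) \<le> fact k"
      by (simp add: exp_minus field_simps)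
    have "r ^ k \<le> 1 + (r\<^sup>2) ^ k"
    proof (cases "r \<le> 1")
      case True then have "r ^ k \<le> 1" using r by (simp add: power_le_one)
      then show ?thesis by (smt (verit) zero_le_power2 zero_le_power)
    next
      case False
      then have "r \<le> r\<^sup>2" by (simp add: power2_eq_square)
      then have "r ^ k \<le> (r\<^sup>2) ^ k" using r by (intro power_mono)
      then show ?thesis by simp
    qed
    also have "(r\<^sup>2) ^ k = (2/s\<^sup>2)^k * u ^ k"
      using s by (simp add: u_def flip: power_mult_distrib) (simp add: power_mult_distrib)
    finally have "r ^ k * exp (-u) \<le> (1 + (2/s\<^sup>2)^k * u ^ k) * exp (-u)"
      by (rule mult_right_mono) simp
    also have "\<dots> = exp (-u) + (2/s\<^sup>2)^k * (u ^ k * exp (-u))" by (simp add: algebra_simps)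
    also have "\<dots> \<le> 1 + (2/s\<^sup>2)^k * fact k"
      using u 1 by (intro add_mono mult_left_mono) auto
    finally show ?thesis by (simp add: u_def)
  qed
  then show ?thesis by blast
qed

text \<open>The exponent \<open>k\<close> must vary in the induction: the rule \<open>linear\<close>
  contributes a factor that Cauchy-Schwarz bounds by |x - c| |b|, so decay of order k for the
  product needs decay of order k + 1 for \<open>f\<close>.\<close>

lemma gaussian_poly_decay:
  assumes "gaussian_poly s c f" and s: "s > 0"
  shows "\<exists>C. \<forall>x. norm (x - c) ^ k * norm (f x) \<le> C"
  using assms(1)
proof (induction arbitrary: k)
  case gauss
  obtain C where "\<And>r. r \<ge> 0 \<Longrightarrow> r ^ k * exp (-(s\<^sup>2*r\<^sup>2)/2) \<le> C"
    using power_times_gaussian_bounded[OF s, of k] by blast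
  then show ?case by (intro exI[of _ C]) auto
next
  case (add f g)
  obtain C D where C: "\<And>x. norm (x - c) ^ k * norm (f x) \<le> C" "\<And>x. norm (x - c) ^ k * norm (g x) \<le> D"
    using add.IH(1)[of k] add.IH(2)[of k] by blast
  have "norm (x - c) ^ k * norm (f x + g x) \<le> C + D" for x
  proof -
    have "norm (x - c) ^ k * norm (f x + g x) \<le> norm (x - c) ^ k * (norm (f x) + norm (g x))"
      by (intro mult_left_mono norm_triangle_ineq) auto
    then show ?thesis using C[of x] by (simp add: distrib_left)
  qed
  then show ?case by blast
next
  case (scale f a)
  obtain C where C: "\<And>x. norm (x - c) ^ k * norm (f x) \<le> C"
    using scale.IH[of k] by blast
  have "norm (x - c) ^ k * norm (a * f x) \<le> norm a * C" for x
    using mult_left_mono[OF C[of x], of "norm a"] by (simp add: norm_mult mult_ac)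
  then show ?case by blast
next
  case (linear f b)
  obtain C where C: "\<And>x. norm (x - c) ^ Suc k * norm (f x) \<le> C"
    using linear.IH[of "Suc k"] by blast
  have "norm (x - c) ^ k * norm (complex_of_real ((x - c) \<bullet> b) * f x) \<le> norm b * C" for x
  proof -
    have "norm (x - c) ^ k * norm (complex_of_real ((x - c) \<bullet> b) * f x)
        = (norm (x - c) ^ k * norm (f x)) * \<bar>(x - c) \<bullet> b\<bar>"
      by (simp add: norm_mult mult_ac)
    also have "\<dots> \<le> (norm (x - c) ^ k * norm (f x)) * (norm (x - c) * norm b)"
      by (intro mult_left_mono Cauchy_Schwarz_ineq2) auto
    also have "\<dots> = norm b * (norm (x - c) ^ Suc k * norm (f x))" by (simp add: mult_ac)
    also have "\<dots> \<le> norm b * C" by (intro mult_left_mono C) auto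
    finally show ?thesis .
  qed
  then show ?case by blast
qed

lemma gaussian_poly_schwartz:
  assumes f: "gaussian_poly s c f" and s: "s > 0"
  shows "f \<in> schwartz"
  unfolding schwartz_def mem_Collect_eq
proof (intro ballI conjI allI)
  fix bs :: "'a list" and x :: 'a
  have g: "gaussian_poly s c (iter_partial bs f)" by (rule gaussian_poly_iter_partial[OF f])
  show "iter_partial bs f differentiable at x"
    using gaussian_poly_has_derivative[OF g] unfolding differentiable_def by blast
next
  fix bs :: "'a list" and k :: nat
  have g: "gaussian_poly s c (iter_partial bs f)" by (rule gaussian_poly_iter_partial[OF f])
  obtain C D where C: "\<And>x. norm (x - c) ^ k * norm (iter_partial bs f x) \<le> C"
    and D: "\<And>x. norm (x - c) ^ 0 * norm (iter_partial bs f x) \<le> D"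
    using gaussian_poly_decay[OF g s, of k] gaussian_poly_decay[OF g s, of 0] by blast
  \<comment> \<open>Decay is known in powers of |x - c|, but the Schwartz condition asks for powers
    of |x|. As |x| is at most twice the larger of |x - c| and |c|, the bound \<open>C\<close> of
    order k and the plain bound \<open>D\<close> together suffice.\<close>
  have "norm (norm x ^ k *\<^sub>R iter_partial bs f x) \<le> 2^k * (C + norm c ^ k * D)" for x
  proof -
    have "norm x \<le> norm (x - c) + norm c" using norm_triangle_ineq[of "x - c" c] by simp
    also have "\<dots> \<le> 2 * max (norm (x - c)) (norm c)" by simp
    finally have "norm x ^ k \<le> (2 * max (norm (x - c)) (norm c)) ^ k" by (intro power_mono) auto
    also have "\<dots> \<le> 2^k * (norm (x - c) ^ k + norm c ^ k)"
      unfolding power_mult_distrib by (intro mult_left_mono) (auto simp: max_def)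
    finally have "norm x ^ k * norm (iter_partial bs f x) \<le> 2^k * (norm (x - c) ^ k + norm c ^ k) * norm (iter_partial bs f x)"
      by (rule mult_right_mono) simp
    also have "\<dots> = 2^k * (norm (x - c) ^ k * norm (iter_partial bs f x) + norm c ^ k * norm (iter_partial bs f x))"
      by (simp add: algebra_simps)
    also have "\<dots> \<le> 2^k * (C + norm c ^ k * D)"
      using C[of x] D[of x] by (intro mult_left_mono add_mono) auto
    finally show ?thesis by simp
  qed
  then show "bounded (range (\<lambda>x. norm x ^ k *\<^sub>R iter_partial bs f x))"
    unfolding bounded_iff by blast
qed

lemma fourier_gaussian:
  fixes \<eta> z :: "'a::euclidean_space"
  assumes T: "T > 0"
  shows "fourier (\<lambda>\<xi>. complex_of_real (exp (-(T\<^sup>2*(norm (\<xi> - \<eta>))\<^sup>2)/2))) z =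
    complex_of_real ((sqrt (2*pi) / T)^DIM('a)) *
     (complex_of_real (exp (-((norm z)\<^sup>2)/(2 * T\<^sup>2))) * exp (- \<i> * complex_of_real (\<eta> \<bullet> z)))"
proof -
  let ?f = "\<lambda>\<xi>::'a. complex_of_real (exp (-(T\<^sup>2*(norm (\<xi> - \<eta>))\<^sup>2)/2)) * exp (- \<i> * complex_of_real (\<xi> \<bullet> z))"
  have m: "?f \<in> borel_measurable borel" by measurable
  have "(LINT x|lborel. ?f x) = (LINT x|distr lborel borel ((+) \<eta>). ?f x)"
    by (simp add: lborel_distr_plus)
  also have "\<dots> = (LINT x|lborel. ?f (\<eta> + x))"
    by (rule integral_distr) (auto intro: m)
  also have "\<dots> = (LINT x|lborel. exp (- \<i> * complex_of_real (\<eta> \<bullet> z)) *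
      (complex_of_real (exp (-(T\<^sup>2*(norm x)\<^sup>2)/2)) * exp (\<i> * complex_of_real (x \<bullet> (-z)))))"
    by (intro Bochner_Integration.integral_cong) (auto simp: inner_add_left algebra_simps simp flip: exp_add)
  also have "\<dots> = exp (- \<i> * complex_of_real (\<eta> \<bullet> z)) * complex_of_real ((sqrt (2*pi) / T)^DIM('a) * exp (-((norm (-z))\<^sup>2)/(2 * T\<^sup>2)))"
    unfolding integral_mult_right_zero gaussian_fourier[OF T] ..
  finally show ?thesis unfolding fourier_def by (simp add: mult_ac)
qed

text \<open>Tested against shifted Gaussians, positive definiteness says that the Fourier transform of
  \<open>g\<close> times any centred Gaussian is nonnegative; nothing else is needed from it.\<close>

lemma positive_definite_gaussian_transform:
  fixes g :: "'a::euclidean_space \<Rightarrow> real"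
  assumes pd: "positive_definite_distribution (function_distribution g)" and T: "T > 0"
  shows "(LINT z|lborel. complex_of_real (g z * exp (-((norm z)\<^sup>2)/(2 * T\<^sup>2))) * exp (- \<i> * complex_of_real (\<eta> \<bullet> z))) \<in> \<real>\<^sub>\<ge>\<^sub>0"
proof -
  let ?\<phi> = "\<lambda>\<xi>. complex_of_real (exp (-(T\<^sup>2*(norm (\<xi> - \<eta>))\<^sup>2)/2))"
  let ?I = "LINT z|lborel. complex_of_real (g z * exp (-((norm z)\<^sup>2)/(2 * T\<^sup>2))) * exp (- \<i> * complex_of_real (\<eta> \<bullet> z))"
  let ?c = "(sqrt (2*pi) / T)^DIM('a)"
  have "?\<phi> \<in> schwartz"
    by (rule gaussian_poly_schwartz[OF gaussian_poly.gauss T])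
  then have "fourier_distribution (function_distribution g) ?\<phi> \<in> \<real>\<^sub>\<ge>\<^sub>0"
    using pd unfolding positive_definite_distribution_def by (auto simp: nonneg_Reals_of_real_iff)
  also have "fourier_distribution (function_distribution g) ?\<phi> =
     (LINT z|lborel. complex_of_real ?c * (complex_of_real (g z * exp (-((norm z)\<^sup>2)/(2 * T\<^sup>2))) * exp (- \<i> * complex_of_real (\<eta> \<bullet> z))))"
    unfolding fourier_distribution_def function_distribution_def fourier_gaussian[OF T]
    by (intro Bochner_Integration.integral_cong) (auto simp: mult_ac)
  also have "\<dots> = complex_of_real ?c * ?I"
    by (rule integral_mult_right_zero)
  finally have "complex_of_real ?c * ?I \<in> \<real>\<^sub>\<ge>\<^sub>0" .
  moreover have "?c > 0" using T by simp
  ultimately show ?thesis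
    using T unfolding complex_nonneg_Reals_iff by (simp add: zero_le_mult_iff del: zero_less_power)
qed

section \<open>Lebesgue measure on hyperplanes\<close>

text \<open>Translation invariance determines Lebesgue measure up to a factor, and a rotation-invariant
  Gaussian shows that the factor is \<open>1\<close>.\<close>

lemma nn_integral_orthogonal_transformation:
  fixes T :: "'a::euclidean_space \<Rightarrow> 'a" and G :: "'a \<Rightarrow> ennreal"
  assumes T: "orthogonal_transformation T" and [measurable]: "G \<in> borel_measurable borel"
  shows "(\<integral>\<^sup>+x. G (T x) \<partial>lborel) = (\<integral>\<^sup>+x. G x \<partial>lborel)"
proof -
  have lT: "linear T" using T orthogonal_transformation_linear by blast
  then have [measurable]: "T \<in> borel_measurable borel"
    by (intro borel_measurable_continuous_onI linear_continuous_on) (simp add: linear_conv_bounded_linear)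
  define w where "w x = ennreal (exp (-(1\<^sup>2*(norm x)\<^sup>2)/2))" for x :: 'a
  have [measurable]: "w \<in> borel_measurable borel" unfolding w_def by measurable
  have wT: "w (T x) = w x" for x using T by (simp add: w_def orthogonal_transformation_norm)
  have tr: "(\<integral>\<^sup>+y. G (a + y) \<partial>lborel) = (\<integral>\<^sup>+y. G y \<partial>lborel)" for a
    using nn_integral_translate[of G a] by (simp add: add.commute)
  define c where "c = (\<integral>\<^sup>+x. w x \<partial>lborel)"
  have c: "c = ennreal ((sqrt (2*pi) / 1)^DIM('a))" unfolding c_def w_def by (rule nn_integral_gaussian) simp
  \<comment> \<open>The double integral of G(Tx) w(Tx - y) is evaluated twice. Integrating y first
    gives the left side. Shifting x by the preimage of y first, and using w(Tx) = w(x), gives the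
    integral of \<open>G\<close> times \<open>c\<close>.\<close>
  have "(\<integral>\<^sup>+x. G (T x) \<partial>lborel) * c = (\<integral>\<^sup>+x. G (T x) * c \<partial>lborel)"
    by (rule nn_integral_multc[symmetric]) measurable
  also have "\<dots> = (\<integral>\<^sup>+x. \<integral>\<^sup>+y. G (T x) * w (T x - y) \<partial>lborel \<partial>lborel)"
    unfolding c_def by (rule nn_integral_cong) (simp add: nn_integral_cmult nn_integral_reflect_translate)
  also have "\<dots> = (\<integral>\<^sup>+y. \<integral>\<^sup>+x. G (T x) * w (T x - y) \<partial>lborel \<partial>lborel)"
    by (rule lborel_pair.Fubini') measurable
  also have "\<dots> = (\<integral>\<^sup>+y. \<integral>\<^sup>+x. G (T x + y) * w x \<partial>lborel \<partial>lborel)"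
  proof (rule nn_integral_cong)
    fix y :: 'a
    obtain y' where y': "y = T y'" using orthogonal_transformation_surj[OF T] by (metis surjD)
    have "(\<integral>\<^sup>+x. G (T x) * w (T x - y) \<partial>lborel) = (\<integral>\<^sup>+x. G (T (x + y')) * w (T (x + y') - y) \<partial>lborel)"
      by (rule nn_integral_translate[symmetric]) measurable
    also have "\<dots> = (\<integral>\<^sup>+x. G (T x + y) * w x \<partial>lborel)"
      by (simp add: linear_add[OF lT] y' wT)
    finally show "(\<integral>\<^sup>+x. G (T x) * w (T x - y) \<partial>lborel) = (\<integral>\<^sup>+x. G (T x + y) * w x \<partial>lborel)" .
  qed
  also have "\<dots> = (\<integral>\<^sup>+x. \<integral>\<^sup>+y. G (T x + y) * w x \<partial>lborel \<partial>lborel)"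
    by (rule lborel_pair.Fubini') measurable
  also have "\<dots> = (\<integral>\<^sup>+x. (\<integral>\<^sup>+y. G y \<partial>lborel) * w x \<partial>lborel)"
    by (simp add: nn_integral_multc tr)
  also have "\<dots> = (\<integral>\<^sup>+x. G x \<partial>lborel) * c"
    unfolding c_def by (rule nn_integral_cmult) measurable
  finally have "c * (\<integral>\<^sup>+x. G (T x) \<partial>lborel) = c * (\<integral>\<^sup>+x. G x \<partial>lborel)"
    by (simp add: mult.commute)
  moreover have "c \<noteq> 0" "c \<noteq> \<top>" unfolding c by (auto simp: ennreal_eq_0_iff not_le)
  ultimately show ?thesis by (simp add: ennreal_mult_cancel_left)
qed

lemma distr_lborel_orthogonal_transformation:
  fixes T :: "'a::euclidean_space \<Rightarrow> 'a"
  assumes T: "orthogonal_transformation T"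
  shows "distr lborel borel T = lborel"
proof (rule measure_eqI)
  have lT: "linear T" using T orthogonal_transformation_linear by blast
  then have mT[measurable]: "T \<in> borel_measurable borel"
    by (intro borel_measurable_continuous_onI linear_continuous_on) (simp add: linear_conv_bounded_linear)
  fix A assume "A \<in> sets (distr lborel borel T)"
  then have A[measurable]: "A \<in> sets borel" by simp
  have "emeasure (distr lborel borel T) A = (\<integral>\<^sup>+x. indicator A x \<partial>(distr lborel borel T))"
    by simp
  also have "\<dots> = (\<integral>\<^sup>+x. indicator A (T x) \<partial>lborel)"
    by (rule nn_integral_distr) measurable
  also have "\<dots> = (\<integral>\<^sup>+x. indicator A x \<partial>lborel)"
    by (rule nn_integral_orthogonal_transformation[OF T]) measurable
  finally show "emeasure (distr lborel borel T) A = emeasure lborel A" by simp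
qed simp

text \<open>A bijection from \<open>Basis\<close> to \<open>B\<close> extends to an orthogonal map
  \<open>T\<close> with inverse \<open>U\<close>. Coordinates along \<open>B\<close> followed by
  \<open>U\<close> are standard coordinates, so the image of the product measure under
  \<open>U\<close> after \<open>S\<close> is \<open>lborel\<close>, as is checked on boxes. Pushing
  forward by \<open>T\<close> restores \<open>S\<close> on one side and fixes \<open>lborel\<close>
  on the other.\<close>

lemma lborel_eq_orthonormal:
  fixes B :: "'a::euclidean_space set"
  assumes B: "orthonormal_basis_of UNIV B"
  shows "distr (\<Pi>\<^sub>M b\<in>B. (lborel :: real measure)) borel (\<lambda>c. \<Sum>b\<in>B. c b *\<^sub>R b) = lborel"
proof -
  interpret product_sigma_finite "\<lambda>_::'a. lborel::real measure" by standard
  have orth: "pairwise orthogonal B" and unit: "\<And>b. b \<in> B \<Longrightarrow> norm b = 1" and span: "span B = UNIV"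
    using B by (auto simp: orthonormal_basis_of_def)
  have ind: "independent B" using orth unit
    by (intro pairwise_orthogonal_independent) force+
  then have fin: "finite B" by (rule independent_imp_finite)
  interpret fp: finite_product_sigma_finite "\<lambda>_::'a. lborel::real measure" B by standard fact
  have "card B = DIM('a)"
    using ind span by (metis dim_UNIV dim_eq_card span_UNIV)
  then obtain \<phi> where \<phi>: "bij_betw \<phi> (Basis :: 'a set) B"
    using finite_same_card_bij[of "Basis :: 'a set" B] fin by auto
  have \<phi>B: "\<phi> e \<in> B" if "e \<in> Basis" for e using \<phi> that by (auto dest: bij_betwE)
  define T where "T x = (\<Sum>e\<in>Basis. (x \<bullet> e) *\<^sub>R \<phi> e)" for x :: "'a"
  define U where "U y = (\<Sum>e\<in>Basis. (y \<bullet> \<phi> e) *\<^sub>R e)" for y :: "'a"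
  have \<phi>\<phi>: "\<phi> e \<bullet> \<phi> e' = (if e = e' then 1 else 0)" if "e \<in> Basis" "e' \<in> Basis" for e e'
  proof (cases "e = e'")
    case True then show ?thesis using unit[OF \<phi>B[OF that(1)]] by (simp add: norm_eq_1)
  next
    case False
    then have "\<phi> e \<noteq> \<phi> e'" using \<phi> that by (auto simp: bij_betw_def inj_on_def)
    then show ?thesis using orth \<phi>B that False by (auto simp: pairwise_def orthogonal_def)
  qed
  have lin: "linear T" unfolding T_def
    by (rule linearI) (auto simp: inner_add_left scaleR_add_left sum.distrib scaleR_sum_right)
  have T\<phi>: "T x \<bullet> \<phi> e = x \<bullet> e" if "e \<in> Basis" for x e
    unfolding T_def using that by (simp add: inner_sum_left \<phi>\<phi> if_distrib cong: if_cong)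
  have UT: "U (T x) = x" for x
    unfolding U_def by (simp add: T\<phi> euclidean_representation)
  have TT: "T x \<bullet> T y = x \<bullet> y" for x y
  proof -
    have "T x \<bullet> T y = (\<Sum>e\<in>Basis. (y \<bullet> e) * (T x \<bullet> \<phi> e))"
      by (subst (2) T_def) (simp add: inner_sum_right)
    also have "\<dots> = x \<bullet> y" by (subst euclidean_inner) (simp add: T\<phi> mult.commute)
    finally show ?thesis .
  qed
  have oT: "orthogonal_transformation T" using lin TT by (auto simp: orthogonal_transformation_def)
  then have "bij T" using orthogonal_transformation_bij by blast
  then have TU: "T (U y) = y" for y using UT by (metis bij_pointE)
  have cT[measurable]: "T \<in> borel_measurable borel" unfolding T_def by measurable
  have cU[measurable]: "U \<in> borel_measurable borel" unfolding U_def by measurable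
  define S where "S = (\<lambda>c. \<Sum>b\<in>B. c b *\<^sub>R b)"
  have S[measurable]: "S \<in> borel_measurable (\<Pi>\<^sub>M b\<in>B. (lborel :: real measure))"
    unfolding S_def by measurable
  have US: "U (S c) = (\<Sum>e\<in>Basis. c (\<phi> e) *\<^sub>R e)" for c
  proof -
    have "S c = (\<Sum>e\<in>Basis. c (\<phi> e) *\<^sub>R \<phi> e)"
      unfolding S_def by (rule sum.reindex_bij_betw[OF \<phi>, symmetric])
    also have "\<dots> = T (\<Sum>e\<in>Basis. c (\<phi> e) *\<^sub>R e)" unfolding T_def by simp
    finally show ?thesis using UT by simp
  qed
  have "lborel = distr (\<Pi>\<^sub>M b\<in>B. (lborel :: real measure)) borel (U \<circ> S)"
  proof (rule lborel_eqI)
    fix l u :: "'a" assume lu: "\<And>b. b \<in> Basis \<Longrightarrow> l \<bullet> b \<le> u \<bullet> b"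
    define \<psi> where "\<psi> = the_inv_into Basis \<phi>"
    have \<psi>\<phi>: "\<psi> (\<phi> e) = e" if "e \<in> Basis" for e using that \<phi>
      by (auto simp: \<psi>_def bij_betw_def the_inv_into_f_f)
    have \<psi>B: "\<psi> b \<in> Basis" if "b \<in> B" for b using that \<phi>
      by (metis \<psi>_def bij_betwE bij_betw_the_inv_into)
    have \<phi>\<psi>: "\<phi> (\<psi> b) = b" if "b \<in> B" for b using that \<phi>
      by (auto simp: \<psi>_def bij_betw_def f_the_inv_into_f)
    have US': "U (S c) \<bullet> e = c (\<phi> e)" if "e \<in> Basis" for c e using that unfolding US by simp
    have "(U \<circ> S) -` box l u \<inter> space (\<Pi>\<^sub>M b\<in>B. (lborel :: real measure))
       = Pi\<^sub>E B (\<lambda>b. {l \<bullet> \<psi> b <..< u \<bullet> \<psi> b})" (is "?L = ?R")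
    proof (intro set_eqI iffI)
      fix c assume c: "c \<in> ?L"
      have "l \<bullet> \<psi> b < c b \<and> c b < u \<bullet> \<psi> b" if "b \<in> B" for b
        using c US'[OF \<psi>B[OF that], of c] \<psi>B[OF that] \<phi>\<psi>[OF that] by (auto simp: box_def)
      with c show "c \<in> ?R" by (auto simp: space_PiM PiE_iff)
    next
      fix c assume c: "c \<in> ?R"
      have "l \<bullet> e < U (S c) \<bullet> e \<and> U (S c) \<bullet> e < u \<bullet> e" if "e \<in> Basis" for e
        using PiE_mem[OF c \<phi>B[OF that]] unfolding US'[OF that] \<psi>\<phi>[OF that] by auto
      with c show "c \<in> ?L" by (auto simp: space_PiM PiE_iff box_def)
    qed
    then have "emeasure (distr (\<Pi>\<^sub>M b\<in>B. (lborel :: real measure)) borel (U \<circ> S)) (box l u)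
      = emeasure (\<Pi>\<^sub>M b\<in>B. (lborel :: real measure)) (Pi\<^sub>E B (\<lambda>b. {l \<bullet> \<psi> b <..< u \<bullet> \<psi> b}))"
      by (subst emeasure_distr) auto
    also have "\<dots> = (\<Prod>b\<in>B. emeasure lborel {l \<bullet> \<psi> b <..< u \<bullet> \<psi> b})"
      by (rule fp.measure_times) auto
    also have "\<dots> = (\<Prod>e\<in>Basis. emeasure lborel {l \<bullet> \<psi> (\<phi> e) <..< u \<bullet> \<psi> (\<phi> e)})"
      by (rule prod.reindex_bij_betw[OF \<phi>, symmetric])
    also have "\<dots> = (\<Prod>e\<in>Basis. ennreal ((u - l) \<bullet> e))"
      by (intro prod.cong refl) (simp add: \<psi>\<phi> lu inner_diff_left)
    also have "\<dots> = ennreal (\<Prod>e\<in>Basis. (u - l) \<bullet> e)"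
      using lu by (intro prod_ennreal) (simp add: inner_diff_left)
    finally show "emeasure (distr (\<Pi>\<^sub>M b\<in>B. (lborel :: real measure)) borel (U \<circ> S)) (box l u)
      = (\<Prod>b\<in>Basis. (u - l) \<bullet> b)" .
  qed simp
  then have "distr lborel borel T = distr (distr (\<Pi>\<^sub>M b\<in>B. (lborel :: real measure)) borel (U \<circ> S)) borel T"
    by simp
  also have "\<dots> = distr (\<Pi>\<^sub>M b\<in>B. (lborel :: real measure)) borel (T \<circ> (U \<circ> S))"
    by (rule distr_distr) auto
  also have "T \<circ> (U \<circ> S) = S" using TU by auto
  finally show ?thesis
    using distr_lborel_orthogonal_transformation[OF oT] by (simp add: S_def)
qed

text \<open>Adjoining xi to an orthonormal basis of its orthogonal complement gives one of the whole
  space. In these coordinates the identity is Fubini for a product measure with one factor split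
  off.\<close>

lemma nn_integral_orthogonal_split:
  fixes \<xi> :: "'a::euclidean_space" and F :: "real \<times> 'a \<Rightarrow> ennreal"
  assumes \<xi>: "norm \<xi> = 1" and F[measurable]: "F \<in> borel_measurable borel"
  shows "(\<integral>\<^sup>+y. F (\<xi> \<bullet> y, y - (\<xi> \<bullet> y) *\<^sub>R \<xi>) \<partial>lborel)
       = (\<integral>\<^sup>+t. \<integral>\<^sup>+z. F (t, z) \<partial>subspace_lborel (hyperplane_perp \<xi>) \<partial>lborel)"
proof -
  interpret product_sigma_finite "\<lambda>_::'a. lborel::real measure" by standard
  \<comment> \<open>This is literally the basis selected inside \<open>subspace_lborel\<close>, so
    the hyperplane measure can be unfolded without comparing different bases.\<close>
  define B where "B = (SOME B. orthonormal_basis_of (hyperplane_perp \<xi>) B)"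
  have "subspace (hyperplane_perp \<xi>)" unfolding hyperplane_perp_def by (rule subspace_hyperplane)
  then obtain B0 where "B0 \<subseteq> hyperplane_perp \<xi>" "pairwise orthogonal B0" "\<And>x. x \<in> B0 \<Longrightarrow> norm x = 1"
    "span B0 = hyperplane_perp \<xi>" using orthonormal_basis_subspace by metis
  then have "\<exists>B. orthonormal_basis_of (hyperplane_perp \<xi>) B"
    by (auto simp: orthonormal_basis_of_def)
  then have B: "orthonormal_basis_of (hyperplane_perp \<xi>) B" unfolding B_def by (rule someI_ex)
  then have orth: "pairwise orthogonal B" and unit: "\<And>b. b \<in> B \<Longrightarrow> norm b = 1" and span: "span B = hyperplane_perp \<xi>"
    by (auto simp: orthonormal_basis_of_def)
  have perp: "\<xi> \<bullet> b = 0" if "b \<in> B" for b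
    using span_base[OF that] unfolding span by (simp add: hyperplane_perp_def)
  have \<xi>\<xi>: "\<xi> \<bullet> \<xi> = 1" using \<xi> by (simp add: norm_eq_1)
  have nin: "\<xi> \<notin> B" using perp \<xi>\<xi> by fastforce
  have "independent B" using orth unit by (intro pairwise_orthogonal_independent) force+
  then have fin: "finite B" by (rule independent_imp_finite)
  have sub: "subspace_lborel (hyperplane_perp \<xi>) = distr (\<Pi>\<^sub>M b\<in>B. (lborel :: real measure)) borel (\<lambda>c. \<Sum>b\<in>B. c b *\<^sub>R b)"
    unfolding subspace_lborel_def B_def Let_def ..
  have onb: "orthonormal_basis_of UNIV (insert \<xi> B)"
    unfolding orthonormal_basis_of_def
  proof (intro conjI ballI)
    show "pairwise orthogonal (insert \<xi> B)"
      using orth perp by (auto simp: pairwise_insert orthogonal_def inner_commute)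
    show "norm b = 1" if "b \<in> insert \<xi> B" for b using that unit \<xi> by auto
    have "y \<in> span (insert \<xi> B)" for y
    proof -
      have "y - (\<xi> \<bullet> y) *\<^sub>R \<xi> \<in> span B" unfolding span hyperplane_perp_def by (simp add: inner_diff_right \<xi>\<xi>)
      then show ?thesis unfolding span_insert by blast
    qed
    then show "span (insert \<xi> B) = UNIV" by blast
  qed
  have m: "(\<lambda>c. \<Sum>b\<in>B. c b *\<^sub>R b) \<in> borel_measurable (\<Pi>\<^sub>M b\<in>B. (lborel :: real measure))" by measurable
  have m': "(\<lambda>c. \<Sum>b\<in>insert \<xi> B. c b *\<^sub>R b) \<in> borel_measurable (\<Pi>\<^sub>M b\<in>insert \<xi> B. (lborel :: real measure))" by measurable
  have eq: "F (\<xi> \<bullet> (\<Sum>b\<in>insert \<xi> B. c b *\<^sub>R b), (\<Sum>b\<in>insert \<xi> B. c b *\<^sub>R b) - (\<xi> \<bullet> (\<Sum>b\<in>insert \<xi> B. c b *\<^sub>R b)) *\<^sub>R \<xi>)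
      = F (c \<xi>, \<Sum>b\<in>B. c b *\<^sub>R b)" for c
  proof -
    have "\<xi> \<bullet> (\<Sum>b\<in>insert \<xi> B. c b *\<^sub>R b) = c \<xi>"
      using fin nin perp by (simp add: inner_add_right inner_sum_right \<xi>\<xi>)
    moreover have "(\<Sum>b\<in>insert \<xi> B. c b *\<^sub>R b) = c \<xi> *\<^sub>R \<xi> + (\<Sum>b\<in>B. c b *\<^sub>R b)"
      using fin nin by simp
    ultimately show ?thesis by simp
  qed
  have upd: "(\<Sum>b\<in>B. (c(\<xi> := t)) b *\<^sub>R b) = (\<Sum>b\<in>B. c b *\<^sub>R b)" for c t
    using nin by (intro sum.cong) auto
  have "(\<integral>\<^sup>+y. F (\<xi> \<bullet> y, y - (\<xi> \<bullet> y) *\<^sub>R \<xi>) \<partial>lborel)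
     = (\<integral>\<^sup>+c. F (c \<xi>, \<Sum>b\<in>B. c b *\<^sub>R b) \<partial>(\<Pi>\<^sub>M b\<in>insert \<xi> B. (lborel :: real measure)))"
    by (subst lborel_eq_orthonormal[OF onb, symmetric], subst nn_integral_distr[OF m']) (auto simp only: eq, measurable)
  also have "\<dots> = (\<integral>\<^sup>+t. \<integral>\<^sup>+c. F ((c(\<xi> := t)) \<xi>, \<Sum>b\<in>B. (c(\<xi> := t)) b *\<^sub>R b) \<partial>(\<Pi>\<^sub>M b\<in>B. (lborel :: real measure)) \<partial>lborel)"
    using fin nin by (intro product_nn_integral_insert_rev) measurable
  also have "\<dots> = (\<integral>\<^sup>+t. \<integral>\<^sup>+c. F (t, \<Sum>b\<in>B. c b *\<^sub>R b) \<partial>(\<Pi>\<^sub>M b\<in>B. (lborel :: real measure)) \<partial>lborel)"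
    unfolding upd by simp
  also have "\<dots> = (\<integral>\<^sup>+t. \<integral>\<^sup>+z. F (t, z) \<partial>subspace_lborel (hyperplane_perp \<xi>) \<partial>lborel)"
    unfolding sub by (rule nn_integral_cong, subst nn_integral_distr[OF m]) measurable
  finally show ?thesis .
qed

section \<open>Fubini formulas between a hyperplane and the whole space\<close>

lemma sets_subspace_lborel[measurable_cong]: "sets (subspace_lborel V) = sets borel"
  by (simp add: subspace_lborel_def Let_def)

lemma space_subspace_lborel[simp]: "space (subspace_lborel V) = UNIV"
  by (simp add: subspace_lborel_def Let_def)

lemma hyperplane_perp_scaleR: "c \<noteq> 0 \<Longrightarrow> hyperplane_perp (c *\<^sub>R \<xi>) = hyperplane_perp \<xi>"
  by (auto simp: hyperplane_perp_def)

lemma nn_integral_cmult_real: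
  fixes f :: "real \<Rightarrow> ennreal"
  assumes [measurable]: "f \<in> borel_measurable borel" and c: "c \<noteq> 0"
  shows "(\<integral>\<^sup>+t. f (a + c * t) \<partial>lborel) = ennreal (1 / \<bar>c\<bar>) * (\<integral>\<^sup>+t. f t \<partial>lborel)"
proof -
  have "(\<integral>\<^sup>+t. f t \<partial>lborel) = ennreal \<bar>c\<bar> * (\<integral>\<^sup>+t. f (a + c * t) \<partial>lborel)"
    using c by (intro nn_integral_real_affine) auto
  then show ?thesis using c by (simp add: mult.assoc[symmetric] flip: ennreal_mult)
qed

lemma nn_integral_hyperplane_split:
  fixes \<eta> :: "'a::euclidean_space" and F :: "real \<times> 'a \<Rightarrow> ennreal"
  assumes \<eta>: "\<eta> \<noteq> 0" and F[measurable]: "F \<in> borel_measurable borel"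
  shows "(\<integral>\<^sup>+y. F (\<eta> \<bullet> y, y - ((\<eta> \<bullet> y) / (norm \<eta>)\<^sup>2) *\<^sub>R \<eta>) \<partial>lborel)
       = ennreal (1 / norm \<eta>) * (\<integral>\<^sup>+t. \<integral>\<^sup>+z. F (t, z) \<partial>subspace_lborel (hyperplane_perp \<eta>) \<partial>lborel)"
proof -
  define \<xi> where "\<xi> = (1 / norm \<eta>) *\<^sub>R \<eta>"
  have \<xi>: "norm \<xi> = 1" using \<eta> by (simp add: \<xi>_def)
  have \<eta>\<xi>: "\<eta> = norm \<eta> *\<^sub>R \<xi>" using \<eta> by (simp add: \<xi>_def)
  have hp: "hyperplane_perp \<eta> = hyperplane_perp \<xi>" using \<eta> by (simp add: \<xi>_def hyperplane_perp_scaleR)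
  \<comment> \<open>Sigma-finiteness makes the inner integral measurable in t, which the rescaling
    of t below relies on. Balls in the hyperplane have finite measure because a cylinder of height 1
    over one lies in a ball of radius larger by 1.\<close>
  interpret sigma_finite_measure "subspace_lborel (hyperplane_perp \<xi>)"
  proof
    let ?f = "\<lambda>n::nat. cball (0::'a) (real n)"
    have fin: "emeasure (subspace_lborel (hyperplane_perp \<xi>)) (?f n) \<noteq> \<infinity>" for n
    proof -
      let ?F = "\<lambda>(t::real, z::'a). indicator {0..1} t * indicator (?f n) z :: ennreal"
      have [measurable]: "?f n \<in> sets borel" by simp
      have [measurable]: "?F \<in> borel_measurable borel"
        unfolding borel_prod[symmetric] by measurable
      have "emeasure (subspace_lborel (hyperplane_perp \<xi>)) (?f n)
         = (\<integral>\<^sup>+t. \<integral>\<^sup>+z. ?F (t, z) \<partial>subspace_lborel (hyperplane_perp \<xi>) \<partial>lborel)"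
        by (simp add: nn_integral_cmult nn_integral_multc)
      also have "\<dots> = (\<integral>\<^sup>+y. ?F (\<xi> \<bullet> y, y - (\<xi> \<bullet> y) *\<^sub>R \<xi>) \<partial>lborel)"
        by (rule nn_integral_orthogonal_split[OF \<xi>, symmetric]) measurable
      also have "\<dots> \<le> (\<integral>\<^sup>+y. indicator (cball (0::'a) (real n + 1)) y \<partial>lborel)"
      proof (rule nn_integral_mono)
        fix y :: 'a
        have "norm y \<le> norm (y - (\<xi> \<bullet> y) *\<^sub>R \<xi>) + \<bar>\<xi> \<bullet> y\<bar>"
          using norm_triangle_ineq[of "y - (\<xi> \<bullet> y) *\<^sub>R \<xi>" "(\<xi> \<bullet> y) *\<^sub>R \<xi>"] \<xi> by simp
        then show "?F (\<xi> \<bullet> y, y - (\<xi> \<bullet> y) *\<^sub>R \<xi>) \<le> indicator (cball 0 (real n + 1)) y"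
          by (auto simp: indicator_def)
      qed
      also have "\<dots> < \<infinity>" using emeasure_lborel_cball_finite[of "0::'a" "real n + 1"] by simp
      finally show ?thesis by simp
    qed
    show "\<exists>A. countable A \<and> A \<subseteq> sets (subspace_lborel (hyperplane_perp \<xi>)) \<and>
        \<Union>A = space (subspace_lborel (hyperplane_perp \<xi>)) \<and>
        (\<forall>a\<in>A. emeasure (subspace_lborel (hyperplane_perp \<xi>)) a \<noteq> \<infinity>)"
    proof (intro exI[of _ "range ?f"] conjI)
      show "\<Union>(range ?f) = space (subspace_lborel (hyperplane_perp \<xi>))"
        by (auto simp: real_arch_simple)
    qed (use fin in \<open>auto simp: sets_subspace_lborel\<close>)
  qed
  have [measurable]: "F \<in> borel_measurable (borel \<Otimes>\<^sub>M borel)" using F by (simp add: borel_prod)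
  have "(\<integral>\<^sup>+y. F (\<eta> \<bullet> y, y - ((\<eta> \<bullet> y) / (norm \<eta>)\<^sup>2) *\<^sub>R \<eta>) \<partial>lborel)
      = (\<integral>\<^sup>+y. F (norm \<eta> * (\<xi> \<bullet> y), y - (\<xi> \<bullet> y) *\<^sub>R \<xi>) \<partial>lborel)"
  proof (rule nn_integral_cong)
    fix y
    have 1: "\<eta> \<bullet> y = norm \<eta> * (\<xi> \<bullet> y)" using \<eta> by (simp add: \<xi>_def)
    have 2: "((\<eta> \<bullet> y) / (norm \<eta>)\<^sup>2) *\<^sub>R \<eta> = (\<xi> \<bullet> y) *\<^sub>R \<xi>"
      unfolding \<xi>_def by (simp add: power2_eq_square)
    show "F (\<eta> \<bullet> y, y - ((\<eta> \<bullet> y) / (norm \<eta>)\<^sup>2) *\<^sub>R \<eta>) = F (norm \<eta> * (\<xi> \<bullet> y), y - (\<xi> \<bullet> y) *\<^sub>R \<xi>)"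
      unfolding 2 unfolding 1 ..
  qed
  also have "\<dots> = (\<integral>\<^sup>+t. \<integral>\<^sup>+z. F (norm \<eta> * t, z) \<partial>subspace_lborel (hyperplane_perp \<xi>) \<partial>lborel)"
    using nn_integral_orthogonal_split[OF \<xi>, of "\<lambda>(t, z). F (norm \<eta> * t, z)"]
    by (simp add: borel_prod[symmetric])
  also have "\<dots> = ennreal (1 / norm \<eta>) * (\<integral>\<^sup>+t. \<integral>\<^sup>+z. F (t, z) \<partial>subspace_lborel (hyperplane_perp \<xi>) \<partial>lborel)"
    using \<eta> nn_integral_cmult_real[of "\<lambda>t. \<integral>\<^sup>+z. F (t, z) \<partial>subspace_lborel (hyperplane_perp \<xi>)" "norm \<eta>" 0] by simp
  finally show ?thesis unfolding hp .
qed

text \<open>A hyperplane integral is smeared out in the normal direction with a profile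
  \<open>k\<close> of one's choice. It becomes an ordinary integral over the space, to which
  translations and Fubini for \<open>lborel\<close> apply.\<close>

lemma nn_integral_hyperplane_slab:
  fixes \<eta> :: "'a::euclidean_space" and G :: "'a \<Rightarrow> ennreal" and k :: "real \<Rightarrow> ennreal"
  assumes \<eta>: "\<eta> \<noteq> 0" and [measurable]: "G \<in> borel_measurable borel" "k \<in> borel_measurable borel"
  shows "(\<integral>\<^sup>+y. k (\<eta> \<bullet> y) * G (y - ((\<eta> \<bullet> y) / (norm \<eta>)\<^sup>2) *\<^sub>R \<eta>) \<partial>lborel)
       = ennreal (1 / norm \<eta>) * ((\<integral>\<^sup>+t. k t \<partial>lborel) * (\<integral>\<^sup>+z. G z \<partial>subspace_lborel (hyperplane_perp \<eta>)))"
  using nn_integral_hyperplane_split[OF \<eta>, of "\<lambda>(t, z). k t * G z"]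
  by (simp add: borel_prod[symmetric] nn_integral_cmult nn_integral_multc)

lemma nn_integral_hyperplane_translate:
  fixes \<eta> :: "'a::euclidean_space" and G :: "'a \<Rightarrow> ennreal"
  assumes \<eta>: "\<eta> \<noteq> 0" and [measurable]: "G \<in> borel_measurable borel" and w: "\<eta> \<bullet> w = 0"
  shows "(\<integral>\<^sup>+z. G (z + w) \<partial>subspace_lborel (hyperplane_perp \<eta>)) = (\<integral>\<^sup>+z. G z \<partial>subspace_lborel (hyperplane_perp \<eta>))"
proof -
  \<comment> \<open>The mass |eta| of this profile cancels the factor 1/|eta| of the slab
    formula.\<close>
  let ?k = "indicator {0..norm \<eta>} :: real \<Rightarrow> ennreal"
  have *: "(\<integral>\<^sup>+z. G z \<partial>subspace_lborel (hyperplane_perp \<eta>)) =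
     (\<integral>\<^sup>+y. ?k (\<eta> \<bullet> y) * G (y - ((\<eta> \<bullet> y) / (norm \<eta>)\<^sup>2) *\<^sub>R \<eta>) \<partial>lborel)"
    if [measurable]: "G \<in> borel_measurable borel" for G
    using \<eta> by (subst nn_integral_hyperplane_slab[OF \<eta>]) (simp_all add: mult.assoc[symmetric] flip: ennreal_mult)
  have "(\<integral>\<^sup>+z. G (z + w) \<partial>subspace_lborel (hyperplane_perp \<eta>)) =
     (\<integral>\<^sup>+y. ?k (\<eta> \<bullet> y) * G (y - ((\<eta> \<bullet> y) / (norm \<eta>)\<^sup>2) *\<^sub>R \<eta> + w) \<partial>lborel)"
    by (rule *) measurable
  also have "\<dots> = (\<integral>\<^sup>+y. ?k (\<eta> \<bullet> (y + w)) * G ((y + w) - ((\<eta> \<bullet> (y + w)) / (norm \<eta>)\<^sup>2) *\<^sub>R \<eta>) \<partial>lborel)"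
    using w by (simp add: inner_add_right algebra_simps)
  also have "\<dots> = (\<integral>\<^sup>+y. ?k (\<eta> \<bullet> y) * G (y - ((\<eta> \<bullet> y) / (norm \<eta>)\<^sup>2) *\<^sub>R \<eta>) \<partial>lborel)"
    by (rule nn_integral_translate[of "\<lambda>y. ?k (\<eta> \<bullet> y) * G (y - ((\<eta> \<bullet> y) / (norm \<eta>)\<^sup>2) *\<^sub>R \<eta>)" w]) measurable
  also have "\<dots> = (\<integral>\<^sup>+z. G z \<partial>subspace_lborel (hyperplane_perp \<eta>))" by (rule *[symmetric]) measurable
  finally show ?thesis .
qed

text \<open>Projecting along \<open>e\<close> instead of along the normal moves the slice at height
  t by t w, with w parallel to the hyperplane; translation invariance inside the hyperplane absorbs
  the shift.\<close>

lemma nn_integral_hyperplane_oblique: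
  fixes \<eta> e :: "'a::euclidean_space" and G :: "'a \<Rightarrow> ennreal" and k :: "real \<Rightarrow> ennreal"
  assumes \<eta>: "\<eta> \<bullet> e \<noteq> 0" and [measurable]: "G \<in> borel_measurable borel" "k \<in> borel_measurable borel"
  shows "(\<integral>\<^sup>+y. k (\<eta> \<bullet> y) * G (y - ((\<eta> \<bullet> y) / (\<eta> \<bullet> e)) *\<^sub>R e) \<partial>lborel)
       = ennreal (1 / norm \<eta>) * ((\<integral>\<^sup>+t. k t \<partial>lborel) * (\<integral>\<^sup>+z. G z \<partial>subspace_lborel (hyperplane_perp \<eta>)))"
proof -
  have \<eta>0: "\<eta> \<noteq> 0" using \<eta> by auto
  define w where "w = (1 / (norm \<eta>)\<^sup>2) *\<^sub>R \<eta> - (1 / (\<eta> \<bullet> e)) *\<^sub>R e"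
  have w: "\<eta> \<bullet> w = 0" using \<eta> \<eta>0 by (simp add: w_def inner_diff_right power2_norm_eq_inner)
  have eq: "y - ((\<eta> \<bullet> y) / (\<eta> \<bullet> e)) *\<^sub>R e = (y - ((\<eta> \<bullet> y) / (norm \<eta>)\<^sup>2) *\<^sub>R \<eta>) + (\<eta> \<bullet> y) *\<^sub>R w" for y
    by (simp add: w_def algebra_simps)
  have "(\<integral>\<^sup>+y. k (\<eta> \<bullet> y) * G (y - ((\<eta> \<bullet> y) / (\<eta> \<bullet> e)) *\<^sub>R e) \<partial>lborel)
     = ennreal (1 / norm \<eta>) * (\<integral>\<^sup>+t. \<integral>\<^sup>+z. k t * G (z + t *\<^sub>R w) \<partial>subspace_lborel (hyperplane_perp \<eta>) \<partial>lborel)"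
    unfolding eq using nn_integral_hyperplane_split[OF \<eta>0, of "\<lambda>(t, z). k t * G (z + t *\<^sub>R w)"]
    by (simp add: borel_prod[symmetric])
  also have "\<dots> = ennreal (1 / norm \<eta>) * (\<integral>\<^sup>+t. k t * \<integral>\<^sup>+z. G z \<partial>subspace_lborel (hyperplane_perp \<eta>) \<partial>lborel)"
    using w by (simp add: nn_integral_cmult nn_integral_hyperplane_translate[OF \<eta>0])
  finally show ?thesis by (simp add: nn_integral_multc)
qed

text \<open>Integration over e^perp is encoded by letting y range over the slab 0 <= y . e <= 1 and
  using only its projection to e^perp. The slab has thickness 1, so no normalising factor appears,
  and the outer measure is \<open>lborel\<close> again.\<close>

lemma nn_integral_coordinate_split:
  fixes e :: "'a::euclidean_space" and u :: "'a \<Rightarrow> ennreal"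
  assumes e: "norm e = 1" and [measurable]: "u \<in> borel_measurable borel"
  shows "(\<integral>\<^sup>+y. u y \<partial>lborel)
     = (\<integral>\<^sup>+y. indicator {0..1} (y \<bullet> e) * (\<integral>\<^sup>+t. u (y - (y \<bullet> e) *\<^sub>R e + t *\<^sub>R e) \<partial>lborel) \<partial>lborel)"
proof -
  let ?k = "indicator {0..1} :: real \<Rightarrow> ennreal"
  have ee: "e \<bullet> e = 1" using e by (simp add: norm_eq_1)
  have "(\<integral>\<^sup>+y. ?k (y \<bullet> e) * (\<integral>\<^sup>+t. u (y - (y \<bullet> e) *\<^sub>R e + t *\<^sub>R e) \<partial>lborel) \<partial>lborel)
     = (\<integral>\<^sup>+y. \<integral>\<^sup>+t. ?k (y \<bullet> e) * u (y + t *\<^sub>R e) \<partial>lborel \<partial>lborel)"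
  proof (rule nn_integral_cong)
    fix y :: 'a
    have "(\<integral>\<^sup>+t. u (y - (y \<bullet> e) *\<^sub>R e + t *\<^sub>R e) \<partial>lborel) = (\<integral>\<^sup>+t. u (y - (y \<bullet> e) *\<^sub>R e + (t + y \<bullet> e) *\<^sub>R e) \<partial>lborel)"
      by (rule nn_integral_translate[symmetric]) measurable
    also have "\<dots> = (\<integral>\<^sup>+t. u (y + t *\<^sub>R e) \<partial>lborel)" by (simp add: algebra_simps)
    finally show "?k (y \<bullet> e) * (\<integral>\<^sup>+t. u (y - (y \<bullet> e) *\<^sub>R e + t *\<^sub>R e) \<partial>lborel) = (\<integral>\<^sup>+t. ?k (y \<bullet> e) * u (y + t *\<^sub>R e) \<partial>lborel)"
      by (simp add: nn_integral_cmult)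
  qed
  also have "\<dots> = (\<integral>\<^sup>+t. \<integral>\<^sup>+y. ?k (y \<bullet> e) * u (y + t *\<^sub>R e) \<partial>lborel \<partial>lborel)"
    by (rule lborel_pair.Fubini') measurable
  also have "\<dots> = (\<integral>\<^sup>+t. \<integral>\<^sup>+y. ?k (y \<bullet> e - t) * u y \<partial>lborel \<partial>lborel)"
  proof (rule nn_integral_cong)
    fix t :: real
    have "(\<integral>\<^sup>+y. ?k (y \<bullet> e - t) * u y \<partial>lborel) = (\<integral>\<^sup>+y. ?k ((y + t *\<^sub>R e) \<bullet> e - t) * u (y + t *\<^sub>R e) \<partial>lborel)"
      by (rule nn_integral_translate[symmetric]) measurable
    then show "(\<integral>\<^sup>+y. ?k (y \<bullet> e) * u (y + t *\<^sub>R e) \<partial>lborel) = (\<integral>\<^sup>+y. ?k (y \<bullet> e - t) * u y \<partial>lborel)"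
      by (simp add: inner_add_left ee)
  qed
  also have "\<dots> = (\<integral>\<^sup>+y. \<integral>\<^sup>+t. ?k (y \<bullet> e - t) * u y \<partial>lborel \<partial>lborel)"
    by (rule lborel_pair.Fubini') measurable
  also have "\<dots> = (\<integral>\<^sup>+y. (\<integral>\<^sup>+t. ?k t \<partial>lborel) * u y \<partial>lborel)"
    by (rule nn_integral_cong) (simp add: nn_integral_multc nn_integral_reflect_translate[of ?k])
  finally show ?thesis by simp
qed

text \<open>The hyperplane is a graph over e^perp with area factor |eta| / |eta . e|. On the right,
  eta occurs only in an explicit jointly measurable integrand over a fixed measure, which is what an
  exchange of integrals in eta requires.\<close>

lemma nn_integral_hyperplane_graph:
  fixes \<eta> e :: "'a::euclidean_space" and G :: "'a \<Rightarrow> ennreal"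
  assumes e: "norm e = 1" and \<eta>: "\<eta> \<bullet> e \<noteq> 0" and [measurable]: "G \<in> borel_measurable borel"
  shows "ennreal (1 / norm \<eta>) * (\<integral>\<^sup>+z. G z \<partial>subspace_lborel (hyperplane_perp \<eta>))
     = ennreal (1 / \<bar>\<eta> \<bullet> e\<bar>) * (\<integral>\<^sup>+y. indicator {0..1} (y \<bullet> e) *
         G (y - (y \<bullet> e) *\<^sub>R e - ((\<eta> \<bullet> (y - (y \<bullet> e) *\<^sub>R e)) / (\<eta> \<bullet> e)) *\<^sub>R e) \<partial>lborel)"
proof -
  let ?k = "indicator {0..1} :: real \<Rightarrow> ennreal"
  have ee: "e \<bullet> e = 1" using e by (simp add: norm_eq_1)
  let ?y = "\<lambda>y. y - (y \<bullet> e) *\<^sub>R e"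
  let ?u = "\<lambda>y. ?k (\<eta> \<bullet> y) * G (y - ((\<eta> \<bullet> y) / (\<eta> \<bullet> e)) *\<^sub>R e)"
  have "ennreal (1 / norm \<eta>) * (\<integral>\<^sup>+z. G z \<partial>subspace_lborel (hyperplane_perp \<eta>)) = (\<integral>\<^sup>+y. ?u y \<partial>lborel)"
    by (subst nn_integral_hyperplane_oblique[OF \<eta>]) auto
  also have "\<dots> = (\<integral>\<^sup>+y. ?k (y \<bullet> e) * (\<integral>\<^sup>+t. ?u (?y y + t *\<^sub>R e) \<partial>lborel) \<partial>lborel)"
    by (rule nn_integral_coordinate_split[OF e]) measurable
  also have "\<dots> = (\<integral>\<^sup>+y. ennreal (1 / \<bar>\<eta> \<bullet> e\<bar>) * (?k (y \<bullet> e) * G (?y y - ((\<eta> \<bullet> ?y y) / (\<eta> \<bullet> e)) *\<^sub>R e)) \<partial>lborel)"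
  proof (rule nn_integral_cong)
    fix y :: 'a
    have 1: "?u (?y y + t *\<^sub>R e) = ?k (\<eta> \<bullet> ?y y + (\<eta> \<bullet> e) * t) * G (?y y - ((\<eta> \<bullet> ?y y) / (\<eta> \<bullet> e)) *\<^sub>R e)" for t
    proof -
      have eq: "?y y + t *\<^sub>R e - ((\<eta> \<bullet> (?y y + t *\<^sub>R e)) / (\<eta> \<bullet> e)) *\<^sub>R e = ?y y - ((\<eta> \<bullet> ?y y) / (\<eta> \<bullet> e)) *\<^sub>R e"
        using \<eta> by (simp add: inner_add_right[of _ "?y y"] add_divide_distrib scaleR_add_left)
      have 2: "\<eta> \<bullet> (?y y + t *\<^sub>R e) = \<eta> \<bullet> ?y y + (\<eta> \<bullet> e) * t"
        by (simp add: inner_add_right[of _ "?y y"] mult.commute)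
      show ?thesis unfolding eq unfolding 2 ..
    qed
    have "(\<integral>\<^sup>+t. ?u (?y y + t *\<^sub>R e) \<partial>lborel) = (\<integral>\<^sup>+t. ?k (\<eta> \<bullet> ?y y + (\<eta> \<bullet> e) * t) \<partial>lborel) * G (?y y - ((\<eta> \<bullet> ?y y) / (\<eta> \<bullet> e)) *\<^sub>R e)"
      unfolding 1 by (rule nn_integral_multc) measurable
    \<comment> \<open>Along e the variable eta . y runs with speed eta . e, so a profile of mass 1
      contributes 1/|eta . e|, whatever the base point.\<close>
    also have "(\<integral>\<^sup>+t. ?k (\<eta> \<bullet> ?y y + (\<eta> \<bullet> e) * t) \<partial>lborel) = ennreal (1 / \<bar>\<eta> \<bullet> e\<bar>)"
      using \<eta> by (subst nn_integral_cmult_real) auto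
    finally show "?k (y \<bullet> e) * (\<integral>\<^sup>+t. ?u (?y y + t *\<^sub>R e) \<partial>lborel) =
      ennreal (1 / \<bar>\<eta> \<bullet> e\<bar>) * (?k (y \<bullet> e) * G (?y y - ((\<eta> \<bullet> ?y y) / (\<eta> \<bullet> e)) *\<^sub>R e))"
      by (simp add: mult_ac)
  qed
  finally show ?thesis by (simp add: nn_integral_cmult)
qed

section \<open>Exchange of point and hyperplane\<close>

lemma nn_integral_haar_scale:
  fixes h :: "real \<Rightarrow> ennreal"
  assumes [measurable]: "h \<in> borel_measurable borel" and c: "c \<noteq> 0"
  shows "(\<integral>\<^sup>+s. ennreal (1 / \<bar>s\<bar>) * h (c * s) \<partial>lborel) = (\<integral>\<^sup>+s. ennreal (1 / \<bar>s\<bar>) * h s \<partial>lborel)"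
proof -
  have "(\<integral>\<^sup>+s. ennreal (1 / \<bar>s\<bar>) * h (c * s) \<partial>lborel)
      = (\<integral>\<^sup>+s. ennreal \<bar>c\<bar> * (ennreal (1 / \<bar>0 + c * s\<bar>) * h (0 + c * s)) \<partial>lborel)"
    using c by (intro nn_integral_cong) (simp add: mult.assoc[symmetric] abs_mult flip: ennreal_mult)
  also have "\<dots> = ennreal \<bar>c\<bar> * (\<integral>\<^sup>+s. ennreal (1 / \<bar>0 + c * s\<bar>) * h (0 + c * s) \<partial>lborel)"
    by (rule nn_integral_cmult) measurable
  also have "\<dots> = (\<integral>\<^sup>+s. ennreal (1 / \<bar>s\<bar>) * h s \<partial>lborel)"
    by (rule nn_integral_real_affine[symmetric]) (use c in auto)
  finally show ?thesis .
qed

text \<open>Uniqueness of Haar measure on the multiplicative group of the reals, applied to the image of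
  \<open>ds/|s|\<close> under inversion.\<close>

lemma nn_integral_haar_inverse:
  fixes h :: "real \<Rightarrow> ennreal"
  assumes [measurable]: "h \<in> borel_measurable borel"
  shows "(\<integral>\<^sup>+s. ennreal (1 / \<bar>s\<bar>) * h (1 / s) \<partial>lborel) = (\<integral>\<^sup>+s. ennreal (1 / \<bar>s\<bar>) * h s \<partial>lborel)"
proof -
  \<comment> \<open>Any \<open>w\<close> whose Haar integral is finite and nonzero would serve; on
    [1,2] the density lies between 1/2 and 1. The product of the integrals of \<open>h\<close> and
    \<open>w\<close> is the double integral of h(s) w(s r). Replacing s by s/r turns this into
    h(s/r) w(s), whose r-integral is the Haar integral of h(1/r).\<close>
  define w where "w = (indicator {1..2} :: real \<Rightarrow> ennreal)"
  have [measurable]: "w \<in> borel_measurable borel" unfolding w_def by measurable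
  define A where "A h = (\<integral>\<^sup>+s. ennreal (1 / \<bar>s\<bar>) * h s \<partial>lborel)" for h :: "real \<Rightarrow> ennreal"
  have AE0: "AE s in lborel. s \<noteq> (0::real)" by (rule AE_lborel_singleton)
  have "A h * A w = (\<integral>\<^sup>+s. ennreal (1 / \<bar>s\<bar>) * h s * A w \<partial>lborel)"
    unfolding A_def by (rule nn_integral_multc[symmetric]) measurable
  also have "\<dots> = (\<integral>\<^sup>+s. \<integral>\<^sup>+r. ennreal (1 / \<bar>s\<bar>) * h s * (ennreal (1 / \<bar>r\<bar>) * w (s * r)) \<partial>lborel \<partial>lborel)"
    by (rule nn_integral_cong_AE, rule AE_mp[OF AE0], intro AE_I2 impI, subst nn_integral_cmult)
       (auto simp: nn_integral_haar_scale[of w] A_def)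
  also have "\<dots> = (\<integral>\<^sup>+r. \<integral>\<^sup>+s. ennreal (1 / \<bar>s\<bar>) * h s * (ennreal (1 / \<bar>r\<bar>) * w (s * r)) \<partial>lborel \<partial>lborel)"
    by (rule lborel_pair.Fubini') measurable
  also have "\<dots> = (\<integral>\<^sup>+r. \<integral>\<^sup>+s. ennreal (1 / \<bar>s\<bar>) * h (1/r * s) * (ennreal (1 / \<bar>r\<bar>) * w s) \<partial>lborel \<partial>lborel)"
  proof (rule nn_integral_cong_AE, rule AE_mp[OF AE0], intro AE_I2 impI)
    fix r :: real assume r: "r \<noteq> 0"
    show "(\<integral>\<^sup>+s. ennreal (1 / \<bar>s\<bar>) * h s * (ennreal (1 / \<bar>r\<bar>) * w (s * r)) \<partial>lborel)
        = (\<integral>\<^sup>+s. ennreal (1 / \<bar>s\<bar>) * h (1/r * s) * (ennreal (1 / \<bar>r\<bar>) * w s) \<partial>lborel)"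
      using r nn_integral_haar_scale[of "\<lambda>s. h s * (ennreal (1 / \<bar>r\<bar>) * w (s * r))" "1/r"]
      by (simp add: mult.assoc)
  qed
  also have "\<dots> = (\<integral>\<^sup>+s. \<integral>\<^sup>+r. ennreal (1 / \<bar>s\<bar>) * h (1/r * s) * (ennreal (1 / \<bar>r\<bar>) * w s) \<partial>lborel \<partial>lborel)"
    by (rule lborel_pair.Fubini') measurable
  also have "\<dots> = (\<integral>\<^sup>+s. ennreal (1 / \<bar>s\<bar>) * w s * A (\<lambda>r. h (1 / r)) \<partial>lborel)"
  proof (rule nn_integral_cong_AE, rule AE_mp[OF AE0], intro AE_I2 impI)
    fix s :: real assume s: "s \<noteq> 0"
    have "(\<integral>\<^sup>+r. ennreal (1 / \<bar>s\<bar>) * h (1/r * s) * (ennreal (1 / \<bar>r\<bar>) * w s) \<partial>lborel)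
       = (\<integral>\<^sup>+r. (ennreal (1 / \<bar>s\<bar>) * w s) * (ennreal (1 / \<bar>r\<bar>) * h (1/(1/s*r))) \<partial>lborel)"
      by (simp add: mult_ac)
    also have "\<dots> = (ennreal (1 / \<bar>s\<bar>) * w s) * (\<integral>\<^sup>+r. ennreal (1 / \<bar>r\<bar>) * h (1/(1/s*r)) \<partial>lborel)"
      by (rule nn_integral_cmult) measurable
    also have "(\<integral>\<^sup>+r. ennreal (1 / \<bar>r\<bar>) * h (1/(1/s*r)) \<partial>lborel) = A (\<lambda>r. h (1 / r))"
      unfolding A_def using s by (intro nn_integral_haar_scale[of "\<lambda>r. h (1/r)"]) auto
    finally show "(\<integral>\<^sup>+r. ennreal (1 / \<bar>s\<bar>) * h (1/r * s) * (ennreal (1 / \<bar>r\<bar>) * w s) \<partial>lborel)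
       = ennreal (1 / \<bar>s\<bar>) * w s * A (\<lambda>r. h (1 / r))" .
  qed
  also have "\<dots> = A w * A (\<lambda>r. h (1 / r))"
    unfolding A_def by (rule nn_integral_multc) measurable
  finally have eq: "A w * A h = A w * A (\<lambda>r. h (1 / r))" by (simp add: mult.commute)
  have "A w \<le> (\<integral>\<^sup>+s. indicator {1..2} s \<partial>(lborel::real measure))"
    unfolding A_def w_def by (intro nn_integral_mono) (auto simp: indicator_def)
  then have "A w < \<infinity>" by (auto simp: less_top[symmetric] top_unique)
  moreover have "A w \<noteq> 0"
  proof -
    have "(\<integral>\<^sup>+s. ennreal (1/2) * indicator {1..2} s \<partial>(lborel::real measure)) \<le> A w"
      unfolding A_def w_def
    proof (rule nn_integral_mono)
      fix s :: real
      have "1/2 \<le> 1 / \<bar>s\<bar>" if "s \<in> {1..2}" using that by (simp add: field_simps)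
      then show "ennreal (1/2) * indicator {1..2} s \<le> ennreal (1 / \<bar>s\<bar>) * indicator {1..2} s"
        using ennreal_leI[of "1/2" "1 / \<bar>s\<bar>"]
        by (cases "s \<in> {1..2}") (simp_all only: indicator_simps mult_1_right mult_zero_right order_refl not_False_eq_True)
    qed
    then have "ennreal (1/2) \<le> A w" by (simp add: nn_integral_cmult_indicator)
    then show ?thesis by (auto simp: ennreal_eq_0_iff)
  qed
  ultimately have "A h = A (\<lambda>r. h (1 / r))"
    using eq by (metis ennreal_mult_cancel_left infinity_ennreal_def less_irrefl)
  then show ?thesis by (simp add: A_def)
qed

text \<open>Both sides integrate \<open>f\<close> over the hyperbola s t = -c. Passing from the
  parameter s to t is an inversion followed by a scaling by -c, and ds/|s| is invariant under
  both.\<close>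

lemma nn_integral_haar_hyperbola:
  fixes f :: "real \<times> real \<Rightarrow> ennreal"
  assumes f: "f \<in> borel_measurable borel" and c: "c \<noteq> 0"
  shows "(\<integral>\<^sup>+s. ennreal (1 / \<bar>s\<bar>) * f (s, - (c / s)) \<partial>lborel) = (\<integral>\<^sup>+t. ennreal (1 / \<bar>t\<bar>) * f (- (c / t), t) \<partial>lborel)"
proof -
  have [measurable]: "f \<in> borel_measurable (borel \<Otimes>\<^sub>M borel)" using f by (simp add: borel_prod)
  have "(\<integral>\<^sup>+s. ennreal (1 / \<bar>s\<bar>) * f (s, - (c / s)) \<partial>lborel)
      = (\<integral>\<^sup>+s. ennreal (1 / \<bar>s\<bar>) * f (- c * s, - (c / (- c * s))) \<partial>lborel)"
    by (rule nn_integral_haar_scale[of "\<lambda>s. f (s, - (c / s))" "- c", symmetric]) (use c in auto)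
  also have "\<dots> = (\<integral>\<^sup>+s. ennreal (1 / \<bar>s\<bar>) * f (- c * (1/s), - (c / (- c * (1/s)))) \<partial>lborel)"
    by (rule nn_integral_haar_inverse[symmetric]) measurable
  also have "\<dots> = (\<integral>\<^sup>+t. ennreal (1 / \<bar>t\<bar>) * f (- (c / t), t) \<partial>lborel)"
    using c by simp
  finally show ?thesis .
qed

lemma AE_lborel_inner_neq_0:
  fixes a :: "'a::euclidean_space"
  assumes "a \<noteq> 0"
  shows "AE x in lborel. a \<bullet> x \<noteq> 0"
proof -
  have "negligible {x. a \<bullet> x = 0}" using assms by (intro negligible_hyperplane) auto
  then have "{x. a \<bullet> x = 0} \<in> null_sets lebesgue" by (simp add: negligible_iff_null_sets)
  moreover have "{x. a \<bullet> x = 0} \<in> sets lborel" by simp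
  ultimately have "{x. a \<bullet> x = 0} \<in> null_sets lborel"
    by (metis null_sets_completion_iff)
  then show ?thesis by (rule AE_I') auto
qed

text \<open>In graph coordinates over \<open>e\<^sup>\<bottom>\<close> the incidence \<open>\<eta> \<bullet> x = 0\<close> reads \<open>s t = - c\<close>, where \<open>s, t\<close> are
  the \<open>e\<close>-components of \<open>\<eta>, x\<close> and \<open>c\<close> is the inner product of the remaining parts; both sides
  of the identity then use the same measure \<open>ds/|s| = dt/|t|\<close> on this hyperbola.\<close>

lemma nn_integral_incidence:
  fixes G H :: "'a::euclidean_space \<Rightarrow> ennreal"
  assumes dim: "DIM('a) \<ge> 2"
    and G[measurable]: "G \<in> borel_measurable borel" and H[measurable]: "H \<in> borel_measurable borel"
  shows "(\<integral>\<^sup>+\<eta>. H \<eta> * (ennreal (1 / norm \<eta>) * (\<integral>\<^sup>+x. G x \<partial>subspace_lborel (hyperplane_perp \<eta>))) \<partial>lborel)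
       = (\<integral>\<^sup>+x. G x * (ennreal (1 / norm x) * (\<integral>\<^sup>+\<eta>. H \<eta> \<partial>subspace_lborel (hyperplane_perp x))) \<partial>lborel)"
proof -
  obtain e :: 'a where eB: "e \<in> Basis" using nonempty_Basis by blast
  have e: "norm e = 1" using eB by simp
  then have ee: "e \<bullet> e = 1" by (simp add: norm_eq_1)
  let ?k = "indicator {0..1} :: real \<Rightarrow> ennreal"
  let ?p = "\<lambda>y::'a. y - (y \<bullet> e) *\<^sub>R e"
  have pe: "?p y \<bullet> e = 0" for y by (simp add: inner_diff_left ee)
  have pp: "?p (?p y + s *\<^sub>R e) = ?p y" for y s by (simp add: inner_add_left inner_diff_left ee)
  \<comment> \<open>Graph coordinates for both the point and the normal bring one side into a form
    whose only asymmetry is the parameter on the hyperbola. The formula is stated for arbitrary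
    \<open>G\<close> and \<open>H\<close> because it is used a second time with the two
    interchanged.\<close>
  have key: "(\<integral>\<^sup>+\<eta>. H \<eta> * (ennreal (1 / norm \<eta>) * (\<integral>\<^sup>+x. G x \<partial>subspace_lborel (hyperplane_perp \<eta>))) \<partial>lborel)
     = (\<integral>\<^sup>+\<eta>. \<integral>\<^sup>+y. ?k (\<eta> \<bullet> e) * (?k (y \<bullet> e) * (\<integral>\<^sup>+s. ennreal (1 / \<bar>s\<bar>) *
          (H (?p \<eta> + s *\<^sub>R e) * G (?p y + (- ((?p \<eta> \<bullet> ?p y) / s)) *\<^sub>R e)) \<partial>lborel)) \<partial>lborel \<partial>lborel)"
    if [measurable]: "G \<in> borel_measurable borel" "H \<in> borel_measurable borel" for G H :: "'a \<Rightarrow> ennreal"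
  proof -
    define u where "u \<eta> = H \<eta> * (ennreal (1 / \<bar>\<eta> \<bullet> e\<bar>) * (\<integral>\<^sup>+y. ?k (y \<bullet> e) *
         G (?p y - ((\<eta> \<bullet> ?p y) / (\<eta> \<bullet> e)) *\<^sub>R e) \<partial>lborel))" for \<eta>
    have [measurable]: "u \<in> borel_measurable borel" unfolding u_def by measurable
    have "e \<noteq> 0" using e by auto
    from AE_lborel_inner_neq_0[OF this]
    have "(\<integral>\<^sup>+\<eta>. H \<eta> * (ennreal (1 / norm \<eta>) * (\<integral>\<^sup>+x. G x \<partial>subspace_lborel (hyperplane_perp \<eta>))) \<partial>lborel) = (\<integral>\<^sup>+\<eta>. u \<eta> \<partial>lborel)"
      unfolding u_def
      by (intro nn_integral_cong_AE) (auto simp: inner_commute nn_integral_hyperplane_graph[OF e])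
    also have "\<dots> = (\<integral>\<^sup>+\<eta>. ?k (\<eta> \<bullet> e) * (\<integral>\<^sup>+s. u (?p \<eta> + s *\<^sub>R e) \<partial>lborel) \<partial>lborel)"
      by (rule nn_integral_coordinate_split[OF e]) measurable
    also have "\<dots> = (\<integral>\<^sup>+\<eta>. \<integral>\<^sup>+y. ?k (\<eta> \<bullet> e) * (?k (y \<bullet> e) * (\<integral>\<^sup>+s. ennreal (1 / \<bar>s\<bar>) *
          (H (?p \<eta> + s *\<^sub>R e) * G (?p y + (- ((?p \<eta> \<bullet> ?p y) / s)) *\<^sub>R e)) \<partial>lborel)) \<partial>lborel \<partial>lborel)"
    proof (rule nn_integral_cong)
      fix \<eta> :: 'a
      have "u (?p \<eta> + s *\<^sub>R e) = (\<integral>\<^sup>+y. ?k (y \<bullet> e) * (ennreal (1 / \<bar>s\<bar>) *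
          (H (?p \<eta> + s *\<^sub>R e) * G (?p y + (- ((?p \<eta> \<bullet> ?p y) / s)) *\<^sub>R e))) \<partial>lborel)" for s
      proof -
        have 1: "(?p \<eta> + s *\<^sub>R e) \<bullet> e = s" using pe[of \<eta>] by (simp only: inner_add_left inner_scaleR_left ee)
        have 2: "(?p \<eta> + s *\<^sub>R e) \<bullet> ?p y = ?p \<eta> \<bullet> ?p y" for y
          using pe[of y] by (simp only: inner_add_left inner_scaleR_left inner_commute[of e])
        have "u (?p \<eta> + s *\<^sub>R e) = H (?p \<eta> + s *\<^sub>R e) * ennreal (1 / \<bar>s\<bar>) * (\<integral>\<^sup>+y. ?k (y \<bullet> e) *
             G (?p y - ((?p \<eta> \<bullet> ?p y) / s) *\<^sub>R e) \<partial>lborel)"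
          unfolding u_def 1 2 by (simp only: mult.assoc)
        also have "\<dots> = (\<integral>\<^sup>+y. (H (?p \<eta> + s *\<^sub>R e) * ennreal (1 / \<bar>s\<bar>)) * (?k (y \<bullet> e) *
             G (?p y - ((?p \<eta> \<bullet> ?p y) / s) *\<^sub>R e)) \<partial>lborel)"
          by (rule nn_integral_cmult[symmetric]) measurable
        also have "\<dots> = (\<integral>\<^sup>+y. ?k (y \<bullet> e) * (ennreal (1 / \<bar>s\<bar>) *
          (H (?p \<eta> + s *\<^sub>R e) * G (?p y + (- ((?p \<eta> \<bullet> ?p y) / s)) *\<^sub>R e))) \<partial>lborel)"
          by (rule nn_integral_cong) (simp only: mult_ac scaleR_minus_left diff_conv_add_uminus)
        finally show ?thesis .
      qed
      then have "(\<integral>\<^sup>+s. u (?p \<eta> + s *\<^sub>R e) \<partial>lborel) = (\<integral>\<^sup>+s. \<integral>\<^sup>+y. ?k (y \<bullet> e) * (ennreal (1 / \<bar>s\<bar>) *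
          (H (?p \<eta> + s *\<^sub>R e) * G (?p y + (- ((?p \<eta> \<bullet> ?p y) / s)) *\<^sub>R e))) \<partial>lborel \<partial>lborel)"
        by (simp only:)
      also have "\<dots> = (\<integral>\<^sup>+y. \<integral>\<^sup>+s. ?k (y \<bullet> e) * (ennreal (1 / \<bar>s\<bar>) *
          (H (?p \<eta> + s *\<^sub>R e) * G (?p y + (- ((?p \<eta> \<bullet> ?p y) / s)) *\<^sub>R e))) \<partial>lborel \<partial>lborel)"
        by (rule lborel_pair.Fubini') measurable
      also have "\<dots> = (\<integral>\<^sup>+y. ?k (y \<bullet> e) * (\<integral>\<^sup>+s. ennreal (1 / \<bar>s\<bar>) *
          (H (?p \<eta> + s *\<^sub>R e) * G (?p y + (- ((?p \<eta> \<bullet> ?p y) / s)) *\<^sub>R e)) \<partial>lborel) \<partial>lborel)"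
        by (rule nn_integral_cong, rule nn_integral_cmult) measurable
      finally show "?k (\<eta> \<bullet> e) * (\<integral>\<^sup>+s. u (?p \<eta> + s *\<^sub>R e) \<partial>lborel) =
         (\<integral>\<^sup>+y. ?k (\<eta> \<bullet> e) * (?k (y \<bullet> e) * (\<integral>\<^sup>+s. ennreal (1 / \<bar>s\<bar>) *
          (H (?p \<eta> + s *\<^sub>R e) * G (?p y + (- ((?p \<eta> \<bullet> ?p y) / s)) *\<^sub>R e)) \<partial>lborel)) \<partial>lborel)"
        by (simp only:) (rule nn_integral_cmult[symmetric], measurable)
    qed
    finally show ?thesis .
  qed
  \<comment> \<open>A second basis direction makes e^perp nontrivial, so the constant c of the
    hyperbola is nonzero for almost all pairs. In dimension one it would vanish identically.\<close>
  obtain e' :: 'a where e': "e' \<in> Basis" "e' \<noteq> e"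
  proof (rule ccontr)
    assume *: "\<not> thesis"
    then have "(Basis::'a set) \<subseteq> {e}" using that by blast
    then have "DIM('a) \<le> 1" by (metis card_mono card.empty card_insert_disjoint finite.emptyI finite.insertI empty_iff One_nat_def)
    then show False using dim by simp
  qed
  have e'0: "e' \<noteq> 0" using e' by (auto simp: nonzero_Basis)
  have ee': "e \<bullet> e' = 0" using eB e' by (simp add: inner_Basis)
  have c0: "AE \<eta> in lborel. AE y in lborel. ?p \<eta> \<bullet> ?p y \<noteq> 0"
  proof (rule AE_mp[OF AE_lborel_inner_neq_0[OF e'0]], rule AE_I2, rule impI)
    fix \<eta> :: 'a assume "e' \<bullet> \<eta> \<noteq> 0"
    then have "?p \<eta> \<bullet> e' \<noteq> 0" using ee' by (simp add: inner_diff_left inner_commute[of \<eta>])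
    then have "?p \<eta> \<noteq> 0" by (metis inner_zero_left)
    moreover have "?p \<eta> \<bullet> y = ?p \<eta> \<bullet> ?p y" for y
      using pe[of \<eta>] by (simp add: inner_diff_right)
    ultimately show "AE y in lborel. ?p \<eta> \<bullet> ?p y \<noteq> 0"
      using AE_lborel_inner_neq_0[of "?p \<eta>"] by simp
  qed
  have "(\<integral>\<^sup>+\<eta>. H \<eta> * (ennreal (1 / norm \<eta>) * (\<integral>\<^sup>+x. G x \<partial>subspace_lborel (hyperplane_perp \<eta>))) \<partial>lborel)
     = (\<integral>\<^sup>+\<eta>. \<integral>\<^sup>+y. ?k (\<eta> \<bullet> e) * (?k (y \<bullet> e) * (\<integral>\<^sup>+s. ennreal (1 / \<bar>s\<bar>) *
          (H (?p \<eta> + s *\<^sub>R e) * G (?p y + (- ((?p \<eta> \<bullet> ?p y) / s)) *\<^sub>R e)) \<partial>lborel)) \<partial>lborel \<partial>lborel)"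
    by (rule key) measurable
  also have "\<dots> = (\<integral>\<^sup>+\<eta>. \<integral>\<^sup>+y. ?k (y \<bullet> e) * (?k (\<eta> \<bullet> e) * (\<integral>\<^sup>+t. ennreal (1 / \<bar>t\<bar>) *
          (G (?p y + t *\<^sub>R e) * H (?p \<eta> + (- ((?p y \<bullet> ?p \<eta>) / t)) *\<^sub>R e)) \<partial>lborel)) \<partial>lborel \<partial>lborel)"
  proof (rule nn_integral_cong_AE, rule AE_mp[OF c0], intro AE_I2 impI, rule nn_integral_cong_AE, erule AE_mp, intro AE_I2 impI)
    fix \<eta> y :: 'a assume c: "?p \<eta> \<bullet> ?p y \<noteq> 0"
    have "(\<integral>\<^sup>+s. ennreal (1 / \<bar>s\<bar>) * (H (?p \<eta> + s *\<^sub>R e) * G (?p y + (- ((?p \<eta> \<bullet> ?p y) / s)) *\<^sub>R e)) \<partial>lborel)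
       = (\<integral>\<^sup>+t. ennreal (1 / \<bar>t\<bar>) * (H (?p \<eta> + (- ((?p \<eta> \<bullet> ?p y) / t)) *\<^sub>R e) * G (?p y + t *\<^sub>R e)) \<partial>lborel)"
      using nn_integral_haar_hyperbola[OF _ c, of "\<lambda>(s, t). H (?p \<eta> + s *\<^sub>R e) * G (?p y + t *\<^sub>R e)"]
      unfolding borel_prod[symmetric] prod.case by measurable
    then show "?k (\<eta> \<bullet> e) * (?k (y \<bullet> e) * (\<integral>\<^sup>+s. ennreal (1 / \<bar>s\<bar>) *
          (H (?p \<eta> + s *\<^sub>R e) * G (?p y + (- ((?p \<eta> \<bullet> ?p y) / s)) *\<^sub>R e)) \<partial>lborel)) =
       ?k (y \<bullet> e) * (?k (\<eta> \<bullet> e) * (\<integral>\<^sup>+t. ennreal (1 / \<bar>t\<bar>) *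
          (G (?p y + t *\<^sub>R e) * H (?p \<eta> + (- ((?p y \<bullet> ?p \<eta>) / t)) *\<^sub>R e)) \<partial>lborel))"
      by (simp only: mult_ac inner_commute[of "?p y"])
  qed
  also have "\<dots> = (\<integral>\<^sup>+y. \<integral>\<^sup>+\<eta>. ?k (y \<bullet> e) * (?k (\<eta> \<bullet> e) * (\<integral>\<^sup>+t. ennreal (1 / \<bar>t\<bar>) *
          (G (?p y + t *\<^sub>R e) * H (?p \<eta> + (- ((?p y \<bullet> ?p \<eta>) / t)) *\<^sub>R e)) \<partial>lborel)) \<partial>lborel \<partial>lborel)"
    by (rule lborel_pair.Fubini') measurable
  also have "\<dots> = (\<integral>\<^sup>+x. G x * (ennreal (1 / norm x) * (\<integral>\<^sup>+\<eta>. H \<eta> \<partial>subspace_lborel (hyperplane_perp x))) \<partial>lborel)"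
    by (rule key[symmetric]) measurable
  finally show ?thesis .
qed

section \<open>Smoothed pairings\<close>

text \<open>Here \<open>m\<close> will be the density \<open>f\<^sub>n\<^sub>1\<close> restricted to
  a body. The integral over r runs along the full line through x, and the z-integral is the cut-off
  kernel convolved with an unnormalised standard Gaussian, evaluated at r x. Values in
  \<open>ennreal\<close> allow all exchanges before finiteness is known.\<close>

definition smoothed_pairing :: "('a::euclidean_space \<Rightarrow> real) \<Rightarrow> ('a \<Rightarrow> real) \<Rightarrow> real \<Rightarrow> ennreal" where
  "smoothed_pairing g m T = (\<integral>\<^sup>+x. ennreal (m x) * (\<integral>\<^sup>+r. \<integral>\<^sup>+z.
     ennreal (g z * exp (-((norm z)\<^sup>2)/(2 * T\<^sup>2)) * exp (-((norm (z - r *\<^sub>R x))\<^sup>2)/2)) \<partial>lborel \<partial>lborel) \<partial>lborel)"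

lemma norm_diff_scaleR_square:
  fixes x z :: "'a::euclidean_space"
  assumes x: "x \<noteq> 0"
  shows "(norm (z - r *\<^sub>R x))\<^sup>2 = (norm (z - ((x \<bullet> z) / (norm x)\<^sup>2) *\<^sub>R x))\<^sup>2
    + (norm x)\<^sup>2 * (r - (x \<bullet> z) / (norm x)\<^sup>2)\<^sup>2"
proof -
  have exp: "(norm (z - c *\<^sub>R x))\<^sup>2 = (norm z)\<^sup>2 - 2 * c * (x \<bullet> z) + c\<^sup>2 * (norm x)\<^sup>2" for c
    unfolding power2_norm_eq_inner
    by (simp add: inner_diff_left inner_diff_right inner_commute power2_eq_square algebra_simps)
  define c where "c = (x \<bullet> z) / (norm x)\<^sup>2"
  have c: "x \<bullet> z = c * (norm x)\<^sup>2" using x by (simp add: c_def)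
  show ?thesis unfolding c_def[symmetric] exp unfolding c
    by (simp add: algebra_simps power2_eq_square)
qed

lemma nn_integral_gaussian_line:
  fixes x z :: "'a::euclidean_space"
  assumes x: "x \<noteq> 0"
  shows "(\<integral>\<^sup>+r. ennreal (exp (-((norm (z - r *\<^sub>R x))\<^sup>2)/2)) \<partial>lborel)
       = ennreal (sqrt (2*pi) / norm x * exp (-((norm (z - ((x \<bullet> z) / (norm x)\<^sup>2) *\<^sub>R x))\<^sup>2)/2))"
proof -
  let ?c = "(x \<bullet> z) / (norm x)\<^sup>2"
  let ?P = "exp (-((norm (z - ?c *\<^sub>R x))\<^sup>2)/2)"
  have eq: "(norm (z - r *\<^sub>R x))\<^sup>2 = (norm (z - ?c *\<^sub>R x))\<^sup>2 + (norm x)\<^sup>2 * (r + - ?c)\<^sup>2" for r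
    by (subst norm_diff_scaleR_square[OF x]) simp
  have "(\<integral>\<^sup>+r. ennreal (exp (-((norm (z - r *\<^sub>R x))\<^sup>2)/2)) \<partial>lborel)
     = (\<integral>\<^sup>+r. ennreal ?P * ennreal (exp (-((norm x)\<^sup>2 * (r + - ?c)\<^sup>2)/2)) \<partial>lborel)"
    by (intro nn_integral_cong, subst eq)
       (simp only: ennreal_mult[symmetric] exp_ge_zero mult_exp_exp add_divide_distrib minus_add_distrib)
  also have "\<dots> = ennreal ?P * (\<integral>\<^sup>+r. ennreal (exp (-((norm x)\<^sup>2 * (r + - ?c)\<^sup>2)/2)) \<partial>lborel)"
    by (rule nn_integral_cmult) measurable
  also have "(\<integral>\<^sup>+r. ennreal (exp (-((norm x)\<^sup>2 * (r + - ?c)\<^sup>2)/2)) \<partial>lborel) = (\<integral>\<^sup>+r. ennreal (exp (-((norm x)\<^sup>2 * r\<^sup>2)/2)) \<partial>lborel)"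
    by (rule nn_integral_translate) measurable
  also have "\<dots> = ennreal (sqrt (2*pi) / norm x)" using x by (intro nn_integral_gaussian_real) simp
  finally show ?thesis by (simp flip: ennreal_mult add: mult_ac)
qed

text \<open>This is the projection-slice theorem with a Gaussian weight. The hyperplane integral is
  smeared to an integral of S(P y) against the standard Gaussian, P being the orthogonal projection
  to x^perp. Inserting the definition of \<open>S\<close>, moving the symmetric P to z and
  integrating over y gives exp(-|P z|^2/2), which is up to a factor the Gaussian integrated along
  the line through x.\<close>

lemma hyperplane_integral_gaussian_transform:
  fixes x :: "'a::euclidean_space" and p :: "'a \<Rightarrow> real"
  assumes x: "x \<noteq> 0" and p: "integrable lborel p" "\<And>z. p z \<ge> 0"
    and S: "\<And>\<eta>. complex_of_real (S \<eta>) = (LINT z|lborel. complex_of_real (p z) * exp (- \<i> * complex_of_real (\<eta> \<bullet> z)))"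
    and S0: "\<And>\<eta>. S \<eta> \<ge> 0" and Sm[measurable]: "S \<in> borel_measurable borel"
  shows "ennreal (1 / norm x) * (\<integral>\<^sup>+\<eta>. ennreal (S \<eta> * exp (-((norm \<eta>)\<^sup>2)/2)) \<partial>subspace_lborel (hyperplane_perp x))
    = ennreal (sqrt (2*pi) ^ DIM('a) / (2*pi)) *
       (\<integral>\<^sup>+r. \<integral>\<^sup>+z. ennreal (p z * exp (-((norm (z - r *\<^sub>R x))\<^sup>2)/2)) \<partial>lborel \<partial>lborel)"
proof -
  have pm[measurable]: "p \<in> borel_measurable borel" using p by (auto dest: borel_measurable_integrable)
  define P where "P y = y - ((x \<bullet> y) / (norm x)\<^sup>2) *\<^sub>R x" for y
  have Pm[measurable]: "P \<in> borel_measurable borel" unfolding P_def by measurable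
  have Psym: "P y \<bullet> z = y \<bullet> P z" for y z
    unfolding P_def by (simp add: inner_diff_left inner_diff_right inner_commute)
  have nx: "norm x > 0" using x by simp
  \<comment> \<open>At t = x . y this is the Gaussian of the component of y along x; multiplied by
    the Gaussian of P y it is the standard Gaussian of y.\<close>
  let ?k = "\<lambda>t. ennreal (exp (-((1 / norm x)\<^sup>2 * t\<^sup>2)/2))"
  let ?H = "\<lambda>\<eta>. ennreal (S \<eta> * exp (-((norm \<eta>)\<^sup>2)/2))"
  let ?\<sigma> = "\<integral>\<^sup>+\<eta>. ?H \<eta> \<partial>subspace_lborel (hyperplane_perp x)"
  define F where "F = (\<lambda>(y::'a, z::'a). complex_of_real (exp (-((norm y)\<^sup>2)/2)) * (complex_of_real (p z) * exp (- \<i> * complex_of_real (P y \<bullet> z))))"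
  have [measurable]: "F \<in> borel_measurable (lborel \<Otimes>\<^sub>M lborel)" unfolding F_def by measurable
  have g1: "(\<integral>\<^sup>+(y::'a). ennreal (exp (-((norm y)\<^sup>2)/2)) \<partial>lborel) = ennreal (sqrt (2*pi) ^ DIM('a))"
    using nn_integral_gaussian[of 1, where 'a='a] by simp
  have Fi: "integrable (lborel \<Otimes>\<^sub>M lborel) F"
  proof (rule integrableI_bounded)
    have g1': "(\<integral>\<^sup>+(y::'a). ennreal (exp (-((norm y)\<^sup>2/2))) \<partial>lborel) = ennreal (sqrt (2*pi) ^ DIM('a))"
      using g1 by simp
    have "(\<integral>\<^sup>+w. ennreal (norm (F w)) \<partial>(lborel \<Otimes>\<^sub>M lborel)) = (\<integral>\<^sup>+y. \<integral>\<^sup>+z. ennreal (norm (F (y, z))) \<partial>lborel \<partial>lborel)"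
      by (rule lborel.nn_integral_fst[symmetric]) measurable
    also have "\<dots> = (\<integral>\<^sup>+y. \<integral>\<^sup>+z. ennreal (exp (-((norm (y::'a))\<^sup>2)/2)) * ennreal (p z) \<partial>lborel \<partial>lborel)"
      by (simp add: F_def norm_mult p(2) flip: ennreal_mult)
    also have "\<dots> = ennreal (sqrt (2*pi) ^ DIM('a)) * (\<integral>\<^sup>+z. ennreal (p z) \<partial>lborel)"
      by (simp add: nn_integral_cmult nn_integral_multc g1')
    also have "\<dots> < \<infinity>" using p by (simp add: integrable_iff_bounded ennreal_mult_less_top)
    finally show "(\<integral>\<^sup>+w. ennreal (norm (F w)) \<partial>(lborel \<Otimes>\<^sub>M lborel)) < \<infinity>" .
  qed measurable
  have inner1: "(LINT z|lborel. F (y, z)) = complex_of_real (S (P y) * exp (-((norm y)\<^sup>2)/2))" for y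
    unfolding F_def prod.case integral_mult_right_zero S[symmetric] by simp
  have inner2: "(LINT y|lborel. F (y, z)) = complex_of_real (sqrt (2*pi) ^ DIM('a) * (p z * exp (-((norm (P z))\<^sup>2)/2)))" for z
  proof -
    have "(LINT y|lborel. F (y, z)) = (LINT y|lborel. complex_of_real (p z) *
        (complex_of_real (exp (-(1\<^sup>2 * (norm y)\<^sup>2)/2)) * exp (\<i> * complex_of_real (y \<bullet> (- P z)))))"
      unfolding F_def by (intro Bochner_Integration.integral_cong) (auto simp: Psym mult_ac)
    also have "\<dots> = complex_of_real (p z) * complex_of_real ((sqrt (2*pi) / 1)^DIM('a) * exp (-((norm (- P z))\<^sup>2)/(2 * 1\<^sup>2)))"
      unfolding integral_mult_right_zero by (subst gaussian_fourier) simp_all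
    finally show ?thesis by (simp add: mult_ac)
  qed
  have Si: "integrable lborel (\<lambda>y. S (P y) * exp (-((norm y)\<^sup>2)/2))"
    using lborel_pair.integrable_fst'[OF Fi] unfolding inner1 complex_of_real_integrable_eq .
  have Pi: "integrable lborel (\<lambda>z. sqrt (2*pi) ^ DIM('a) * (p z * exp (-((norm (P z))\<^sup>2)/2)))"
    using lborel_pair.integrable_snd[of "\<lambda>y z. F (y, z)"] Fi unfolding inner2 complex_of_real_integrable_eq by simp
  have "complex_of_real (LINT y|lborel. S (P y) * exp (-((norm y)\<^sup>2)/2)) = (LINT y|lborel. LINT z|lborel. F (y, z))"
    unfolding inner1 by (simp only: integral_complex_of_real)
  also have "\<dots> = (LINT z|lborel. LINT y|lborel. F (y, z))"
    using lborel_pair.Fubini_integral[of "\<lambda>y z. F (y, z)"] Fi by simp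
  also have "\<dots> = complex_of_real (LINT z|lborel. sqrt (2*pi) ^ DIM('a) * (p z * exp (-((norm (P z))\<^sup>2)/2)))"
    unfolding inner2 by (simp only: integral_complex_of_real)
  finally have re: "(LINT y|lborel. S (P y) * exp (-((norm y)\<^sup>2)/2)) = (LINT z|lborel. sqrt (2*pi) ^ DIM('a) * (p z * exp (-((norm (P z))\<^sup>2)/2)))"
    by (simp only: of_real_eq_iff)
  have kH: "?k (x \<bullet> y) * ?H (P y) = ennreal (S (P y) * exp (-((norm y)\<^sup>2)/2))" for y
  proof -
    have "(norm y)\<^sup>2 = (x \<bullet> y)\<^sup>2 / (norm x)\<^sup>2 + (norm (P y))\<^sup>2"
      using norm_diff_scaleR_square[OF x, of y 0] x unfolding P_def by (simp add: power_divide power2_eq_square)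
    then have "exp (-((norm y)\<^sup>2)/2) = exp (-((1 / norm x)\<^sup>2 * (x \<bullet> y)\<^sup>2)/2) * exp (-((norm (P y))\<^sup>2)/2)"
      by (simp flip: exp_add add: power_divide field_simps)
    then show ?thesis using S0 by (simp only: ennreal_mult[symmetric] exp_ge_zero mult_nonneg_nonneg mult_ac)
  qed
  have km: "?k \<in> borel_measurable borel" and Hm: "?H \<in> borel_measurable borel" by measurable
  have n1: "1 / norm x > 0" using nx by simp
  have "ennreal (1 / norm x) * (ennreal (sqrt (2*pi) / (1 / norm x)) * ?\<sigma>) = (\<integral>\<^sup>+y. ?k (x \<bullet> y) * ?H (P y) \<partial>lborel)"
    unfolding P_def nn_integral_hyperplane_slab[OF x Hm km] nn_integral_gaussian_real[OF n1] ..
  also have "\<dots> = ennreal (LINT y|lborel. S (P y) * exp (-((norm y)\<^sup>2)/2))"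
    unfolding kH using S0 by (intro nn_integral_eq_integral Si) auto
  also have "\<dots> = (\<integral>\<^sup>+z. ennreal (sqrt (2*pi) ^ DIM('a) * (p z * exp (-((norm (P z))\<^sup>2)/2))) \<partial>lborel)"
    unfolding re using p(2) by (intro nn_integral_eq_integral[symmetric] Pi) auto
  also have "\<dots> = (\<integral>\<^sup>+z. ennreal (sqrt (2*pi) ^ DIM('a) / sqrt (2*pi) * norm x) * (ennreal (p z) * (\<integral>\<^sup>+r. ennreal (exp (-((norm (z - r *\<^sub>R x))\<^sup>2)/2)) \<partial>lborel)) \<partial>lborel)"
    unfolding nn_integral_gaussian_line[OF x] P_def using nx p(2)
    by (intro nn_integral_cong) (simp flip: ennreal_mult)
  also have "\<dots> = ennreal (sqrt (2*pi) ^ DIM('a) / sqrt (2*pi) * norm x) * (\<integral>\<^sup>+z. \<integral>\<^sup>+r. ennreal (p z * exp (-((norm (z - r *\<^sub>R x))\<^sup>2)/2)) \<partial>lborel \<partial>lborel)"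
    using p(2) by (subst nn_integral_cmult) (auto simp: ennreal_mult nn_integral_cmult)
  also have "(\<integral>\<^sup>+z. \<integral>\<^sup>+r. ennreal (p z * exp (-((norm (z - r *\<^sub>R x))\<^sup>2)/2)) \<partial>lborel \<partial>lborel) = (\<integral>\<^sup>+r. \<integral>\<^sup>+z. ennreal (p z * exp (-((norm (z - r *\<^sub>R x))\<^sup>2)/2)) \<partial>lborel \<partial>lborel)"
    (is "_ = ?I")
    by (rule lborel_pair.Fubini') measurable
  finally have eq: "ennreal (1 / norm x) * (ennreal (sqrt (2*pi) / (1 / norm x)) * ?\<sigma>) = ennreal (sqrt (2*pi) ^ DIM('a) / sqrt (2*pi) * norm x) * ?I" .
  have em: "ennreal a * (ennreal b * X) = ennreal (a * b) * X" if "a \<ge> 0" for a b X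
    using that by (simp only: ennreal_mult' mult.assoc)
  let ?a = "1 / (norm x * sqrt (2*pi))"
  have a0: "?a \<ge> 0" by simp
  have pp: "sqrt (2*pi) * sqrt (2*pi) = 2*pi" by simp
  have "ennreal (1 / norm x) * ?\<sigma> = ennreal (?a * (1 / norm x * (sqrt (2*pi) / (1 / norm x)))) * ?\<sigma>"
    using nx by simp
  also have "\<dots> = ennreal ?a * (ennreal (1 / norm x) * (ennreal (sqrt (2*pi) / (1 / norm x)) * ?\<sigma>))"
    unfolding em[OF less_imp_le[OF n1]] em[OF a0] ..
  also have "\<dots> = ennreal (?a * (sqrt (2*pi) ^ DIM('a) / sqrt (2*pi) * norm x)) * ?I"
    unfolding eq by (rule em[OF a0])
  also have "?a * (sqrt (2*pi) ^ DIM('a) / sqrt (2*pi) * norm x) = sqrt (2*pi) ^ DIM('a) / (sqrt (2*pi) * sqrt (2*pi))"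
    using nx by simp
  also have "\<dots> = sqrt (2*pi) ^ DIM('a) / (2*pi)" unfolding pp ..
  finally show ?thesis .
qed

lemma nn_integral_kernel_gaussian_finite:
  fixes g :: "'a::euclidean_space \<Rightarrow> real"
  assumes dim: "DIM('a) \<ge> 2"
    and [measurable]: "g \<in> borel_measurable borel" and g0: "\<And>z. g z \<ge> 0" and gC: "\<And>z. g z \<le> C / norm z"
    and T: "T > 0"
  shows "(\<integral>\<^sup>+z. ennreal (g z * exp (-((norm z)\<^sup>2)/(2 * T\<^sup>2))) \<partial>lborel) < \<infinity>"
proof -
  have C0: "C \<ge> 0"
  proof -
    obtain b :: 'a where "b \<in> Basis" using nonempty_Basis by blast
    then show ?thesis using g0[of b] gC[of b] by simp
  qed
  have "(\<integral>\<^sup>+z. ennreal (g z * exp (-((norm z)\<^sup>2)/(2 * T\<^sup>2))) \<partial>lborel)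
     \<le> (\<integral>\<^sup>+(z::'a). ennreal C * ennreal (1 / norm z * exp (-((1/T)\<^sup>2*(norm z)\<^sup>2)/2)) \<partial>lborel)"
  proof (intro nn_integral_mono)
    fix z
    have "g z * exp (-((norm z)\<^sup>2)/(2 * T\<^sup>2)) \<le> C / norm z * exp (-((norm z)\<^sup>2)/(2 * T\<^sup>2))"
      by (intro mult_right_mono gC) simp
    also have "\<dots> = C * (1 / norm z * exp (-((1/T)\<^sup>2*(norm z)\<^sup>2)/2))"
      by (simp add: power_divide mult.commute)
    finally show "ennreal (g z * exp (-((norm z)\<^sup>2)/(2 * T\<^sup>2))) \<le> ennreal C * ennreal (1 / norm z * exp (-((1/T)\<^sup>2*(norm z)\<^sup>2)/2))"
      using C0 by (simp only: ennreal_mult'[symmetric] ennreal_leI)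
  qed
  also have "\<dots> < \<infinity>"
    using nn_integral_inverse_norm_gaussian_finite[OF dim, of "1/T"] T
    by (subst nn_integral_cmult) (auto simp: ennreal_mult_less_top)
  finally show ?thesis .
qed

lemma smoothed_pairing_mono_sections:
  fixes g m m' :: "'a::euclidean_space \<Rightarrow> real"
  assumes dim: "DIM('a) \<ge> 2"
    and pd: "positive_definite_distribution (function_distribution g)"
    and g[measurable]: "g \<in> borel_measurable borel" and g0: "\<And>z. g z \<ge> 0" and gC: "\<And>z. g z \<le> C / norm z"
    and m[measurable]: "m \<in> borel_measurable borel" "m' \<in> borel_measurable borel"
    and T: "T > 0"
    and sec: "\<And>\<xi>. norm \<xi> = 1 \<Longrightarrow> (\<integral>\<^sup>+x. ennreal (m x) \<partial>subspace_lborel (hyperplane_perp \<xi>))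
        \<le> (\<integral>\<^sup>+x. ennreal (m' x) \<partial>subspace_lborel (hyperplane_perp \<xi>))"
  shows "smoothed_pairing g m T \<le> smoothed_pairing g m' T"
proof -
  define p where "p z = g z * exp (-((norm z)\<^sup>2)/(2 * T\<^sup>2))" for z
  have pm[measurable]: "p \<in> borel_measurable borel" unfolding p_def by measurable
  have p0: "p z \<ge> 0" for z using g0 by (simp add: p_def)
  have pi: "integrable lborel p"
    using nn_integral_kernel_gaussian_finite[OF dim g g0 gC T] p0
    by (intro integrableI_bounded) (auto simp: p_def)
  \<comment> \<open>Membership in the nonnegative reals includes a vanishing imaginary part, so the
    real part is the whole transform.\<close>
  define S where "S \<eta> = Re (LINT z|lborel. complex_of_real (p z) * exp (- \<i> * complex_of_real (\<eta> \<bullet> z)))" for \<eta>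
  have nn: "(LINT z|lborel. complex_of_real (p z) * exp (- \<i> * complex_of_real (\<eta> \<bullet> z))) \<in> \<real>\<^sub>\<ge>\<^sub>0" for \<eta>
    using positive_definite_gaussian_transform[OF pd T, of \<eta>] by (simp only: p_def)
  have S: "complex_of_real (S \<eta>) = (LINT z|lborel. complex_of_real (p z) * exp (- \<i> * complex_of_real (\<eta> \<bullet> z)))" for \<eta>
    using nn[of \<eta>] unfolding S_def complex_nonneg_Reals_iff by (simp add: complex_eq_iff)
  have S0: "S \<eta> \<ge> 0" for \<eta> using nn[of \<eta>] unfolding S_def complex_nonneg_Reals_iff by simp
  have Sm[measurable]: "S \<in> borel_measurable borel" unfolding S_def by measurable
  define H where "H \<eta> = ennreal (S \<eta> * exp (-((norm \<eta>)\<^sup>2)/2))" for \<eta>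
  have [measurable]: "H \<in> borel_measurable borel" unfolding H_def by measurable
  define \<kappa> where "\<kappa> = ennreal (sqrt (2*pi) ^ DIM('a) / (2*pi))"
  have \<kappa>: "\<kappa> \<noteq> 0" "\<kappa> \<noteq> \<top>" unfolding \<kappa>_def by (auto simp: ennreal_eq_0_iff not_le)
  \<comment> \<open>The body enters the right side only through its section integrals, and they are
    weighted by the nonnegative \<open>H\<close>; this makes the pairing monotone in the
    sections.\<close>
  have J: "\<kappa> * smoothed_pairing g m T = (\<integral>\<^sup>+\<eta>. H \<eta> * (ennreal (1 / norm \<eta>) * (\<integral>\<^sup>+x. ennreal (m x) \<partial>subspace_lborel (hyperplane_perp \<eta>))) \<partial>lborel)"
    if [measurable]: "m \<in> borel_measurable borel" for m
  proof -
    have "\<kappa> * smoothed_pairing g m T = (\<integral>\<^sup>+x. \<kappa> * (ennreal (m x) * (\<integral>\<^sup>+r. \<integral>\<^sup>+z.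
       ennreal (p z * exp (-((norm (z - r *\<^sub>R x))\<^sup>2)/2)) \<partial>lborel \<partial>lborel)) \<partial>lborel)"
      unfolding smoothed_pairing_def p_def[symmetric] by (rule nn_integral_cmult[symmetric]) measurable
    also have "\<dots> = (\<integral>\<^sup>+x. ennreal (m x) * (ennreal (1 / norm x) * (\<integral>\<^sup>+\<eta>. H \<eta> \<partial>subspace_lborel (hyperplane_perp x))) \<partial>lborel)"
    proof (rule nn_integral_cong_AE, rule AE_mp[OF AE_lborel_singleton[of "0::'a"]], intro AE_I2 impI)
      fix x :: 'a assume x: "x \<noteq> 0"
      show "\<kappa> * (ennreal (m x) * (\<integral>\<^sup>+r. \<integral>\<^sup>+z. ennreal (p z * exp (-((norm (z - r *\<^sub>R x))\<^sup>2)/2)) \<partial>lborel \<partial>lborel))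
         = ennreal (m x) * (ennreal (1 / norm x) * (\<integral>\<^sup>+\<eta>. H \<eta> \<partial>subspace_lborel (hyperplane_perp x)))"
        unfolding H_def hyperplane_integral_gaussian_transform[OF x pi p0 S S0 Sm] \<kappa>_def
        by (simp only: mult_ac)
    qed
    also have "\<dots> = (\<integral>\<^sup>+\<eta>. H \<eta> * (ennreal (1 / norm \<eta>) * (\<integral>\<^sup>+x. ennreal (m x) \<partial>subspace_lborel (hyperplane_perp \<eta>))) \<partial>lborel)"
      by (rule nn_integral_incidence[OF dim, symmetric]) measurable
    finally show ?thesis .
  qed
  have "\<kappa> * smoothed_pairing g m T \<le> \<kappa> * smoothed_pairing g m' T"
    unfolding J[OF m(1)] J[OF m(2)]
  proof (rule nn_integral_mono_AE, rule AE_mp[OF AE_lborel_singleton[of "0::'a"]], intro AE_I2 impI)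
    fix \<eta> :: 'a assume \<eta>: "\<eta> \<noteq> 0"
    have "hyperplane_perp ((1 / norm \<eta>) *\<^sub>R \<eta>) = hyperplane_perp \<eta>"
      using \<eta> by (intro hyperplane_perp_scaleR) simp
    then have "(\<integral>\<^sup>+x. ennreal (m x) \<partial>subspace_lborel (hyperplane_perp \<eta>)) \<le> (\<integral>\<^sup>+x. ennreal (m' x) \<partial>subspace_lborel (hyperplane_perp \<eta>))"
      using sec[of "(1 / norm \<eta>) *\<^sub>R \<eta>"] \<eta> by simp
    then show "H \<eta> * (ennreal (1 / norm \<eta>) * (\<integral>\<^sup>+x. ennreal (m x) \<partial>subspace_lborel (hyperplane_perp \<eta>)))
      \<le> H \<eta> * (ennreal (1 / norm \<eta>) * (\<integral>\<^sup>+x. ennreal (m' x) \<partial>subspace_lborel (hyperplane_perp \<eta>)))"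
      by (intro mult_left_mono) auto
  qed
  then show ?thesis using \<kappa> by (simp add: ennreal_mult_le_mult_iff)
qed

section \<open>Continuity of translations\<close>

text \<open>Openness controls only one half of the symmetric difference: a point of \<open>U\<close>
  stays in \<open>U\<close> under small shifts, so the measure of \<open>U\<close> minus its shifted
  copy tends to 0 by dominated convergence. The other half has equal measure, because
  \<open>U\<close> and its translate have the same finite measure and their intersection
  cancels.\<close>

lemma nn_integral_translate_diff_open:
  fixes U :: "'a::euclidean_space set"
  assumes U: "open U" "emeasure lborel U < \<infinity>" and u: "u \<longlonglongrightarrow> 0"
  shows "(\<lambda>k. \<integral>\<^sup>+x. ennreal \<bar>indicator U (x + u k) - indicator U x\<bar> \<partial>lborel) \<longlonglongrightarrow> 0"
proof -
  have [measurable]: "U \<in> sets borel" using U by simp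
  let ?m = "\<lambda>k. (\<integral>\<^sup>+x. indicator (U - (\<lambda>x. x + u k) -` U) x \<partial>lborel)"
  let ?I = "\<lambda>k. (\<integral>\<^sup>+x. indicator (U \<inter> (\<lambda>x. x + u k) -` U) x \<partial>lborel)"
  have [measurable]: "(\<lambda>x. x + u k) -` U \<in> sets borel" for k
    using measurable_sets[of "\<lambda>x. x + u k" borel borel U] by simp
  have "(\<lambda>k. ?m k) \<longlonglongrightarrow> (\<integral>\<^sup>+x. 0 \<partial>(lborel::'a measure))"
  proof (rule nn_integral_dominated_convergence[where w="indicator U"])
    show "(\<integral>\<^sup>+x. indicator U x \<partial>lborel) < \<infinity>" using U by simp
    have "(\<lambda>k. indicator (U - (\<lambda>x. x + u k) -` U) x :: ennreal) \<longlonglongrightarrow> 0" for x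
    proof (cases "x \<in> U")
      case True
      have "(\<lambda>k. x + u k) \<longlonglongrightarrow> x + 0" by (intro tendsto_intros u)
      then have "eventually (\<lambda>k. x + u k \<in> U) sequentially"
        using U(1) True by (intro topological_tendstoD) auto
      then have "eventually (\<lambda>k. indicator (U - (\<lambda>x. x + u k) -` U) x = (0::ennreal)) sequentially"
        by eventually_elim auto
      then show ?thesis by (rule tendsto_eventually)
    qed simp
    then show "AE x in lborel. (\<lambda>k. indicator (U - (\<lambda>x. x + u k) -` U) x :: ennreal) \<longlonglongrightarrow> 0" by simp
  qed (auto simp: indicator_def)
  then have m0: "?m \<longlonglongrightarrow> 0" by simp
  have "(\<integral>\<^sup>+x. ennreal \<bar>indicator U (x + u k) - indicator U x\<bar> \<partial>lborel) = ?m k + ?m k" for k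
  proof -
    let ?d = "\<integral>\<^sup>+x. indicator ((\<lambda>x. x + u k) -` U - U) x \<partial>lborel"
    have "?m k + ?I k = (\<integral>\<^sup>+x. indicator (U - (\<lambda>x. x + u k) -` U) x + indicator (U \<inter> (\<lambda>x. x + u k) -` U) x \<partial>lborel)"
      by (rule nn_integral_add[symmetric]) measurable
    also have "\<dots> = (\<integral>\<^sup>+x. indicator U x \<partial>lborel)"
      by (rule nn_integral_cong) (auto simp: indicator_def)
    also have "\<dots> = (\<integral>\<^sup>+x. indicator U (x + u k) \<partial>lborel)" by (rule nn_integral_translate[symmetric]) measurable
    also have "\<dots> = ?d + ?I k"
      by (subst nn_integral_add[symmetric]) (auto intro!: nn_integral_cong simp: indicator_def)
    finally have "?m k + ?I k = ?d + ?I k" .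
    moreover have "?I k \<le> (\<integral>\<^sup>+x. indicator U x \<partial>lborel)" by (intro nn_integral_mono) (auto simp: indicator_def)
    then have "?I k \<noteq> \<top>" using U(2) by (auto simp: top_unique)
    ultimately have "?m k = ?d" by (simp add: add.commute[of _ "?I k"] ennreal_add_left_cancel)
    moreover have "(\<integral>\<^sup>+x. ennreal \<bar>indicator U (x + u k) - indicator U x\<bar> \<partial>lborel) = ?m k + ?d"
      by (subst nn_integral_add[symmetric]) (auto intro!: nn_integral_cong simp: indicator_def)
    ultimately show ?thesis by simp
  qed
  then show ?thesis using tendsto_add[OF m0 m0] by simp
qed

lemma nn_integral_translate_diff_approx:
  fixes f h :: "'a::euclidean_space \<Rightarrow> real"
  assumes [measurable]: "f \<in> borel_measurable borel" "h \<in> borel_measurable borel"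
  shows "(\<integral>\<^sup>+x. ennreal \<bar>f (x + t) - f x\<bar> \<partial>lborel)
    \<le> (\<integral>\<^sup>+x. ennreal \<bar>h (x + t) - h x\<bar> \<partial>lborel) + 2 * (\<integral>\<^sup>+x. ennreal \<bar>f x - h x\<bar> \<partial>lborel)"
proof -
  have "(\<integral>\<^sup>+x. ennreal \<bar>f (x + t) - f x\<bar> \<partial>lborel) \<le>
     (\<integral>\<^sup>+x. ennreal \<bar>h (x + t) - h x\<bar> + (ennreal \<bar>f (x + t) - h (x + t)\<bar> + ennreal \<bar>f x - h x\<bar>) \<partial>lborel)"
    by (intro nn_integral_mono) (auto simp flip: ennreal_plus intro!: ennreal_leI)
  also have "\<dots> = (\<integral>\<^sup>+x. ennreal \<bar>h (x + t) - h x\<bar> \<partial>lborel)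
     + ((\<integral>\<^sup>+x. ennreal \<bar>f (x + t) - h (x + t)\<bar> \<partial>lborel) + (\<integral>\<^sup>+x. ennreal \<bar>f x - h x\<bar> \<partial>lborel))"
    by (simp add: nn_integral_add)
  also have "(\<integral>\<^sup>+x. ennreal \<bar>f (x + t) - h (x + t)\<bar> \<partial>lborel) = (\<integral>\<^sup>+x. ennreal \<bar>f x - h x\<bar> \<partial>lborel)"
    by (rule nn_integral_translate[of "\<lambda>x. ennreal \<bar>f x - h x\<bar>"]) measurable
  finally show ?thesis by (simp add: mult_2)
qed

lemma nn_integral_translate_diff_limit:
  fixes f :: "'a::euclidean_space \<Rightarrow> real"
  assumes [measurable]: "f \<in> borel_measurable borel"
    and approx: "\<And>e::real. e > 0 \<Longrightarrow> \<exists>h\<in>borel_measurable borel. (\<integral>\<^sup>+x. ennreal \<bar>f x - h x\<bar> \<partial>lborel) \<le> ennreal e \<and>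
       (\<lambda>k. \<integral>\<^sup>+x. ennreal \<bar>h (x + u k) - h x\<bar> \<partial>lborel) \<longlonglongrightarrow> 0"
  shows "(\<lambda>k. \<integral>\<^sup>+x. ennreal \<bar>f (x + u k) - f x\<bar> \<partial>lborel) \<longlonglongrightarrow> 0"
proof (rule order_tendstoI)
  fix a :: ennreal assume "0 < a"
  then obtain e where e: "0 < e" "ennreal e < a"
    using dense[of 0 a] by (metis ennreal_cases ennreal_eq_0_iff ennreal_less_zero_iff not_less order_less_imp_le top.not_eq_extremum not_top_less)
  obtain h where h[measurable]: "h \<in> borel_measurable borel" and he: "(\<integral>\<^sup>+x. ennreal \<bar>f x - h x\<bar> \<partial>lborel) \<le> ennreal (e/4)"
    and hl: "(\<lambda>k. \<integral>\<^sup>+x. ennreal \<bar>h (x + u k) - h x\<bar> \<partial>lborel) \<longlonglongrightarrow> 0"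
    using approx[of "e/4"] e by auto
  have "eventually (\<lambda>k. (\<integral>\<^sup>+x. ennreal \<bar>h (x + u k) - h x\<bar> \<partial>lborel) < ennreal (e/2)) sequentially"
    using e by (intro order_tendstoD[OF hl]) auto
  then show "eventually (\<lambda>k. (\<integral>\<^sup>+x. ennreal \<bar>f (x + u k) - f x\<bar> \<partial>lborel) < a) sequentially"
  proof eventually_elim
    case (elim k)
    have "(\<integral>\<^sup>+x. ennreal \<bar>f (x + u k) - f x\<bar> \<partial>lborel)
      \<le> (\<integral>\<^sup>+x. ennreal \<bar>h (x + u k) - h x\<bar> \<partial>lborel) + 2 * (\<integral>\<^sup>+x. ennreal \<bar>f x - h x\<bar> \<partial>lborel)"
      by (rule nn_integral_translate_diff_approx) measurable
    also have "\<dots> \<le> ennreal (e/2) + 2 * ennreal (e/4)"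
      using elim he by (intro add_mono mult_left_mono) auto
    also have "2 * ennreal (e/4) = ennreal (e/2)"
      using ennreal_mult[of 2 "e/4"] e by simp
    also have "ennreal (e/2) + ennreal (e/2) = ennreal e"
      using e by (simp flip: ennreal_plus)
    finally show ?case using e(2) by simp
  qed
qed simp

lemma nn_integral_translate_diff_tendsto_0:
  fixes f :: "'a::euclidean_space \<Rightarrow> real"
  assumes f: "integrable lborel f" and u: "u \<longlonglongrightarrow> 0"
  shows "(\<lambda>k. \<integral>\<^sup>+x. ennreal \<bar>f (x + u k) - f x\<bar> \<partial>lborel) \<longlonglongrightarrow> 0"
  using f
proof (induction rule: integrable_induct)
  case (base A c)
  then have [measurable]: "A \<in> sets borel" by simp
  show ?case
  proof (rule nn_integral_translate_diff_limit)
    fix e :: real assume e: "e > 0"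
    \<comment> \<open>Adding 1 in the denominator keeps the quotient meaningful when c = 0.\<close>
    define e' where "e' = e / (\<bar>c\<bar> + 1)"
    have e': "e' > 0" using e by (simp add: e'_def)
    have ce: "\<bar>c\<bar> * e' \<le> e" using e by (simp add: e'_def field_simps)
    obtain U where U: "open U" "A \<subseteq> U" "emeasure lborel (U - A) < ennreal e'"
      using outer_regular_lborel[of A e'] e' by auto
    have [measurable]: "U \<in> sets borel" using U by simp
    have "emeasure lborel U \<le> emeasure lborel A + emeasure lborel (U - A)"
      using U by (subst plus_emeasure) (auto intro!: emeasure_mono)
    also have "\<dots> < \<infinity>" using base U(3) by (auto simp: less_top[symmetric] top_unique)
    finally have Uf: "emeasure lborel U < \<infinity>" .
    have "(\<integral>\<^sup>+x. ennreal \<bar>indicator A x *\<^sub>R c - indicator U x *\<^sub>R c\<bar> \<partial>lborel) = (\<integral>\<^sup>+x. ennreal \<bar>c\<bar> * indicator (U - A) x \<partial>lborel)"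
      using U(2) by (intro nn_integral_cong) (auto simp: indicator_def)
    also have "\<dots> = ennreal \<bar>c\<bar> * emeasure lborel (U - A)" by (simp add: nn_integral_cmult_indicator)
    also have "\<dots> \<le> ennreal \<bar>c\<bar> * ennreal e'" using U(3) by (intro mult_left_mono) auto
    also have "\<dots> \<le> ennreal e" using ce e' by (simp flip: ennreal_mult add: ennreal_leI)
    finally have 1: "(\<integral>\<^sup>+x. ennreal \<bar>indicator A x *\<^sub>R c - indicator U x *\<^sub>R c\<bar> \<partial>lborel) \<le> ennreal e" .
    have "(\<integral>\<^sup>+x. ennreal \<bar>indicator U (x + u k) *\<^sub>R c - indicator U x *\<^sub>R c\<bar> \<partial>lborel)
        = ennreal \<bar>c\<bar> * (\<integral>\<^sup>+x. ennreal \<bar>indicator U (x + u k) - indicator U x\<bar> \<partial>lborel)" for k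
      by (subst nn_integral_cmult[symmetric])
         (auto intro!: nn_integral_cong simp: abs_mult simp flip: ennreal_mult left_diff_distrib)
    moreover have "(\<lambda>k. ennreal \<bar>c\<bar> * (\<integral>\<^sup>+x. ennreal \<bar>indicator U (x + u k) - indicator U x\<bar> \<partial>lborel)) \<longlonglongrightarrow> ennreal \<bar>c\<bar> * 0"
      by (intro ennreal_tendsto_cmult nn_integral_translate_diff_open U Uf u) simp
    ultimately have 2: "(\<lambda>k. \<integral>\<^sup>+x. ennreal \<bar>indicator U (x + u k) *\<^sub>R c - indicator U x *\<^sub>R c\<bar> \<partial>lborel) \<longlonglongrightarrow> 0" by simp
    show "\<exists>h\<in>borel_measurable borel. (\<integral>\<^sup>+x. ennreal \<bar>indicator A x *\<^sub>R c - h x\<bar> \<partial>lborel) \<le> ennreal e \<and>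
       (\<lambda>k. \<integral>\<^sup>+x. ennreal \<bar>h (x + u k) - h x\<bar> \<partial>lborel) \<longlonglongrightarrow> 0"
      by (rule bexI[of _ "\<lambda>x. indicator U x *\<^sub>R c"]) (use 1 2 in auto)
  qed measurable
next
  case (add f g)
  have [measurable]: "f \<in> borel_measurable borel" "g \<in> borel_measurable borel"
    using add by (auto dest: borel_measurable_integrable)
  have "(\<lambda>k. (\<integral>\<^sup>+x. ennreal \<bar>f (x + u k) - f x\<bar> \<partial>lborel) + (\<integral>\<^sup>+x. ennreal \<bar>g (x + u k) - g x\<bar> \<partial>lborel)) \<longlonglongrightarrow> 0 + 0"
    by (intro tendsto_add add)
  then have lim: "(\<lambda>k. (\<integral>\<^sup>+x. ennreal \<bar>f (x + u k) - f x\<bar> \<partial>lborel) + (\<integral>\<^sup>+x. ennreal \<bar>g (x + u k) - g x\<bar> \<partial>lborel)) \<longlonglongrightarrow> 0"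
    by simp
  show ?case
  proof (rule tendsto_sandwich[OF _ _ tendsto_const lim])
    show "\<forall>\<^sub>F k in sequentially. (\<integral>\<^sup>+x. ennreal \<bar>f (x + u k) + g (x + u k) - (f x + g x)\<bar> \<partial>lborel)
       \<le> (\<integral>\<^sup>+x. ennreal \<bar>f (x + u k) - f x\<bar> \<partial>lborel) + (\<integral>\<^sup>+x. ennreal \<bar>g (x + u k) - g x\<bar> \<partial>lborel)"
    proof (rule always_eventually, rule allI)
      fix k
      have "(\<integral>\<^sup>+x. ennreal \<bar>f (x + u k) + g (x + u k) - (f x + g x)\<bar> \<partial>lborel)
         \<le> (\<integral>\<^sup>+x. ennreal \<bar>f (x + u k) - f x\<bar> + ennreal \<bar>g (x + u k) - g x\<bar> \<partial>lborel)"
        by (intro nn_integral_mono) (auto simp flip: ennreal_plus intro!: ennreal_leI)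
      then show "(\<integral>\<^sup>+x. ennreal \<bar>f (x + u k) + g (x + u k) - (f x + g x)\<bar> \<partial>lborel)
         \<le> (\<integral>\<^sup>+x. ennreal \<bar>f (x + u k) - f x\<bar> \<partial>lborel) + (\<integral>\<^sup>+x. ennreal \<bar>g (x + u k) - g x\<bar> \<partial>lborel)"
        by (simp add: nn_integral_add)
    qed
  qed simp
next
  case (lim f s)
  have [measurable]: "f \<in> borel_measurable borel" "\<And>i. s i \<in> borel_measurable borel"
    using lim by (auto dest: borel_measurable_integrable)
  show ?case
  proof (rule nn_integral_translate_diff_limit)
    fix e :: real assume e: "e > 0"
    have "(\<lambda>i. \<integral>\<^sup>+x. ennreal \<bar>f x - s i x\<bar> \<partial>lborel) \<longlonglongrightarrow> (\<integral>\<^sup>+x. 0 \<partial>(lborel::'a measure))"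
    \<comment> \<open>The approximants of the induction rule satisfy |s i x| <= 2 |f x|, hence the
      majorant 3 |f|.\<close>
    proof (rule nn_integral_dominated_convergence[where w="\<lambda>x. ennreal (3 * \<bar>f x\<bar>)"])
      have "(\<integral>\<^sup>+x. ennreal (3 * \<bar>f x\<bar>) \<partial>lborel) = ennreal 3 * (\<integral>\<^sup>+x. ennreal \<bar>f x\<bar> \<partial>lborel)"
        by (simp add: ennreal_mult nn_integral_cmult)
      then show "(\<integral>\<^sup>+x. ennreal (3 * \<bar>f x\<bar>) \<partial>lborel) < \<infinity>"
        using lim.hyps(4) by (simp add: integrable_iff_bounded ennreal_mult_less_top)
      have "\<bar>f x - s i x\<bar> \<le> 3 * \<bar>f x\<bar>" for i x using lim.hyps(3)[of x i] by simp
      then show "AE x in lborel. ennreal \<bar>f x - s i x\<bar> \<le> ennreal (3 * \<bar>f x\<bar>)" for i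
        by (simp add: ennreal_leI)
      have "(\<lambda>i. ennreal \<bar>f x - s i x\<bar>) \<longlonglongrightarrow> ennreal \<bar>f x - f x\<bar>" for x
        using lim.hyps(2)[of x] by (intro tendsto_intros) auto
      then show "AE x in lborel. (\<lambda>i. ennreal \<bar>f x - s i x\<bar>) \<longlonglongrightarrow> 0" by simp
    qed auto
    then have "(\<lambda>i. \<integral>\<^sup>+x. ennreal \<bar>f x - s i x\<bar> \<partial>lborel) \<longlonglongrightarrow> 0" by simp
    then have "eventually (\<lambda>i. (\<integral>\<^sup>+x. ennreal \<bar>f x - s i x\<bar> \<partial>lborel) < ennreal e) sequentially"
      using e by (intro order_tendstoD) auto
    then obtain i where "(\<integral>\<^sup>+x. ennreal \<bar>f x - s i x\<bar> \<partial>lborel) < ennreal e"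
      by (auto simp: eventually_sequentially)
    then show "\<exists>h\<in>borel_measurable borel. (\<integral>\<^sup>+x. ennreal \<bar>f x - h x\<bar> \<partial>lborel) \<le> ennreal e \<and>
       (\<lambda>k. \<integral>\<^sup>+x. ennreal \<bar>h (x + u k) - h x\<bar> \<partial>lborel) \<longlonglongrightarrow> 0"
      using lim.IH[of i] by (intro bexI[of _ "s i"]) auto
  qed measurable
qed

section \<open>Logarithmic growth of smoothed pairings\<close>

text \<open>On the ball of radius R the constant 1 is at most exp(R^2/2) times the standard
  Gaussian, which reduces the claim to the Gaussian case.\<close>

lemma nn_integral_inverse_norm_bounded_support_finite:
  fixes m :: "'a::euclidean_space \<Rightarrow> real"
  assumes dim: "DIM('a) \<ge> 2" and m: "\<And>x. m x \<le> B" "\<And>x. norm x > R \<Longrightarrow> m x = 0" and B: "B \<ge> 0"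
  shows "(\<integral>\<^sup>+x. ennreal (m x * (1 / norm x)) \<partial>lborel) < \<infinity>"
proof -
  have "(\<integral>\<^sup>+x. ennreal (m x * (1 / norm x)) \<partial>lborel)
    \<le> (\<integral>\<^sup>+(x::'a). ennreal (B * exp (R\<^sup>2/2)) * ennreal (1 / norm x * exp (-(1\<^sup>2*(norm x)\<^sup>2)/2)) \<partial>lborel)"
  proof (intro nn_integral_mono)
    fix x
    have "m x * (1 / norm x) \<le> B * exp (R\<^sup>2/2) * (1 / norm x * exp (-(1\<^sup>2*(norm x)\<^sup>2)/2))"
    proof (cases "norm x > R")
      case True then show ?thesis using m(2) B by simp
    next
      case False
      then have "(norm x)\<^sup>2 \<le> R\<^sup>2" by (intro power_mono) auto
      then have "1 \<le> exp (R\<^sup>2/2) * exp (-(1\<^sup>2*(norm x)\<^sup>2)/2)" by (simp flip: exp_add)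
      then have "m x * 1 \<le> B * (exp (R\<^sup>2/2) * exp (-(1\<^sup>2*(norm x)\<^sup>2)/2))"
        using m(1)[of x] B by (metis mult_mono order_trans zero_le_one mult_1_right mult_left_mono)
      then have "m x * 1 * (1 / norm x) \<le> B * (exp (R\<^sup>2/2) * exp (-(1\<^sup>2*(norm x)\<^sup>2)/2)) * (1 / norm x)"
        by (intro mult_right_mono) auto
      then show ?thesis by (simp add: mult_ac)
    qed
    then show "ennreal (m x * (1 / norm x)) \<le> ennreal (B * exp (R\<^sup>2/2)) * ennreal (1 / norm x * exp (-(1\<^sup>2*(norm x)\<^sup>2)/2))"
      using B by (subst ennreal_mult[symmetric]) (auto intro: ennreal_leI)
  qed
  also have "\<dots> < \<infinity>"
    using nn_integral_inverse_norm_gaussian_finite[OF dim, of 1]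
    by (subst nn_integral_cmult) (auto simp: ennreal_mult_less_top)
  finally show ?thesis .
qed

text \<open>Two one-sided estimates replace a bound on the distance, which truncated subtraction
  would obscure; finiteness of the limit makes the subtraction of \<open>E k\<close>
  continuous.\<close>

lemma tendsto_ennreal_squeeze:
  fixes a :: "nat \<Rightarrow> ennreal"
  assumes "\<And>k. a k \<le> l + E k" "\<And>k. l \<le> a k + E k" "E \<longlonglongrightarrow> 0" "l \<noteq> \<top>"
  shows "a \<longlonglongrightarrow> l"
proof (rule tendsto_sandwich[where f="\<lambda>k. l - E k" and h="\<lambda>k. l + E k"])
  show "(\<lambda>k. l + E k) \<longlonglongrightarrow> l" using tendsto_add[OF tendsto_const assms(3), of l] by simp
  show "(\<lambda>k. l - E k) \<longlonglongrightarrow> l" using tendsto_diff_ennreal[OF tendsto_const assms(3,4)] by simp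
  show "\<forall>\<^sub>F k in sequentially. l - E k \<le> a k"
    using assms(2,4) by (auto simp: ennreal_minus_le_iff add.commute intro!: always_eventually)
  show "\<forall>\<^sub>F k in sequentially. a k \<le> l + E k" using assms(1) by simp
qed

text \<open>The difference of the cut-offs \<open>exp(-r\<^sup>2/2T\<^sup>2)\<close> at \<open>T = 2\<close> and \<open>T = 1\<close>.\<close>

definition bump :: "real \<Rightarrow> real" where "bump r = exp (-(r\<^sup>2)/8) - exp (-(r\<^sup>2)/2)"

lemma bump_measurable[measurable]: "bump \<in> borel_measurable borel"
  unfolding bump_def by measurable

lemma bump_nonneg: "bump r \<ge> 0"
  by (simp add: bump_def field_simps)

lemma bump_pos: "r \<noteq> 0 \<Longrightarrow> bump r > 0"
  by (simp add: bump_def field_simps)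

lemma bump_le: "bump r \<le> exp (-(r\<^sup>2)/8)"
  by (simp add: bump_def)

text \<open>Second-order vanishing at 0 is what tames the singularities 1/|s| of the Haar density
  and C/|z| of the kernel. The exponent is written with (1/2)^2 to match the shape of the polynomial
  decay bounds.\<close>

lemma bump_le_square: "bump r \<le> r\<^sup>2 * exp (-((1/2)\<^sup>2*r\<^sup>2)/2)"
proof -
  have "1 - 3 * r\<^sup>2 / 8 \<le> exp (- (3 * r\<^sup>2 / 8))" using exp_ge_add_one_self[of "- (3 * r\<^sup>2 / 8)"] by simp
  then have "1 - exp (- (3 * r\<^sup>2 / 8)) \<le> r\<^sup>2" using zero_le_power2[of r] by linarith
  then have "exp (-(r\<^sup>2)/8) * (1 - exp (- (3 * r\<^sup>2 / 8))) \<le> exp (-(r\<^sup>2)/8) * r\<^sup>2"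
    by (intro mult_left_mono) auto
  moreover have "exp (-(r\<^sup>2)/8) * exp (- (3 * r\<^sup>2 / 8)) = exp (-(r\<^sup>2)/2)" by (simp flip: exp_add)
  ultimately show ?thesis by (simp add: bump_def right_diff_distrib power_divide mult.commute)
qed

text \<open>This is a Frullani integral with value 2 log 2: the amount that one doubling of the
  cut-off adds to the integral of dr/|r| over the line. As a common factor it cancels, so being
  finite and nonzero is what counts.\<close>

definition bump_mass :: ennreal where
  "bump_mass = (\<integral>\<^sup>+s. ennreal (1 / \<bar>s\<bar>) * ennreal (bump s) \<partial>lborel)"

lemma bump_mass_pos: "bump_mass \<noteq> 0"
proof
  assume "bump_mass = 0"
  then have ae: "AE s in lborel. ennreal (1 / \<bar>s\<bar>) * ennreal (bump s) = 0"
    unfolding bump_mass_def by (subst (asm) nn_integral_0_iff_AE) auto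
  have "AE s in (lborel :: real measure). False"
  proof (rule AE_mp[OF ae], rule AE_mp[OF AE_lborel_singleton[of "0::real"]], intro AE_I2 impI)
    fix s :: real assume "s \<noteq> 0" "ennreal (1 / \<bar>s\<bar>) * ennreal (bump s) = 0"
    then show False using bump_pos[of s] by (auto simp: ennreal_eq_0_iff not_le simp flip: ennreal_mult')
  qed
  then show False by (simp add: AE_iff_measurable[OF _ refl])
qed

lemma bump_mass_finite: "bump_mass \<noteq> \<top>"
proof -
  obtain C1 C3 where C: "\<And>r::real. r \<ge> 0 \<Longrightarrow> r ^ 1 * exp (-((1/2)\<^sup>2*r\<^sup>2)/2) \<le> C1"
     "\<And>r::real. r \<ge> 0 \<Longrightarrow> r ^ 3 * exp (-((1/2)\<^sup>2*r\<^sup>2)/2) \<le> C3"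
    using power_times_gaussian_bounded[of "1/2" 1] power_times_gaussian_bounded[of "1/2" 3] by auto
  have le: "1 / t * bump t \<le> (C1 + C3) * (1 / (1 + t\<^sup>2))" if t: "t \<ge> 0" for t :: real
  proof -
    have "1 / t * bump t \<le> 1 / t * (t\<^sup>2 * exp (-((1/2)\<^sup>2*t\<^sup>2)/2))"
      using t by (intro mult_left_mono bump_le_square) simp
    also have "\<dots> = t * exp (-((1/2)\<^sup>2*t\<^sup>2)/2)"
      by (cases "t = 0") (auto simp: power2_eq_square)
    finally have 1: "1 / t * bump t \<le> t * exp (-((1/2)\<^sup>2*t\<^sup>2)/2)" .
    \<comment> \<open>Multiplication by 1 + t^2 produces t and t^3 times a Gaussian, which explains
      the two constants \<open>C1\<close> and \<open>C3\<close>.\<close>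
    have "(1 / t * bump t) * (1 + t\<^sup>2) \<le> t * exp (-((1/2)\<^sup>2*t\<^sup>2)/2) * (1 + t\<^sup>2)"
      by (intro mult_right_mono 1) simp
    also have "\<dots> = t ^ 1 * exp (-((1/2)\<^sup>2*t\<^sup>2)/2) + t ^ 3 * exp (-((1/2)\<^sup>2*t\<^sup>2)/2)"
      by (simp add: algebra_simps power3_eq_cube power2_eq_square)
    also have "\<dots> \<le> C1 + C3" using C[OF t] by (intro add_mono) auto
    finally have "1 / t * bump t \<le> (C1 + C3) / (1 + t\<^sup>2)"
      by (subst pos_le_divide_eq) (auto simp: add_pos_nonneg)
    then show ?thesis by simp
  qed
  have "1 / \<bar>s\<bar> * bump s \<le> (C1 + C3) * (1 / (1 + s\<^sup>2))" for s :: real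
    using le[of "\<bar>s\<bar>"] by (simp add: bump_def)
  then have "bump_mass \<le> (\<integral>\<^sup>+s. ennreal (C1 + C3) * ennreal (1 / (1 + s\<^sup>2)) \<partial>lborel)"
    unfolding bump_mass_def using bump_nonneg
    by (intro nn_integral_mono) (simp flip: ennreal_mult' ennreal_mult'' add: ennreal_leI)
  also have "\<dots> < \<infinity>"
    using nn_integral_inverse_1_plus_square by (subst nn_integral_cmult) (auto simp: ennreal_mult_less_top)
  finally show ?thesis by simp
qed

text \<open>A negative limit would eventually force a linear descent below zero. Applied to
  differences of pairings at T = 2^k, this replaces an asymptotic expansion in log T.\<close>

lemma increments_limit_nonneg:
  fixes x :: "nat \<Rightarrow> real"
  assumes x: "\<And>k. x k \<ge> 0" and lim: "(\<lambda>k. x (Suc k) - x k) \<longlonglongrightarrow> l"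
  shows "l \<ge> 0"
proof (rule ccontr)
  assume "\<not> l \<ge> 0"
  then have l: "l < l/2" "l / 2 < 0" by auto
  obtain N where N: "\<And>k. k \<ge> N \<Longrightarrow> x (Suc k) - x k < l/2"
    using order_tendstoD(2)[OF lim l(1)] by (auto simp: eventually_sequentially)
  have "x (N + k) \<le> x N + real k * (l/2)" for k
  proof (induction k)
    case (Suc k) then show ?case using N[of "N + k"] by (simp add: field_simps)
  qed simp
  moreover obtain k where "real k * (- (l/2)) > x N" using l(2) reals_Archimedean3[of "- (l/2)"] by (auto simp: mult.commute)
  ultimately show False using x[of "N + k"] by (smt (verit) mult_minus_right)
qed

locale homogeneous_kernel =
  fixes g :: "'a::euclidean_space \<Rightarrow> real" and C :: real
  assumes dim: "DIM('a) \<ge> 2"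
    and g_measurable[measurable]: "g \<in> borel_measurable borel"
    and g_nonneg: "\<And>z. g z \<ge> 0" and g_le: "\<And>z. g z \<le> C / norm z"
    and g_homogeneous: "\<And>c z. c \<noteq> 0 \<Longrightarrow> g (c *\<^sub>R z) = g z / \<bar>c\<bar>"
begin

lemma C_nonneg: "C \<ge> 0"
proof -
  obtain b :: 'a where "b \<in> Basis" using nonempty_Basis by blast
  then show ?thesis using g_nonneg[of b] g_le[of b] by simp
qed

text \<open>The difference of two Gaussian cut-offs of \<open>g\<close> keeps mainly the part with
  |z| of order 1. Unlike \<open>g\<close>, which may be singular at the origin and too large at
  infinity, it is bounded and integrable.\<close>

definition shell_kernel :: "'a \<Rightarrow> real" where "shell_kernel z = g z * bump (norm z)"

lemma shell_kernel_measurable[measurable]: "shell_kernel \<in> borel_measurable borel"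
  unfolding shell_kernel_def by measurable

lemma shell_kernel_nonneg: "shell_kernel z \<ge> 0"
  by (simp add: shell_kernel_def g_nonneg bump_nonneg)

lemma shell_kernel_integrable: "integrable lborel shell_kernel"
proof (rule integrableI_bounded)
  have "(\<integral>\<^sup>+z. ennreal (norm (shell_kernel z)) \<partial>lborel) \<le> (\<integral>\<^sup>+z. ennreal (g z * exp (-((norm z)\<^sup>2)/(2 * 2\<^sup>2))) \<partial>lborel)"
    using bump_le g_nonneg shell_kernel_nonneg by (intro nn_integral_mono ennreal_leI) (auto simp: shell_kernel_def intro!: mult_left_mono order_trans[OF bump_le])
  also have "\<dots> < \<infinity>"
    by (rule nn_integral_kernel_gaussian_finite[OF dim g_measurable g_nonneg g_le]) simp
  finally show "(\<integral>\<^sup>+z. ennreal (norm (shell_kernel z)) \<partial>lborel) < \<infinity>" .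
qed measurable

lemma shell_kernel_bounded: "\<exists>B\<ge>0. \<forall>z. shell_kernel z \<le> B"
proof -
  obtain C1 where C1: "\<And>r::real. r \<ge> 0 \<Longrightarrow> r ^ 1 * exp (-((1/2)\<^sup>2*r\<^sup>2)/2) \<le> C1"
    using power_times_gaussian_bounded[of "1/2" 1] by auto
  have C10: "C1 \<ge> 0" using C1[of 0] by simp
  have "shell_kernel z \<le> C * C1" for z
  proof -
    have "shell_kernel z \<le> C / norm z * ((norm z)\<^sup>2 * exp (-((1/2)\<^sup>2*(norm z)\<^sup>2)/2))"
      unfolding shell_kernel_def using C_nonneg by (intro mult_mono g_le bump_le_square bump_nonneg) auto
    also have "\<dots> = C * (norm z ^ 1 * exp (-((1/2)\<^sup>2*(norm z)\<^sup>2)/2))"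
      by (cases "z = 0") (auto simp: power2_eq_square)
    also have "\<dots> \<le> C * C1" using C1[of "norm z"] C_nonneg by (intro mult_left_mono) auto
    finally show ?thesis .
  qed
  then show ?thesis using C10 C_nonneg by (intro exI[of _ "C * C1"]) auto
qed

lemma shell_kernel_scale: "s \<noteq> 0 \<Longrightarrow> shell_kernel (s *\<^sub>R x) = 1 / \<bar>s\<bar> * (g x * bump (norm x * s))"
  by (simp add: shell_kernel_def g_homogeneous bump_def power_mult_distrib mult.commute)

end

locale homogeneous_pairing = homogeneous_kernel g C
  for g :: "'a::euclidean_space \<Rightarrow> real" and C +
  fixes m :: "'a \<Rightarrow> real" and B R :: real
  assumes m_measurable[measurable]: "m \<in> borel_measurable borel"
    and m_nonneg: "\<And>x. m x \<ge> 0" and m_le: "\<And>x. m x \<le> B" and m_support: "\<And>x. norm x > R \<Longrightarrow> m x = 0"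
begin

lemma B_nonneg: "B \<ge> 0"
  using m_nonneg[of 0] m_le[of 0] by simp

text \<open>Whatever z is, the Gaussian integrated along the line through x is at most sqrt(2
  pi)/|x|. This separates z from x, and 1/|x| is integrable over the bounded support of
  \<open>m\<close>.\<close>

lemma smoothed_pairing_finite:
  assumes T: "T > 0"
  shows "smoothed_pairing g m T < \<infinity>"
proof -
  define A where "A = (\<integral>\<^sup>+z. ennreal (g z * exp (-((norm z)\<^sup>2)/(2 * T\<^sup>2))) \<partial>lborel)"
  have A: "A < \<infinity>" unfolding A_def by (rule nn_integral_kernel_gaussian_finite[OF dim g_measurable g_nonneg g_le T])
  have "smoothed_pairing g m T \<le> (\<integral>\<^sup>+x. ennreal (sqrt (2*pi)) * A * ennreal (m x * (1 / norm x)) \<partial>lborel)"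
    unfolding smoothed_pairing_def
  proof (rule nn_integral_mono_AE, rule AE_mp[OF AE_lborel_singleton[of "0::'a"]], intro AE_I2 impI)
    fix x :: 'a assume x: "x \<noteq> 0"
    let ?q = "\<lambda>z. g z * exp (-((norm z)\<^sup>2)/(2 * T\<^sup>2))"
    have q0: "?q z \<ge> 0" for z using g_nonneg by simp
    have "(\<integral>\<^sup>+r. \<integral>\<^sup>+z. ennreal (?q z * exp (-((norm (z - r *\<^sub>R x))\<^sup>2)/2)) \<partial>lborel \<partial>lborel)
       = (\<integral>\<^sup>+z. \<integral>\<^sup>+r. ennreal (?q z * exp (-((norm (z - r *\<^sub>R x))\<^sup>2)/2)) \<partial>lborel \<partial>lborel)"
      by (rule lborel_pair.Fubini') measurable
    also have "\<dots> = (\<integral>\<^sup>+z. ennreal (?q z) * (\<integral>\<^sup>+r. ennreal (exp (-((norm (z - r *\<^sub>R x))\<^sup>2)/2)) \<partial>lborel) \<partial>lborel)"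
      by (rule nn_integral_cong, subst nn_integral_cmult[symmetric]) (auto simp only: ennreal_mult[OF q0 exp_ge_zero], measurable)
    also have "\<dots> \<le> (\<integral>\<^sup>+z. ennreal (?q z) * ennreal (sqrt (2*pi) / norm x) \<partial>lborel)"
      unfolding nn_integral_gaussian_line[OF x]
      by (intro nn_integral_mono mult_left_mono ennreal_leI mult_left_le) auto
    also have "\<dots> = A * ennreal (sqrt (2*pi) / norm x)" unfolding A_def by (rule nn_integral_multc) measurable
    finally have "ennreal (m x) * (\<integral>\<^sup>+r. \<integral>\<^sup>+z. ennreal (?q z * exp (-((norm (z - r *\<^sub>R x))\<^sup>2)/2)) \<partial>lborel \<partial>lborel)
      \<le> ennreal (m x) * (A * ennreal (sqrt (2*pi) / norm x))" by (rule mult_left_mono) simp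
    also have "\<dots> = A * (ennreal (m x) * ennreal (sqrt (2*pi) / norm x))" by (simp only: mult_ac)
    also have "ennreal (m x) * ennreal (sqrt (2*pi) / norm x) = ennreal (m x * (sqrt (2*pi) / norm x))"
      using m_nonneg by (intro ennreal_mult[symmetric]) auto
    also have "m x * (sqrt (2*pi) / norm x) = sqrt (2*pi) * (m x * (1 / norm x))" by simp
    also have "ennreal (sqrt (2*pi) * (m x * (1 / norm x))) = ennreal (sqrt (2*pi)) * ennreal (m x * (1 / norm x))"
      by (rule ennreal_mult') simp
    also have "A * (ennreal (sqrt (2*pi)) * ennreal (m x * (1 / norm x))) = ennreal (sqrt (2*pi)) * A * ennreal (m x * (1 / norm x))"
      by (simp only: mult_ac)
    finally show "ennreal (m x) * (\<integral>\<^sup>+r. \<integral>\<^sup>+z. ennreal (?q z * exp (-((norm (z - r *\<^sub>R x))\<^sup>2)/2)) \<partial>lborel \<partial>lborel)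
      \<le> ennreal (sqrt (2*pi)) * A * ennreal (m x * (1 / norm x))" .
  qed
  also have "\<dots> < \<infinity>"
    using A nn_integral_inverse_norm_bounded_support_finite[OF dim m_le m_support B_nonneg]
    by (subst nn_integral_cmult) (auto simp: ennreal_mult_less_top)
  finally show ?thesis .
qed

text \<open>This is what doubling T adds, rescaled so that the kernel no longer depends on T. The
  scale survives only in the shift v/T, which tends to 0.\<close>

definition dyadic_increment :: "real \<Rightarrow> ennreal" where
  "dyadic_increment T = (\<integral>\<^sup>+x. ennreal (m x) * (\<integral>\<^sup>+s. \<integral>\<^sup>+v.
     ennreal (shell_kernel (s *\<^sub>R x + (1/T) *\<^sub>R v) * exp (-((norm v)\<^sup>2)/2)) \<partial>lborel \<partial>lborel) \<partial>lborel)"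

lemma smoothed_pairing_double:
  assumes T: "T > 0"
  shows "smoothed_pairing g m (2 * T) = smoothed_pairing g m T + dyadic_increment T"
proof -
  let ?E = "\<lambda>x r z. exp (-((norm (z - r *\<^sub>R x))\<^sup>2)/2)"
  have id: "ennreal (g z * exp (-((norm z)\<^sup>2)/(2 * (2 * T)\<^sup>2)) * ?E x r z)
     = ennreal (g z * exp (-((norm z)\<^sup>2)/(2 * T\<^sup>2)) * ?E x r z) + ennreal (1/T * shell_kernel ((1/T) *\<^sub>R z) * ?E x r z)" for x r z
  proof -
    \<comment> \<open>Homogeneity gives g(z) = g(z/T)/T, so the difference of the cut-offs at 2T and
      T is the shell kernel at z/T, divided by T.\<close>
    have gT: "g ((1/T) *\<^sub>R z) = T * g z" using T by (subst g_homogeneous) auto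
    have b: "bump (norm ((1/T) *\<^sub>R z)) = exp (-((norm z)\<^sup>2)/(2 * (2 * T)\<^sup>2)) - exp (-((norm z)\<^sup>2)/(2 * T\<^sup>2))"
      by (simp add: bump_def power_divide power_mult_distrib mult.commute)
    have eq: "1/T * shell_kernel ((1/T) *\<^sub>R z) = g z * (exp (-((norm z)\<^sup>2)/(2 * (2 * T)\<^sup>2)) - exp (-((norm z)\<^sup>2)/(2 * T\<^sup>2)))"
      unfolding shell_kernel_def gT b using T by simp
    have "g z * exp (-((norm z)\<^sup>2)/(2 * (2 * T)\<^sup>2)) * ?E x r z =
       g z * exp (-((norm z)\<^sup>2)/(2 * T\<^sup>2)) * ?E x r z + 1/T * shell_kernel ((1/T) *\<^sub>R z) * ?E x r z"
      unfolding eq by (simp add: algebra_simps)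
    then show ?thesis
      using g_nonneg shell_kernel_nonneg T by (subst ennreal_plus[symmetric]) auto
  qed
  \<comment> \<open>The substitutions z = v + r x and r = T s center the mollifier and rescale the
    line; the Jacobian T cancels the factor 1/T.\<close>
  have D: "(\<integral>\<^sup>+r. \<integral>\<^sup>+z. ennreal (1/T * shell_kernel ((1/T) *\<^sub>R z) * ?E x r z) \<partial>lborel \<partial>lborel)
     = (\<integral>\<^sup>+s. \<integral>\<^sup>+v. ennreal (shell_kernel (s *\<^sub>R x + (1/T) *\<^sub>R v) * exp (-((norm v)\<^sup>2)/2)) \<partial>lborel \<partial>lborel)" for x
  proof -
    have "(\<integral>\<^sup>+r. \<integral>\<^sup>+z. ennreal (1/T * shell_kernel ((1/T) *\<^sub>R z) * ?E x r z) \<partial>lborel \<partial>lborel)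
       = (\<integral>\<^sup>+r. \<integral>\<^sup>+v. ennreal (1/T * shell_kernel ((1/T) *\<^sub>R (v + r *\<^sub>R x)) * ?E x r (v + r *\<^sub>R x)) \<partial>lborel \<partial>lborel)"
      by (rule nn_integral_cong, rule nn_integral_translate[symmetric]) measurable
    also have "\<dots> = ennreal \<bar>T\<bar> * (\<integral>\<^sup>+s. \<integral>\<^sup>+v. ennreal (1/T * shell_kernel ((1/T) *\<^sub>R (v + (0 + T * s) *\<^sub>R x)) * ?E x (0 + T * s) (v + (0 + T * s) *\<^sub>R x)) \<partial>lborel \<partial>lborel)"
      using T by (intro nn_integral_real_affine) measurable
    also have "\<dots> = (\<integral>\<^sup>+s. \<integral>\<^sup>+v. ennreal T * ennreal (1/T * shell_kernel ((1/T) *\<^sub>R (v + (0 + T * s) *\<^sub>R x)) * ?E x (0 + T * s) (v + (0 + T * s) *\<^sub>R x)) \<partial>lborel \<partial>lborel)"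
      using T by (simp add: nn_integral_cmult)
    also have "\<dots> = (\<integral>\<^sup>+s. \<integral>\<^sup>+v. ennreal (shell_kernel (s *\<^sub>R x + (1/T) *\<^sub>R v) * exp (-((norm v)\<^sup>2)/2)) \<partial>lborel \<partial>lborel)"
      using T by (simp flip: ennreal_mult' add: scaleR_add_right add.commute)
    finally show ?thesis .
  qed
  have inner: "(\<integral>\<^sup>+r. \<integral>\<^sup>+z. ennreal (g z * exp (-((norm z)\<^sup>2)/(2 * (2 * T)\<^sup>2)) * ?E x r z) \<partial>lborel \<partial>lborel)
     = (\<integral>\<^sup>+r. \<integral>\<^sup>+z. ennreal (g z * exp (-((norm z)\<^sup>2)/(2 * T\<^sup>2)) * ?E x r z) \<partial>lborel \<partial>lborel)
     + (\<integral>\<^sup>+s. \<integral>\<^sup>+v. ennreal (shell_kernel (s *\<^sub>R x + (1/T) *\<^sub>R v) * exp (-((norm v)\<^sup>2)/2)) \<partial>lborel \<partial>lborel)" for x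
    unfolding id D[symmetric] by (simp add: nn_integral_add)
  show ?thesis
    unfolding smoothed_pairing_def dyadic_increment_def inner distrib_left
    by (rule nn_integral_add) measurable
qed

text \<open>The x-integral is innermost on purpose: for fixed s other than 0, continuity in the
  shift \<open>u\<close> holds after integration over x, as continuity of translations in the mean,
  whereas a fixed line x gives no such control.\<close>

definition line_pairing :: "'a \<Rightarrow> ennreal" where
  "line_pairing u = (\<integral>\<^sup>+s. \<integral>\<^sup>+x. ennreal (m x * shell_kernel (s *\<^sub>R x + u)) \<partial>lborel \<partial>lborel)"

lemma line_pairing_measurable[measurable]: "line_pairing \<in> borel_measurable borel"
  unfolding line_pairing_def by measurable

lemma dyadic_increment_eq:
  "dyadic_increment T = (\<integral>\<^sup>+v. ennreal (exp (-((norm v)\<^sup>2)/2)) * line_pairing ((1/T) *\<^sub>R v) \<partial>lborel)"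
proof -
  let ?f = "\<lambda>x s v. ennreal (exp (-((norm (v::'a))\<^sup>2)/2)) * ennreal (m x * shell_kernel (s *\<^sub>R x + (1/T) *\<^sub>R v))"
  have "dyadic_increment T = (\<integral>\<^sup>+x. \<integral>\<^sup>+s. \<integral>\<^sup>+v. ennreal (m x) *
     ennreal (shell_kernel (s *\<^sub>R x + (1/T) *\<^sub>R v) * exp (-((norm v)\<^sup>2)/2)) \<partial>lborel \<partial>lborel \<partial>lborel)"
    unfolding dyadic_increment_def by (simp add: nn_integral_cmult)
  also have "\<dots> = (\<integral>\<^sup>+x. \<integral>\<^sup>+s. \<integral>\<^sup>+v. ?f x s v \<partial>lborel \<partial>lborel \<partial>lborel)"
    using m_nonneg shell_kernel_nonneg by (simp flip: ennreal_mult add: mult_ac)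
  also have "\<dots> = (\<integral>\<^sup>+x. \<integral>\<^sup>+v. \<integral>\<^sup>+s. ?f x s v \<partial>lborel \<partial>lborel \<partial>lborel)"
    by (rule nn_integral_cong, rule lborel_pair.Fubini') measurable
  also have "\<dots> = (\<integral>\<^sup>+v. \<integral>\<^sup>+x. \<integral>\<^sup>+s. ?f x s v \<partial>lborel \<partial>lborel \<partial>lborel)"
    by (rule lborel_pair.Fubini') measurable
  also have "\<dots> = (\<integral>\<^sup>+v. \<integral>\<^sup>+s. \<integral>\<^sup>+x. ?f x s v \<partial>lborel \<partial>lborel \<partial>lborel)"
    by (rule nn_integral_cong, rule lborel_pair.Fubini') measurable
  also have "\<dots> = (\<integral>\<^sup>+v. ennreal (exp (-((norm v)\<^sup>2)/2)) * line_pairing ((1/T) *\<^sub>R v) \<partial>lborel)"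
    unfolding line_pairing_def by (simp add: nn_integral_cmult)
  finally show ?thesis .
qed

text \<open>The bound is uniform in the shift and so serves as a majorant in s. For |s| <= 1 the
  kernel is bounded and the support of \<open>m\<close> has finite volume. For |s| > 1 the
  substitution s x gains 1/|s|^n, at most 1/s^2 since n is at least 2.\<close>

lemma section_bound: "\<exists>A\<ge>0. \<forall>s u. (\<integral>\<^sup>+x. ennreal (m x * shell_kernel (s *\<^sub>R x + u)) \<partial>lborel) \<le> ennreal (A * (1 / (1 + s\<^sup>2)))"
proof -
  obtain P where P: "P \<ge> 0" "\<And>z. shell_kernel z \<le> P" using shell_kernel_bounded by blast
  define N where "N = enn2real (\<integral>\<^sup>+z. ennreal (shell_kernel z) \<partial>lborel)"
  have N: "(\<integral>\<^sup>+z. ennreal (shell_kernel z) \<partial>lborel) = ennreal N" "N \<ge> 0"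
    using shell_kernel_integrable shell_kernel_nonneg unfolding N_def by (auto simp: integrable_iff_bounded)
  define V where "V = measure lborel (cball (0::'a) R)"
  have V: "emeasure lborel (cball (0::'a) R) = ennreal V"
    unfolding V_def using emeasure_lborel_cball_finite[of "0::'a" R] by (intro emeasure_eq_ennreal_measure) auto
  have V0: "V \<ge> 0" by (simp add: V_def)
  \<comment> \<open>The summands serve the two ranges of s. The factor 2 comes from 1 <= 2/(1 + s^2)
    for |s| <= 1 and from (1 + s^2)/2 <= |s|^n otherwise.\<close>
  define A where "A = 2 * (B * P * V + B * N)"
  have A0: "A \<ge> 0" unfolding A_def using B_nonneg P N(2) V0 by simp
  have "(\<integral>\<^sup>+x. ennreal (m x * shell_kernel (s *\<^sub>R x + u)) \<partial>lborel) \<le> ennreal (A * (1 / (1 + s\<^sup>2)))" for s u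
  proof (cases "\<bar>s\<bar> \<le> 1")
    case True
    have "(\<integral>\<^sup>+x. ennreal (m x * shell_kernel (s *\<^sub>R x + u)) \<partial>lborel) \<le> (\<integral>\<^sup>+x. ennreal (B * P) * indicator (cball (0::'a) R) x \<partial>lborel)"
    proof (rule nn_integral_mono)
      fix x :: 'a
      show "ennreal (m x * shell_kernel (s *\<^sub>R x + u)) \<le> ennreal (B * P) * indicator (cball 0 R) x"
        using m_support[of x] B_nonneg
        by (cases "norm x > R") (auto intro!: ennreal_leI mult_mono m_le P shell_kernel_nonneg)
    qed
    also have "\<dots> = ennreal (B * P) * ennreal V" by (simp add: nn_integral_cmult_indicator V)
    also have "\<dots> = ennreal (B * P * V)" using B_nonneg P V0 by (simp flip: ennreal_mult)
    also have "\<dots> \<le> ennreal (A * (1 / (1 + s\<^sup>2)))"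
    proof (rule ennreal_leI)
      have "s\<^sup>2 \<le> 1" using True by (simp add: abs_square_le_1)
      then have "1/2 \<le> 1 / (1 + s\<^sup>2)" by (simp add: field_simps add_pos_nonneg)
      then have "A * (1/2) \<le> A * (1 / (1 + s\<^sup>2))" using A0 by (intro mult_left_mono)
      moreover have "B * P * V \<le> A * (1/2)" unfolding A_def using B_nonneg N(2) by simp
      ultimately show "B * P * V \<le> A * (1 / (1 + s\<^sup>2))" by (rule order_trans[rotated])
    qed
    finally show ?thesis .
  next
    case False
    then have s: "s \<noteq> 0" "\<bar>s\<bar> \<ge> 1" by auto
    have "(\<integral>\<^sup>+x. ennreal (m x * shell_kernel (s *\<^sub>R x + u)) \<partial>lborel) \<le> (\<integral>\<^sup>+x. ennreal B * ennreal (shell_kernel (s *\<^sub>R x + u)) \<partial>lborel)"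
      using B_nonneg shell_kernel_nonneg by (intro nn_integral_mono) (auto simp flip: ennreal_mult intro!: ennreal_leI mult_right_mono m_le)
    also have "\<dots> = ennreal B * (\<integral>\<^sup>+x. ennreal (shell_kernel (s *\<^sub>R x + u)) \<partial>lborel)" by (rule nn_integral_cmult) measurable
    also have "(\<integral>\<^sup>+x. ennreal (shell_kernel (s *\<^sub>R x + u)) \<partial>lborel) = ennreal (1 / \<bar>s\<bar> ^ DIM('a)) * (\<integral>\<^sup>+x. ennreal (shell_kernel (x + u)) \<partial>lborel)"
      by (subst nn_integral_scale[OF _ s(1), of "\<lambda>x. ennreal (shell_kernel (x + u))"]) (use s in \<open>auto simp flip: ennreal_mult mult.assoc\<close>)
    also have "(\<integral>\<^sup>+x. ennreal (shell_kernel (x + u)) \<partial>lborel) = (\<integral>\<^sup>+x. ennreal (shell_kernel x) \<partial>lborel)" by (rule nn_integral_translate) measurable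
    also have "ennreal B * (ennreal (1 / \<bar>s\<bar> ^ DIM('a)) * (\<integral>\<^sup>+x. ennreal (shell_kernel x) \<partial>lborel)) = ennreal (B * (1 / \<bar>s\<bar> ^ DIM('a) * N))"
      unfolding N using B_nonneg N(2) by (simp flip: ennreal_mult)
    also have "\<dots> \<le> ennreal (A * (1 / (1 + s\<^sup>2)))"
    proof (rule ennreal_leI)
      have "\<bar>s\<bar>\<^sup>2 \<le> \<bar>s\<bar> ^ DIM('a)" using s dim by (intro power_increasing) auto
      moreover have "1 \<le> s\<^sup>2" using s by (metis abs_le_square_iff abs_one one_power2)
      ultimately have "(1 + s\<^sup>2) / 2 \<le> \<bar>s\<bar> ^ DIM('a)" by simp
      then have "1 / \<bar>s\<bar> ^ DIM('a) \<le> 1 / ((1 + s\<^sup>2) / 2)"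
        using s by (intro divide_left_mono) (auto simp: add_pos_nonneg)
      then have "1 / \<bar>s\<bar> ^ DIM('a) \<le> 2 * (1 / (1 + s\<^sup>2))" by simp
      then have "B * (1 / \<bar>s\<bar> ^ DIM('a) * N) \<le> B * (2 * (1 / (1 + s\<^sup>2)) * N)"
        using B_nonneg N(2) by (intro mult_left_mono mult_right_mono) auto
      also have "\<dots> = (2 * (B * N)) * (1 / (1 + s\<^sup>2))" by simp
      also have "\<dots> \<le> A * (1 / (1 + s\<^sup>2))"
        unfolding A_def using B_nonneg P V0 by (intro mult_right_mono) auto
      finally show "B * (1 / \<bar>s\<bar> ^ DIM('a) * N) \<le> A * (1 / (1 + s\<^sup>2))" .
    qed
    finally show ?thesis .
  qed
  with A0 show ?thesis by (intro exI[of _ A] conjI allI)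
qed

text \<open>Since \<open>m\<close> is at most \<open>B\<close>, the error is at most B |s|^(-n)
  times the distance in the mean between the shell kernel and its translate by \<open>u k\<close>;
  the change of variables is where s must be nonzero.\<close>

lemma section_continuous:
  assumes u: "u \<longlonglongrightarrow> 0" and s: "s \<noteq> 0"
  shows "(\<lambda>k. \<integral>\<^sup>+x. ennreal (m x * shell_kernel (s *\<^sub>R x + u k)) \<partial>lborel) \<longlonglongrightarrow> (\<integral>\<^sup>+x. ennreal (m x * shell_kernel (s *\<^sub>R x)) \<partial>lborel)"
proof (rule tendsto_ennreal_squeeze)
  define E where "E k = ennreal B * (ennreal (1 / \<bar>s\<bar> ^ DIM('a)) * (\<integral>\<^sup>+x. ennreal \<bar>shell_kernel (x + u k) - shell_kernel x\<bar> \<partial>lborel))" for k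
  have "E \<longlonglongrightarrow> ennreal B * (ennreal (1 / \<bar>s\<bar> ^ DIM('a)) * 0)"
    unfolding E_def by (intro ennreal_tendsto_cmult nn_integral_translate_diff_tendsto_0 shell_kernel_integrable u) auto
  then show "E \<longlonglongrightarrow> 0" by simp
  have E: "E k = (\<integral>\<^sup>+x. ennreal (B * \<bar>shell_kernel (s *\<^sub>R x + u k) - shell_kernel (s *\<^sub>R x)\<bar>) \<partial>lborel)" for k
  proof -
    have "ennreal (1 / \<bar>s\<bar> ^ DIM('a)) * (\<integral>\<^sup>+x. ennreal \<bar>shell_kernel (x + u k) - shell_kernel x\<bar> \<partial>lborel)
       = (\<integral>\<^sup>+x. ennreal \<bar>shell_kernel (s *\<^sub>R x + u k) - shell_kernel (s *\<^sub>R x)\<bar> \<partial>lborel)"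
      by (subst nn_integral_scale[OF _ s, of "\<lambda>x. ennreal \<bar>shell_kernel (x + u k) - shell_kernel x\<bar>"]) (use s in \<open>auto simp flip: ennreal_mult mult.assoc\<close>)
    then show ?thesis unfolding E_def using B_nonneg by (simp add: ennreal_mult nn_integral_cmult)
  qed
  have le: "m x * a \<le> m x * b + B * \<bar>a - b\<bar>" for x a b
  proof -
    have "m x * (a - b) \<le> m x * \<bar>a - b\<bar>" using m_nonneg by (intro mult_left_mono) auto
    also have "\<dots> \<le> B * \<bar>a - b\<bar>" using m_le by (intro mult_right_mono) auto
    finally show ?thesis by (simp add: algebra_simps)
  qed
  have le': "ennreal (m x * a) \<le> ennreal (m x * b) + ennreal (B * \<bar>a - b\<bar>)" if "b \<ge> 0" for x a b
  proof -
    have "ennreal (m x * a) \<le> ennreal (m x * b + B * \<bar>a - b\<bar>)" by (rule ennreal_leI[OF le])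
    also have "\<dots> = ennreal (m x * b) + ennreal (B * \<bar>a - b\<bar>)"
      using m_nonneg[of x] B_nonneg that by (intro ennreal_plus) auto
    finally show ?thesis .
  qed
  show "(\<integral>\<^sup>+x. ennreal (m x * shell_kernel (s *\<^sub>R x + u k)) \<partial>lborel) \<le> (\<integral>\<^sup>+x. ennreal (m x * shell_kernel (s *\<^sub>R x)) \<partial>lborel) + E k" for k
    unfolding E by (subst nn_integral_add[symmetric]) (auto intro!: nn_integral_mono le' shell_kernel_nonneg)
  show "(\<integral>\<^sup>+x. ennreal (m x * shell_kernel (s *\<^sub>R x)) \<partial>lborel) \<le> (\<integral>\<^sup>+x. ennreal (m x * shell_kernel (s *\<^sub>R x + u k)) \<partial>lborel) + E k" for k
    unfolding E abs_minus_commute[of "shell_kernel (s *\<^sub>R _ + u k)"]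
    by (subst nn_integral_add[symmetric]) (auto intro!: nn_integral_mono le' shell_kernel_nonneg)
  obtain A where "\<And>s u. (\<integral>\<^sup>+x. ennreal (m x * shell_kernel (s *\<^sub>R x + u)) \<partial>lborel) \<le> ennreal (A * (1 / (1 + s\<^sup>2)))"
    using section_bound by blast
  from this[of s 0] show "(\<integral>\<^sup>+x. ennreal (m x * shell_kernel (s *\<^sub>R x)) \<partial>lborel) \<noteq> \<top>"
    by (auto simp: top_unique)
qed

lemma line_pairing_bounded: "\<exists>A. \<forall>u. line_pairing u \<le> ennreal A"
proof -
  obtain A where A: "A \<ge> 0" "\<And>s u. (\<integral>\<^sup>+x. ennreal (m x * shell_kernel (s *\<^sub>R x + u)) \<partial>lborel) \<le> ennreal (A * (1 / (1 + s\<^sup>2)))"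
    using section_bound by blast
  have "line_pairing u \<le> (\<integral>\<^sup>+s. ennreal A * ennreal (1 / (1 + s\<^sup>2)) \<partial>lborel)" for u
    unfolding line_pairing_def using A by (intro nn_integral_mono) (simp flip: ennreal_mult)
  also have "(\<integral>\<^sup>+s. ennreal A * ennreal (1 / (1 + s\<^sup>2)) \<partial>lborel) = ennreal A * (\<integral>\<^sup>+(s::real). ennreal (1 / (1 + s\<^sup>2)) \<partial>lborel)"
    by (rule nn_integral_cmult) measurable
  finally have le: "\<And>u. line_pairing u \<le> ennreal A * (\<integral>\<^sup>+(s::real). ennreal (1 / (1 + s\<^sup>2)) \<partial>lborel)" .
  have "ennreal A * (\<integral>\<^sup>+(s::real). ennreal (1 / (1 + s\<^sup>2)) \<partial>lborel) < \<infinity>"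
    using nn_integral_inverse_1_plus_square by (simp add: ennreal_mult_less_top)
  then obtain A' where "ennreal A * (\<integral>\<^sup>+(s::real). ennreal (1 / (1 + s\<^sup>2)) \<partial>lborel) = ennreal A'"
    by (cases "ennreal A * (\<integral>\<^sup>+(s::real). ennreal (1 / (1 + s\<^sup>2)) \<partial>lborel)" rule: ennreal_cases) auto
  then show ?thesis using le by auto
qed

lemma line_pairing_continuous:
  assumes u: "u \<longlonglongrightarrow> 0"
  shows "(\<lambda>k. line_pairing (u k)) \<longlonglongrightarrow> line_pairing 0"
proof -
  obtain A where A: "A \<ge> 0" "\<And>s u. (\<integral>\<^sup>+x. ennreal (m x * shell_kernel (s *\<^sub>R x + u)) \<partial>lborel) \<le> ennreal (A * (1 / (1 + s\<^sup>2)))"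
    using section_bound by blast
  show ?thesis unfolding line_pairing_def
  proof (rule nn_integral_dominated_convergence[where w="\<lambda>s. ennreal A * ennreal (1 / (1 + s\<^sup>2))"])
    show "AE s in lborel. (\<integral>\<^sup>+x. ennreal (m x * shell_kernel (s *\<^sub>R x + u j)) \<partial>lborel) \<le> ennreal A * ennreal (1 / (1 + s\<^sup>2))" for j
      using A by (simp flip: ennreal_mult)
    show "(\<integral>\<^sup>+s. ennreal A * ennreal (1 / (1 + s\<^sup>2)) \<partial>lborel) < \<infinity>"
      using nn_integral_inverse_1_plus_square by (subst nn_integral_cmult) (auto simp: ennreal_mult_less_top)
    show "AE s in lborel. (\<lambda>k. \<integral>\<^sup>+x. ennreal (m x * shell_kernel (s *\<^sub>R x + u k)) \<partial>lborel) \<longlonglongrightarrow> (\<integral>\<^sup>+x. ennreal (m x * shell_kernel (s *\<^sub>R x + 0)) \<partial>lborel)"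
      using AE_lborel_singleton[of "0::real"] by eventually_elim (use section_continuous[OF u] in simp)
  qed measurable
qed

text \<open>On the line through x the shell kernel is g(x) bump(|x| s)/|s|. Invariance of ds/|s|
  under scaling removes |x|, so every line contributes the same constant times g(x).\<close>

lemma line_pairing_0: "line_pairing 0 = bump_mass * (\<integral>\<^sup>+x. ennreal (m x * g x) \<partial>lborel)"
proof -
  have "line_pairing 0 = (\<integral>\<^sup>+x. \<integral>\<^sup>+s. ennreal (m x * shell_kernel (s *\<^sub>R x)) \<partial>lborel \<partial>lborel)"
    unfolding line_pairing_def by (simp only: add_0_right) (rule lborel_pair.Fubini', measurable)
  also have "\<dots> = (\<integral>\<^sup>+x. bump_mass * ennreal (m x * g x) \<partial>lborel)"
  proof (rule nn_integral_cong_AE, rule AE_mp[OF AE_lborel_singleton[of "0::'a"]], intro AE_I2 impI)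
    fix x :: 'a assume x: "x \<noteq> 0"
    have "(\<integral>\<^sup>+s. ennreal (m x * shell_kernel (s *\<^sub>R x)) \<partial>lborel)
       = (\<integral>\<^sup>+s. ennreal (m x * g x) * (ennreal (1 / \<bar>s\<bar>) * ennreal (bump (norm x * s))) \<partial>lborel)"
    proof (rule nn_integral_cong_AE, rule AE_mp[OF AE_lborel_singleton[of "0::real"]], intro AE_I2 impI)
      fix s :: real assume "s \<noteq> 0"
      then have "m x * shell_kernel (s *\<^sub>R x) = (m x * g x) * (1 / \<bar>s\<bar> * bump (norm x * s))" by (simp add: shell_kernel_scale)
      then show "ennreal (m x * shell_kernel (s *\<^sub>R x)) = ennreal (m x * g x) * (ennreal (1 / \<bar>s\<bar>) * ennreal (bump (norm x * s)))"
        using m_nonneg[of x] g_nonneg[of x] bump_nonneg[of "norm x * s"] by (simp only: ennreal_mult mult_nonneg_nonneg zero_le_divide_1_iff abs_ge_zero)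
    qed
    also have "\<dots> = ennreal (m x * g x) * (\<integral>\<^sup>+s. ennreal (1 / \<bar>s\<bar>) * ennreal (bump (norm x * s)) \<partial>lborel)"
      by (rule nn_integral_cmult) measurable
    also have "(\<integral>\<^sup>+s. ennreal (1 / \<bar>s\<bar>) * ennreal (bump (norm x * s)) \<partial>lborel) = bump_mass"
      unfolding bump_mass_def using x by (intro nn_integral_haar_scale[of "\<lambda>s. ennreal (bump s)"]) auto
    finally show "(\<integral>\<^sup>+s. ennreal (m x * shell_kernel (s *\<^sub>R x)) \<partial>lborel) = bump_mass * ennreal (m x * g x)" by (simp add: mult.commute)
  qed
  also have "\<dots> = bump_mass * (\<integral>\<^sup>+x. ennreal (m x * g x) \<partial>lborel)" by (rule nn_integral_cmult) measurable
  finally show ?thesis .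
qed

lemma dyadic_increment_tendsto:
  "(\<lambda>k. dyadic_increment (2 ^ k)) \<longlonglongrightarrow>
     ennreal (sqrt (2*pi) ^ DIM('a)) * (bump_mass * (\<integral>\<^sup>+x. ennreal (m x * g x) \<partial>lborel))"
proof -
  obtain A where A: "\<And>u. line_pairing u \<le> ennreal A" using line_pairing_bounded by blast
  have g1: "(\<integral>\<^sup>+(v::'a). ennreal (exp (-((norm v)\<^sup>2)/2)) \<partial>lborel) = ennreal (sqrt (2*pi) ^ DIM('a))"
    using nn_integral_gaussian[of 1, where 'a='a] by simp
  have "(\<lambda>k. \<integral>\<^sup>+v. ennreal (exp (-((norm v)\<^sup>2)/2)) * line_pairing ((1 / 2 ^ k) *\<^sub>R v) \<partial>lborel)
      \<longlonglongrightarrow> (\<integral>\<^sup>+(v::'a). ennreal (exp (-((norm v)\<^sup>2)/2)) * line_pairing 0 \<partial>lborel)"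
  proof (rule nn_integral_dominated_convergence[where w="\<lambda>v. ennreal (exp (-((norm v)\<^sup>2)/2)) * ennreal A"])
    show "AE v in lborel. ennreal (exp (-((norm v)\<^sup>2)/2)) * line_pairing ((1 / 2 ^ j) *\<^sub>R v) \<le> ennreal (exp (-((norm v)\<^sup>2)/2)) * ennreal A" for j
      by (intro AE_I2 mult_left_mono A) simp
    show "(\<integral>\<^sup>+(v::'a). ennreal (exp (-((norm v)\<^sup>2)/2)) * ennreal A \<partial>lborel) < \<infinity>"
      by (subst nn_integral_multc) (simp_all only: g1, auto simp: ennreal_mult_less_top)
    have "(\<lambda>k. ennreal (exp (-((norm v)\<^sup>2)/2)) * line_pairing ((1 / 2 ^ k) *\<^sub>R v)) \<longlonglongrightarrow> ennreal (exp (-((norm v)\<^sup>2)/2)) * line_pairing 0" for v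
    proof (intro ennreal_tendsto_cmult line_pairing_continuous)
      have "(\<lambda>k. ((1/2) ^ k) *\<^sub>R v) \<longlonglongrightarrow> 0 *\<^sub>R v"
        by (intro tendsto_intros LIMSEQ_realpow_zero) auto
      then show "(\<lambda>k. (1 / 2 ^ k) *\<^sub>R v) \<longlonglongrightarrow> 0" by (simp add: power_divide)
    qed simp
    then show "AE v in lborel. (\<lambda>k. ennreal (exp (-((norm v)\<^sup>2)/2)) * line_pairing ((1 / 2 ^ k) *\<^sub>R v)) \<longlonglongrightarrow> ennreal (exp (-((norm v)\<^sup>2)/2)) * line_pairing 0"
      by simp
  qed measurable
  also have "(\<integral>\<^sup>+(v::'a). ennreal (exp (-((norm v)\<^sup>2)/2)) * line_pairing 0 \<partial>lborel) = ennreal (sqrt (2*pi) ^ DIM('a)) * line_pairing 0"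
    unfolding g1[symmetric] by (rule nn_integral_multc) measurable
  finally show ?thesis unfolding dyadic_increment_eq line_pairing_0 .
qed

lemma pairing_finite: "(\<integral>\<^sup>+x. ennreal (m x * g x) \<partial>lborel) < \<infinity>"
proof -
  obtain A where "line_pairing 0 \<le> ennreal A" using line_pairing_bounded by blast
  then have "line_pairing 0 < \<top>" using le_less_trans ennreal_less_top by blast
  then show ?thesis unfolding line_pairing_0 using bump_mass_pos by (auto simp: ennreal_mult_less_top)
qed

end

text \<open>Smoothing at scale \<open>T\<close> makes the pairing grow like \<open>log T\<close>; the coefficient is recovered as the
  limit of the increments between \<open>T = 2\<^sup>k\<close> and \<open>T = 2\<^sup>k\<^sup>+\<^sup>1\<close>.\<close>

lemma pairing_mono_of_smoothed_pairing_mono: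
  assumes m: "homogeneous_pairing g C m B R" and m': "homogeneous_pairing g C m' B' R'"
    and le: "\<And>T. T > 0 \<Longrightarrow> smoothed_pairing g m T \<le> smoothed_pairing g m' T"
  shows "(\<integral>\<^sup>+x. ennreal (m x * g x) \<partial>lborel) \<le> (\<integral>\<^sup>+x. ennreal (m' x * g x) \<partial>lborel)"
proof -
  interpret m: homogeneous_pairing g C m B R by fact
  interpret m': homogeneous_pairing g C m' B' R' by fact
  define c where "c = ennreal (sqrt (2*pi) ^ DIM('a)) * bump_mass"
  have c: "c \<noteq> 0" "c \<noteq> \<top>"
    unfolding c_def using bump_mass_pos bump_mass_finite by (auto simp: ennreal_mult_eq_top_iff ennreal_eq_0_iff not_le)
  let ?J = "\<lambda>k. enn2real (smoothed_pairing g m (2^k))" and ?J' = "\<lambda>k. enn2real (smoothed_pairing g m' (2^k))"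
  let ?I = "\<integral>\<^sup>+x. ennreal (m x * g x) \<partial>lborel" and ?I' = "\<integral>\<^sup>+x. ennreal (m' x * g x) \<partial>lborel"
  have fin: "smoothed_pairing g m (2^k) < \<top>" "smoothed_pairing g m' (2^k) < \<top>" for k
    using m.smoothed_pairing_finite[of "2^k"] m'.smoothed_pairing_finite[of "2^k"] by auto
  have step: "enn2real (m.dyadic_increment (2^k)) = ?J (Suc k) - ?J k" "m.dyadic_increment (2^k) < \<top>"
       "enn2real (m'.dyadic_increment (2^k)) = ?J' (Suc k) - ?J' k" "m'.dyadic_increment (2^k) < \<top>" for k
  proof -
    have 1: "smoothed_pairing g m (2^Suc k) = smoothed_pairing g m (2^k) + m.dyadic_increment (2^k)"
      using m.smoothed_pairing_double[of "2^k"] by simp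
    have 2: "smoothed_pairing g m' (2^Suc k) = smoothed_pairing g m' (2^k) + m'.dyadic_increment (2^k)"
      using m'.smoothed_pairing_double[of "2^k"] by simp
    show f1: "m.dyadic_increment (2^k) < \<top>" using fin(1)[of "Suc k"] unfolding 1 by simp
    show f2: "m'.dyadic_increment (2^k) < \<top>" using fin(2)[of "Suc k"] unfolding 2 by simp
    show "enn2real (m.dyadic_increment (2^k)) = ?J (Suc k) - ?J k"
      unfolding 1 using f1 fin(1)[of k] by (subst enn2real_plus) auto
    show "enn2real (m'.dyadic_increment (2^k)) = ?J' (Suc k) - ?J' k"
      unfolding 2 using f2 fin(2)[of k] by (subst enn2real_plus) auto
  qed
  have cI: "c * ?I < \<top>" "c * ?I' < \<top>"
    using m.pairing_finite m'.pairing_finite c by (auto simp: ennreal_mult_less_top less_top)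
  have lim: "(\<lambda>k. enn2real (m.dyadic_increment (2^k))) \<longlonglongrightarrow> enn2real (c * ?I)"
    using m.dyadic_increment_tendsto cI(1) unfolding c_def mult.assoc by (intro tendsto_enn2real) auto
  have lim': "(\<lambda>k. enn2real (m'.dyadic_increment (2^k))) \<longlonglongrightarrow> enn2real (c * ?I')"
    using m'.dyadic_increment_tendsto cI(2) unfolding c_def mult.assoc by (intro tendsto_enn2real) auto
  \<comment> \<open>The nonnegative sequence is the difference of the two pairings at T = 2^k; its
    increments converge to the difference of the two limits.\<close>
  have "0 \<le> enn2real (c * ?I') - enn2real (c * ?I)"
  proof (rule increments_limit_nonneg[of "\<lambda>k. ?J' k - ?J k"])
    show "(\<lambda>k. (?J' (Suc k) - ?J (Suc k)) - (?J' k - ?J k)) \<longlonglongrightarrow> enn2real (c * ?I') - enn2real (c * ?I)"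
      using tendsto_diff[OF lim' lim] unfolding step by (simp add: algebra_simps)
    show "?J' k - ?J k \<ge> 0" for k
      using le[of "2^k"] fin(2)[of k] by (simp add: enn2real_mono)
  qed
  then have "enn2real (c * ?I) \<le> enn2real (c * ?I')" by simp
  then have "c * ?I \<le> c * ?I'"
    by (subst ennreal_enn2real[OF cI(1), symmetric], subst ennreal_enn2real[OF cI(2), symmetric]) (rule ennreal_leI)
  then show ?thesis using c by (simp add: ennreal_mult_le_mult_iff)
qed

section \<open>Star-shaped bodies\<close>

lemma star_shaped_body_scaleR:
  assumes K: "star_shaped_body K" and x: "x \<in> K" and s: "0 \<le> s" "s \<le> 1"
  shows "s *\<^sub>R x \<in> K"
proof -
  have "s *\<^sub>R x \<in> closed_segment 0 x"
    unfolding in_segment using s by (intro exI[of _ s]) simp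
  then show ?thesis using K x by (auto simp: star_shaped_body_def)
qed

text \<open>The reciprocal of the Minkowski functional is the radial function, the largest s >= 0
  with s x in \<open>K\<close>. Compactness gives the maximum, and star-shapedness fills in
  everything below it.\<close>

lemma inv_minkowski_radial:
  fixes K :: "'a::euclidean_space set"
  assumes K: "star_shaped_body K" and x: "x \<noteq> 0"
  shows "inv_minkowski K x \<ge> 0"
    and "s \<ge> 0 \<Longrightarrow> s *\<^sub>R x \<in> K \<longleftrightarrow> s \<le> inv_minkowski K x"
proof -
  have cK: "compact K" and K0: "0 \<in> K" using K by (auto simp: star_shaped_body_def)
  obtain R where R: "\<And>y. y \<in> K \<Longrightarrow> norm y \<le> R"
    using compact_imp_bounded[OF cK] by (auto simp: bounded_iff)
  define S where "S = {s. 0 \<le> s \<and> s *\<^sub>R x \<in> K}"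
  have "closed S"
  proof -
    have "S = {0..} \<inter> (\<lambda>s. s *\<^sub>R x) -` K" by (auto simp: S_def)
    moreover have "closed ((\<lambda>s. s *\<^sub>R x) -` K)"
      by (intro closed_vimage compact_imp_closed cK continuous_intros)
    ultimately show ?thesis by (simp add: closed_Int)
  qed
  moreover have "bounded S"
  proof -
    have "\<bar>s\<bar> \<le> R / norm x" if "s \<in> S" for s
      using R[of "s *\<^sub>R x"] that x by (auto simp: S_def field_simps)
    then show ?thesis by (auto simp: bounded_iff)
  qed
  ultimately have "compact S" by (simp add: compact_eq_bounded_closed)
  moreover have "0 \<in> S" using K0 by (simp add: S_def)
  ultimately obtain \<sigma> where \<sigma>: "\<sigma> \<in> S" "\<And>s. s \<in> S \<Longrightarrow> s \<le> \<sigma>"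
    using compact_attains_sup[of S] by auto
  have \<sigma>0: "\<sigma> \<ge> 0" and \<sigma>K: "\<sigma> *\<^sub>R x \<in> K" using \<sigma>(1) by (auto simp: S_def)
  define A where "A = {a. 0 < a \<and> x \<in> (\<lambda>y. a *\<^sub>R y) ` K}"
  have A: "a \<in> A \<longleftrightarrow> 0 < a \<and> (1/a) *\<^sub>R x \<in> K" for a
  proof
    assume "a \<in> A"
    then show "0 < a \<and> (1/a) *\<^sub>R x \<in> K" by (auto simp: A_def)
  next
    assume a: "0 < a \<and> (1/a) *\<^sub>R x \<in> K"
    then have "x = a *\<^sub>R ((1/a) *\<^sub>R x)" by simp
    then show "a \<in> A" using a unfolding A_def by blast
  qed
  have mf: "minkowski_functional K x = (INF a\<in>A. ereal a)"
    by (simp add: minkowski_functional_def A_def)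
  have eq: "inv_minkowski K x = \<sigma>"
  proof (cases "\<sigma> = 0")
    case True
    \<comment> \<open>No positive multiple of x lies in \<open>K\<close>: the infimum over the empty
      set is infinite, and its inverse is 0.\<close>
    have "A = {}"
    proof (rule ccontr)
      assume "A \<noteq> {}"
      then obtain a where "0 < a" "(1/a) *\<^sub>R x \<in> K" using A by blast
      then have "1/a \<le> \<sigma>" by (intro \<sigma>(2)) (simp add: S_def)
      with True \<open>0 < a\<close> show False by (simp add: field_simps)
    qed
    then show ?thesis unfolding inv_minkowski_def mf by (simp add: True top_ereal_def)
  next
    case False
    then have \<sigma>p: "\<sigma> > 0" using \<sigma>0 by simp
    have "minkowski_functional K x = ereal (1/\<sigma>)" unfolding mf
    proof (rule antisym)
      show "(INF a\<in>A. ereal a) \<le> ereal (1/\<sigma>)"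
        using \<sigma>p \<sigma>K by (intro INF_lower) (simp add: A)
      show "ereal (1/\<sigma>) \<le> (INF a\<in>A. ereal a)"
      proof (rule INF_greatest)
        fix a assume "a \<in> A"
        then have a: "0 < a" "(1/a) *\<^sub>R x \<in> K" by (auto simp: A)
        then have "1/a \<le> \<sigma>" by (intro \<sigma>(2)) (simp add: S_def)
        then show "ereal (1/\<sigma>) \<le> ereal a" using a \<sigma>p by (simp add: field_simps)
      qed
    qed
    then show ?thesis using \<sigma>p by (simp add: inv_minkowski_def)
  qed
  show "inv_minkowski K x \<ge> 0" using eq \<sigma>0 by simp
  show "s *\<^sub>R x \<in> K \<longleftrightarrow> s \<le> inv_minkowski K x" if s: "s \<ge> 0" for s
  proof
    assume "s *\<^sub>R x \<in> K" then show "s \<le> inv_minkowski K x" using s \<sigma>(2) eq by (simp add: S_def)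
  next
    assume le: "s \<le> inv_minkowski K x"
    show "s *\<^sub>R x \<in> K"
    proof (cases "\<sigma> = 0")
      case True then show ?thesis using le eq s K0 by simp
    next
      case False
      then have "s *\<^sub>R x = (s/\<sigma>) *\<^sub>R (\<sigma> *\<^sub>R x)" by simp
      also have "\<dots> \<in> K" using le eq s \<sigma>0 False by (intro star_shaped_body_scaleR[OF K \<sigma>K]) (auto simp: field_simps)
      finally show ?thesis .
    qed
  qed
qed

text \<open>The functional is 0 at the origin, its inverse in \<open>ereal\<close> is infinite, and
  \<open>real_of_ereal\<close> maps that to the default value 0.\<close>

lemma inv_minkowski_0:
  assumes "star_shaped_body K"
  shows "inv_minkowski K 0 = 0"
proof -
  have "0 \<in> K" using assms by (simp add: star_shaped_body_def)
  then have eq: "{a. 0 < a \<and> 0 \<in> (\<lambda>y. a *\<^sub>R y) ` K} = {0<..}" by (force simp: image_iff)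
  have "(INF a\<in>{0<..}. ereal a) = 0"
  proof (rule antisym)
    show "(INF a\<in>{0<..}. ereal a) \<le> 0"
    proof (rule ereal_le_epsilon2)
      fix e :: real assume "0 < e"
      then show "(INF a\<in>{0<..}. ereal a) \<le> 0 + ereal e" by (intro INF_lower2[of e]) auto
    qed
  qed (auto intro!: INF_greatest)
  then show ?thesis by (simp add: inv_minkowski_def minkowski_functional_def eq)
qed

lemma inv_minkowski_eqI:
  fixes K :: "'a::euclidean_space set"
  assumes K: "star_shaped_body K" and x: "x \<noteq> 0" and r: "r \<ge> 0" "\<And>s. s \<ge> 0 \<Longrightarrow> s *\<^sub>R x \<in> K \<longleftrightarrow> s \<le> r"
  shows "inv_minkowski K x = r"
  using inv_minkowski_radial[OF K x] r by (metis order_antisym order_refl)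

lemma inv_minkowski_scaleR:
  fixes K :: "'a::euclidean_space set"
  assumes K: "star_shaped_body K" "origin_symmetric K" and c: "c \<noteq> 0"
  shows "inv_minkowski K (c *\<^sub>R x) = inv_minkowski K x / \<bar>c\<bar>"
proof (cases "x = 0")
  case True then show ?thesis using inv_minkowski_0[OF K(1)] by simp
next
  case False
  have sym: "y \<in> K \<longleftrightarrow> - y \<in> K" for y
    using K(2) unfolding origin_symmetric_def by (metis image_eqI minus_minus)
  show ?thesis
  proof (rule inv_minkowski_eqI[OF K(1)])
    fix s :: real assume s: "s \<ge> 0"
    have "s *\<^sub>R c *\<^sub>R x \<in> K \<longleftrightarrow> (s * \<bar>c\<bar>) *\<^sub>R x \<in> K"
      using sym[of "(s * c) *\<^sub>R x"] by (cases "c > 0") auto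
    also have "\<dots> \<longleftrightarrow> s * \<bar>c\<bar> \<le> inv_minkowski K x"
      using s by (intro inv_minkowski_radial(2)[OF K(1) False]) auto
    finally show "s *\<^sub>R c *\<^sub>R x \<in> K \<longleftrightarrow> s \<le> inv_minkowski K x / \<bar>c\<bar>"
      using c by (simp add: pos_le_divide_eq)
  qed (use c False inv_minkowski_radial(1)[OF K(1) False] in auto)
qed

lemma inv_minkowski_measurable:
  fixes K :: "'a::euclidean_space set"
  assumes K: "star_shaped_body K"
  shows "inv_minkowski K \<in> borel_measurable borel"
proof (rule borel_measurableI_ge)
  fix y :: real
  have "compact K" using K by (simp add: star_shaped_body_def)
  then have [measurable]: "K \<in> sets borel" by (simp add: borel_compact)
  have nn: "inv_minkowski K x \<ge> 0" for x
    using inv_minkowski_0[OF K] inv_minkowski_radial(1)[OF K] by (cases "x = 0") auto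
  show "{x \<in> space borel. y \<le> inv_minkowski K x} \<in> sets borel"
  proof (cases "y \<le> 0")
    case True
    then have "{x \<in> space borel. y \<le> inv_minkowski K x} = UNIV" using nn order_trans by auto
    then show ?thesis by simp
  next
    case False
    \<comment> \<open>For y > 0 a superlevel set is the preimage of \<open>K\<close> under scaling
      by y with the origin removed: 0 lies in \<open>K\<close>, but the default value there is
      0.\<close>
    then have "y \<le> inv_minkowski K x \<longleftrightarrow> x \<noteq> 0 \<and> y *\<^sub>R x \<in> K" for x
      using inv_minkowski_0[OF K] inv_minkowski_radial(2)[OF K, of x y] by (cases "x = 0") auto
    then have "{x \<in> space borel. y \<le> inv_minkowski K x} = {x \<in> space borel. x \<noteq> 0 \<and> y *\<^sub>R x \<in> K}"
      by simp
    also have "\<dots> \<in> sets borel" by measurable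
    finally show ?thesis .
  qed
qed

text \<open>The hyperplane measure is formally a measure on the whole space. The slab formula
  evaluates its integrand only at orthogonal projections, all of which lie in the hyperplane, so the
  indicator changes nothing.\<close>

lemma nn_integral_subspace_lborel_carrier:
  fixes \<xi> :: "'a::euclidean_space" and F :: "'a \<Rightarrow> ennreal"
  assumes \<xi>: "norm \<xi> = 1" and [measurable]: "F \<in> borel_measurable borel"
  shows "(\<integral>\<^sup>+x. F x * indicator (hyperplane_perp \<xi>) x \<partial>subspace_lborel (hyperplane_perp \<xi>))
       = (\<integral>\<^sup>+x. F x \<partial>subspace_lborel (hyperplane_perp \<xi>))"
proof -
  have \<xi>0: "\<xi> \<noteq> 0" using \<xi> by auto
  let ?k = "indicator {0..1} :: real \<Rightarrow> ennreal"
  let ?P = "\<lambda>y. y - ((\<xi> \<bullet> y) / (norm \<xi>)\<^sup>2) *\<^sub>R \<xi>"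
  have [measurable]: "hyperplane_perp \<xi> \<in> sets borel" unfolding hyperplane_perp_def by measurable
  have P: "?P y \<in> hyperplane_perp \<xi>" for y
    using \<xi> norm_eq_1[of \<xi>] by (simp add: hyperplane_perp_def inner_diff_right)
  have *: "(\<integral>\<^sup>+x. F x \<partial>subspace_lborel (hyperplane_perp \<xi>)) = (\<integral>\<^sup>+y. ?k (\<xi> \<bullet> y) * F (?P y) \<partial>lborel)"
    if [measurable]: "F \<in> borel_measurable borel" for F
    by (subst nn_integral_hyperplane_slab[OF \<xi>0]) (simp_all add: \<xi>)
  have m: "(\<lambda>x. F x * indicator (hyperplane_perp \<xi>) x) \<in> borel_measurable borel" by measurable
  show ?thesis
    unfolding *[OF m] *[OF assms(2)] using P by simp
qed

lemma emeasure_mu_perp: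
  fixes f :: "'a::euclidean_space \<Rightarrow> real"
  assumes \<xi>: "norm \<xi> = 1" and [measurable]: "f \<in> borel_measurable borel" "A \<in> sets borel"
  shows "emeasure (mu_perp f \<xi>) (A \<inter> hyperplane_perp \<xi>)
     = (\<integral>\<^sup>+x. ennreal (indicator A x * f x) \<partial>subspace_lborel (hyperplane_perp \<xi>))"
proof -
  have [measurable]: "hyperplane_perp \<xi> \<in> sets borel" unfolding hyperplane_perp_def by measurable
  have "emeasure (mu_perp f \<xi>) (A \<inter> hyperplane_perp \<xi>)
     = (\<integral>\<^sup>+x. ennreal (f x) * indicator (A \<inter> hyperplane_perp \<xi>) x \<partial>subspace_lborel (hyperplane_perp \<xi>))"
    unfolding mu_perp_def by (rule emeasure_density) measurable
  also have "\<dots> = (\<integral>\<^sup>+x. ennreal (indicator A x * f x) * indicator (hyperplane_perp \<xi>) x \<partial>subspace_lborel (hyperplane_perp \<xi>))"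
    by (intro nn_integral_cong) (auto simp: indicator_def)
  also have "\<dots> = (\<integral>\<^sup>+x. ennreal (indicator A x * f x) \<partial>subspace_lborel (hyperplane_perp \<xi>))"
    by (rule nn_integral_subspace_lborel_carrier[OF \<xi>]) measurable
  finally show ?thesis .
qed

section \<open>Comparison of the two bodies\<close>

theorem theorem1:
  fixes f\<^sub>n f\<^sub>n\<^sub>1 :: "real ^ 'n \<Rightarrow> real"
    and K L :: "(real ^ 'n) set"
  assumes dim: "CARD('n) \<ge> 2"
    and f\<^sub>n: "continuous_on UNIV f\<^sub>n" "\<And>x. f\<^sub>n (- x) = f\<^sub>n x" "\<And>x. f\<^sub>n x \<ge> 0"
    and f\<^sub>n\<^sub>1: "continuous_on UNIV f\<^sub>n\<^sub>1" "\<And>x. f\<^sub>n\<^sub>1 (- x) = f\<^sub>n\<^sub>1 x" "\<And>x. f\<^sub>n\<^sub>1 x \<ge> 0"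
    and quotient_defined: "\<And>x t. x \<in> sphere 0 1 \<Longrightarrow> t > 0 \<Longrightarrow> f\<^sub>n\<^sub>1 (t *\<^sub>R x) \<noteq> 0"
    and increasing: "\<And>x. x \<in> sphere 0 1 \<Longrightarrow>
          mono_on {0<..} (\<lambda>t. t * (f\<^sub>n (t *\<^sub>R x) / f\<^sub>n\<^sub>1 (t *\<^sub>R x)))"
    and K: "star_shaped_body K" "origin_symmetric K"
    and pos_def: "positive_definite_distribution (function_distribution
          (\<lambda>x. inv_minkowski K x *
             (f\<^sub>n (inv_minkowski K x *\<^sub>R x) / f\<^sub>n\<^sub>1 (inv_minkowski K x *\<^sub>R x))))"
    and L: "star_shaped_body L" "origin_symmetric L"
    and sections: "\<And>\<xi>. \<xi> \<in> sphere 0 1 \<Longrightarrow>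
          emeasure (mu_perp f\<^sub>n\<^sub>1 \<xi>) (K \<inter> hyperplane_perp \<xi>)
            \<le> emeasure (mu_perp f\<^sub>n\<^sub>1 \<xi>) (L \<inter> hyperplane_perp \<xi>)"
  shows "emeasure (mu f\<^sub>n) K \<le> emeasure (mu f\<^sub>n) L"
proof -
  define \<rho> where "\<rho> = inv_minkowski K"
  define \<phi> where "\<phi> x = f\<^sub>n x / f\<^sub>n\<^sub>1 x" for x
  define g where "g x = \<rho> x * \<phi> (\<rho> x *\<^sub>R x)" for x
  have cK: "compact K" "compact L" using K L by (auto simp: star_shaped_body_def)
  have [measurable]: "K \<in> sets borel" "L \<in> sets borel" using cK by (auto simp: borel_compact)
  have [measurable]: "f\<^sub>n \<in> borel_measurable borel" "f\<^sub>n\<^sub>1 \<in> borel_measurable borel"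
    using f\<^sub>n(1) f\<^sub>n\<^sub>1(1) by (auto intro: borel_measurable_continuous_onI)
  have [measurable]: "\<rho> \<in> borel_measurable borel" unfolding \<rho>_def by (rule inv_minkowski_measurable[OF K(1)])
  have [measurable]: "\<phi> \<in> borel_measurable borel" unfolding \<phi>_def by measurable
  have gm[measurable]: "g \<in> borel_measurable borel" unfolding g_def by measurable
  have \<phi>0: "\<phi> x \<ge> 0" for x using f\<^sub>n(3) f\<^sub>n\<^sub>1(3) by (simp add: \<phi>_def)
  have \<rho>0: "\<rho> x \<ge> 0" for x
    using inv_minkowski_0[OF K(1)] inv_minkowski_radial(1)[OF K(1)] unfolding \<rho>_def by (cases "x = 0") auto
  have g0: "g x \<ge> 0" for x using \<rho>0 \<phi>0 by (simp add: g_def)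
  have f1pos: "f\<^sub>n\<^sub>1 x > 0" if "x \<noteq> 0" for x
  proof -
    have "f\<^sub>n\<^sub>1 (norm x *\<^sub>R ((1 / norm x) *\<^sub>R x)) \<noteq> 0" using that by (intro quotient_defined) auto
    then show ?thesis using that f\<^sub>n\<^sub>1(3)[of x] by simp
  qed
  \<comment> \<open>Monotonicity is assumed along unit vectors; with radii a|x| and b|x| the common
    factor |x| cancels and any nonzero x is allowed.\<close>
  have mono: "a * \<phi> (a *\<^sub>R x) \<le> b * \<phi> (b *\<^sub>R x)" if "0 < a" "a \<le> b" "x \<noteq> 0" for a b x
  proof -
    let ?\<theta> = "(1 / norm x) *\<^sub>R x"
    have "(a * norm x) * \<phi> ((a * norm x) *\<^sub>R ?\<theta>) \<le> (b * norm x) * \<phi> ((b * norm x) *\<^sub>R ?\<theta>)"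
      unfolding \<phi>_def using that
      by (intro mono_onD[OF increasing[of ?\<theta>], of "a * norm x" "b * norm x"]) auto
    then have "norm x * (a * \<phi> (a *\<^sub>R x)) \<le> norm x * (b * \<phi> (b *\<^sub>R x))"
      using that by (simp add: mult_ac)
    then show ?thesis using that by simp
  qed
  have g_hom: "g (c *\<^sub>R x) = g x / \<bar>c\<bar>" if c: "c \<noteq> 0" for c x
  proof -
    have "\<phi> (- y) = \<phi> y" for y by (simp add: \<phi>_def f\<^sub>n(2) f\<^sub>n\<^sub>1(2))
    then have "\<phi> ((\<rho> x / \<bar>c\<bar>) *\<^sub>R c *\<^sub>R x) = \<phi> (\<rho> x *\<^sub>R x)"
      using c by (cases "c > 0") auto
    then show ?thesis unfolding g_def \<rho>_def using inv_minkowski_scaleR[OF K c] by (simp add: \<rho>_def)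
  qed
  \<comment> \<open>If \<open>K\<close> lies in the ball of radius \<open>R\<close>, then \<rho>(x)
    <= R/|x|. By monotonicity g(x) is at most its analogue with radius R/|x|, which is 1/|x| times a
    continuous function on the compact sphere.\<close>
  obtain C where g_le: "\<And>x. g x \<le> C / norm x"
  proof -
    obtain R0 where R0: "\<And>y. y \<in> K \<Longrightarrow> norm y \<le> R0"
      using compact_imp_bounded[OF cK(1)] by (auto simp: bounded_iff)
    \<comment> \<open>The maximum with 1 makes \<open>R\<close> positive, so that the quotient is
      evaluated away from the origin, where \<open>f\<^sub>n\<^sub>1\<close> might vanish.\<close>
    define R where "R = max R0 1"
    have R: "R > 0" "\<And>y. y \<in> K \<Longrightarrow> norm y \<le> R" using R0 by (force simp: R_def)+
    have "continuous_on (sphere 0 1) (\<lambda>\<theta>::real^'n. R * \<phi> (R *\<^sub>R \<theta>))"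
      unfolding \<phi>_def using quotient_defined R(1)
      by (intro continuous_intros continuous_on_compose2[OF f\<^sub>n(1)] continuous_on_compose2[OF f\<^sub>n\<^sub>1(1)]) auto
    then have "bounded ((\<lambda>\<theta>::real^'n. R * \<phi> (R *\<^sub>R \<theta>)) ` sphere 0 1)"
      by (intro compact_imp_bounded compact_continuous_image) auto
    then obtain C where "\<forall>y\<in>(\<lambda>\<theta>::real^'n. R * \<phi> (R *\<^sub>R \<theta>)) ` sphere 0 1. norm y \<le> C"
      unfolding bounded_iff by blast
    then have C: "\<bar>R * \<phi> (R *\<^sub>R \<theta>)\<bar> \<le> C" if "\<theta> \<in> sphere 0 1" for \<theta>
      using that by auto
    have "g x \<le> C / norm x" for x
    proof (cases "x = 0 \<or> \<rho> x = 0")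
      case True
      obtain b :: "real^'n" where "b \<in> Basis" using nonempty_Basis by blast
      then have "0 \<le> C" using C[of b] by (simp add: order_trans[OF abs_ge_zero])
      then show ?thesis using True inv_minkowski_0[OF K(1)] by (auto simp: g_def \<rho>_def)
    next
      case False
      then have x: "x \<noteq> 0" and \<rho>: "\<rho> x > 0" using \<rho>0[of x] by auto
      have "\<rho> x *\<^sub>R x \<in> K" using inv_minkowski_radial(2)[OF K(1) x, of "\<rho> x"] \<rho> by (simp add: \<rho>_def)
      then have "\<rho> x \<le> R / norm x" using R(2)[of "\<rho> x *\<^sub>R x"] \<rho> x by (simp add: field_simps)
      then have "g x \<le> (R / norm x) * \<phi> ((R / norm x) *\<^sub>R x)"
        unfolding g_def using \<rho> x by (intro mono) auto
      also have "\<dots> = (R * \<phi> (R *\<^sub>R ((1 / norm x) *\<^sub>R x))) / norm x" by simp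
      also have "\<dots> \<le> C / norm x"
        using C[of "(1 / norm x) *\<^sub>R x"] x by (intro divide_right_mono) auto
      finally show ?thesis .
    qed
    then show thesis by (rule that)
  qed
  have pd: "positive_definite_distribution (function_distribution g)"
    using pos_def unfolding g_def \<rho>_def \<phi>_def .
  have dimv: "DIM(real^'n) \<ge> 2" using dim by simp
  have hp: "\<exists>B R. homogeneous_pairing g C (\<lambda>x. indicator A x * f\<^sub>n\<^sub>1 x) B R" if A: "compact A" for A
  proof -
    have [measurable]: "A \<in> sets borel" using A by (simp add: borel_compact)
    obtain R where R: "\<And>x. x \<in> A \<Longrightarrow> norm x \<le> R"
      using compact_imp_bounded[OF A] by (auto simp: bounded_iff)
    have "bounded (f\<^sub>n\<^sub>1 ` A)"
      using A f\<^sub>n\<^sub>1(1) by (intro compact_imp_bounded compact_continuous_image) (auto intro: continuous_on_subset)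
    then obtain B where B: "\<And>x. x \<in> A \<Longrightarrow> \<bar>f\<^sub>n\<^sub>1 x\<bar> \<le> B" by (auto simp: bounded_iff)
    have "homogeneous_pairing g C (\<lambda>x. indicator A x * f\<^sub>n\<^sub>1 x) (max B 0) R"
    proof (unfold_locales)
      show "indicator A x * f\<^sub>n\<^sub>1 x \<le> max B 0" for x using B[of x] by (auto simp: indicator_def)
      show "indicator A x * f\<^sub>n\<^sub>1 x = 0" if "norm x > R" for x using R[of x] that by (auto simp: indicator_def)
    qed (use dimv g0 g_le g_hom f\<^sub>n\<^sub>1(3) in \<open>auto simp: indicator_def\<close>)
    then show ?thesis by blast
  qed
  obtain B R where hK: "homogeneous_pairing g C (\<lambda>x. indicator K x * f\<^sub>n\<^sub>1 x) B R" using hp[OF cK(1)] by blast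
  obtain B' R' where hL: "homogeneous_pairing g C (\<lambda>x. indicator L x * f\<^sub>n\<^sub>1 x) B' R'" using hp[OF cK(2)] by blast
  let ?G = "\<lambda>A. \<integral>\<^sup>+x. ennreal (indicator A x * f\<^sub>n\<^sub>1 x * g x) \<partial>lborel"
  let ?F = "\<lambda>A. \<integral>\<^sup>+x. ennreal (indicator A x * f\<^sub>n x) \<partial>lborel"
  have GKL: "?G K \<le> ?G L"
  proof (rule pairing_mono_of_smoothed_pairing_mono[OF hK hL])
    fix T :: real assume T: "T > 0"
    show "smoothed_pairing g (\<lambda>x. indicator K x * f\<^sub>n\<^sub>1 x) T \<le> smoothed_pairing g (\<lambda>x. indicator L x * f\<^sub>n\<^sub>1 x) T"
    proof (rule smoothed_pairing_mono_sections[OF dimv pd gm g0 g_le _ _ T])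
      fix \<xi> :: "real^'n" assume \<xi>: "norm \<xi> = 1"
      show "(\<integral>\<^sup>+x. ennreal (indicator K x * f\<^sub>n\<^sub>1 x) \<partial>subspace_lborel (hyperplane_perp \<xi>))
         \<le> (\<integral>\<^sup>+x. ennreal (indicator L x * f\<^sub>n\<^sub>1 x) \<partial>subspace_lborel (hyperplane_perp \<xi>))"
        using sections[of \<xi>] \<xi> by (simp add: emeasure_mu_perp)
    qed measurable
  qed
  have GL: "?G L < \<infinity>" by (rule homogeneous_pairing.pairing_finite[OF hL])
  have inK: "f\<^sub>n x \<le> f\<^sub>n\<^sub>1 x * g x" if "x \<noteq> 0" "x \<in> K" for x
  proof -
    have "1 \<le> \<rho> x" using inv_minkowski_radial(2)[OF K(1) that(1), of 1] that(2) by (simp add: \<rho>_def)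
    then have "1 * \<phi> (1 *\<^sub>R x) \<le> g x" unfolding g_def using that(1) by (intro mono) auto
    then show ?thesis using f1pos[OF that(1)] by (simp add: \<phi>_def field_simps)
  qed
  have outK: "f\<^sub>n\<^sub>1 x * g x \<le> f\<^sub>n x" if "x \<noteq> 0" "x \<notin> K" for x
  proof -
    have "\<rho> x < 1" using inv_minkowski_radial(2)[OF K(1) that(1), of 1] that(2) by (simp add: \<rho>_def)
    have "g x \<le> 1 * \<phi> (1 *\<^sub>R x)"
    proof (cases "\<rho> x = 0")
      case True then show ?thesis using \<phi>0 by (simp add: g_def)
    next
      case False
      then show ?thesis unfolding g_def using that(1) \<rho>0[of x] \<open>\<rho> x < 1\<close> by (intro mono) auto
    qed
    then show ?thesis using f1pos[OF that(1)] by (simp add: \<phi>_def field_simps)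
  qed
  \<comment> \<open>The comparison is added rather than subtracted, to stay within
    \<open>ennreal\<close>. Only points in exactly one body matter: \<open>inK\<close> covers those
    of \<open>K\<close> outside \<open>L\<close>, and \<open>outK\<close> those of \<open>L\<close>
    outside \<open>K\<close>. The finite term \<open>?G L\<close> is cancelled at the end.\<close>
  have "?F K + ?G L = (\<integral>\<^sup>+x. ennreal (indicator K x * f\<^sub>n x) + ennreal (indicator L x * f\<^sub>n\<^sub>1 x * g x) \<partial>lborel)"
    by (rule nn_integral_add[symmetric]) measurable
  also have "\<dots> \<le> (\<integral>\<^sup>+x. ennreal (indicator L x * f\<^sub>n x) + ennreal (indicator K x * f\<^sub>n\<^sub>1 x * g x) \<partial>lborel)"
  proof (rule nn_integral_mono_AE, rule AE_mp[OF AE_lborel_singleton[of "0::real^'n"]], intro AE_I2 impI)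
    fix x :: "real^'n" assume x: "x \<noteq> 0"
    show "ennreal (indicator K x * f\<^sub>n x) + ennreal (indicator L x * f\<^sub>n\<^sub>1 x * g x)
      \<le> ennreal (indicator L x * f\<^sub>n x) + ennreal (indicator K x * f\<^sub>n\<^sub>1 x * g x)"
      using inK[OF x] outK[OF x]
      by (cases "x \<in> K"; cases "x \<in> L") (auto intro: ennreal_leI)
  qed
  also have "\<dots> = ?F L + ?G K"
    by (rule nn_integral_add) measurable
  also have "\<dots> \<le> ?F L + ?G L" by (intro add_left_mono GKL)
  finally have "?G L + ?F K \<le> ?G L + ?F L" by (simp only: add.commute)
  then have "?F K \<le> ?F L" using GL by (auto simp: ennreal_add_left_cancel_le)
  moreover have "emeasure (mu f\<^sub>n) A = ?F A" if [measurable]: "A \<in> sets borel" for A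
    unfolding mu_def
    by (subst emeasure_density) (auto intro!: nn_integral_cong simp: indicator_def)
  ultimately show ?thesis by simp
qed

end
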